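(* Let $X=\{X(t),t\ge0\}$ be a real-valued symmetric unimodal pure-jump Lévy process whose characteristic exponent $\psi$ satisfies $\psi\in\mathrm{WLSC}(\alpha,\underline{\theta},\underline{c})\cap\mathrm{WUSC}(\alpha,\overline{\theta},\overline{C})$ with $\alpha>1$ and some constants $\underline{\theta},\overline{\theta}\ge0$, $\underline{c}\in(0,1]$, $\overline{C}\in[1,\infty)$. Let $L$ be its jointly continuous local time, and for an interval $I\subset[0,\infty)$ let $L^*(I)=\sup_{x\in\mathbb{R}}L(x,I)$. Fix $\tau>0$ and $N>0$. Then, almost surely, $$\limsup_{r\to0}\frac{L^{*}([\tau-r,\tau+r])}{r^{1-\frac1\alpha}(\ln\ln r^{-1})^{\frac1\alpha}}<\infty,$$ and, almost surely, $$\limsup_{r\to0}\ \sup_{I\subset[0,N],\ m(I)<r}\frac{L^{*}(I)}{r^{1-\frac1\alpha}(\ln r^{-1})^{\frac1\alpha}}<\infty,$$ where the supremum is over intervals $I$ and $m$ denotes Lebesgue measure.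
   Context: Probabilities are under $\mathbb{P}=\mathbb{P}^0$, the law of $X$ started at $0$. The characteristic exponent $\psi$ is defined by $\mathbb{E}^0[e^{i\lambda X(t)}]=e^{-t\psi(\lambda)}$. $X$ is symmetric if $X$ and $-X$ have the same law under $\mathbb{P}^0$; then $\psi$ is real-valued and even. "Pure jump" means that the Gaussian part of $X$ vanishes, i.e. $\psi(\lambda)=2\int_0^\infty(1-\cos(x\lambda))\,\nu(dx)$ with $\nu$ the Lévy measure. A Borel measure $\mu$ on $\mathbb{R}$ is unimodal with mode $a$ if $\mu=c\,\delta_a+f(x)\,dx$ with $c\ge0$ and $f$ increasing on $(-\infty,a)$ and decreasing on $(a,\infty)$. A symmetric Lévy process $X$ is called unimodal if the distribution of $X(t)$ is unimodal for all $t>0$ (equivalently, its Lévy measure $\nu$ is unimodal). Weak scaling conditions, for $\psi:[0,\infty)\to[0,\infty)$: $\psi\in\mathrm{WLSC}(\underline{\alpha},\underline{\theta},\underline{c})$, where $\underline{\alpha}\in\mathbb{R}$, $\underline{\theta}\ge0$, $\underline{c}\in(0,1]$, means $\psi(\lambda\theta)\ge\underline{c}\,\lambda^{\underline{\alpha}}\psi(\theta)$ for all $\lambda\ge1$ and $\theta>\underline{\theta}$. $\psi\in\mathrm{WUSC}(\overline{\alpha},\overline{\theta},\overline{C})$, where $\overline{\alpha}\in\mathbb{R}$, $\overline{\theta}\ge0$, $\overline{C}\in[1,\infty)$, means $\psi(\lambda\theta)\le\overline{C}\,\lambda^{\overline{\alpha}}\psi(\theta)$ for all $\lambda\ge1$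 and $\theta>\overline{\theta}$. These are applied to the restriction of the characteristic exponent to $[0,\infty)$. Local time: for a Borel set $A\subset[0,\infty)$ the occupation measure is $\mu_A(\cdot)=m(\{t\in A:X(t)\in\cdot\})$; if $\mu_A\ll m$, then $L(x,A)=\frac{d\mu_A}{dm}(x)$. Write $L(x,t)=L(x,[0,t])$. The jointly continuous local time is the modification for which $(x,t)\mapsto L(x,t)$ is continuous; for an interval $I$ with endpoints $a\le b$ one has $L(x,I)=L(x,b)-L(x,a)$. *)

theory Defs
  imports "HOL-Probability.Probability"
begin

definition cadlag :: "(real \<Rightarrow> real) \<Rightarrow> bool" where
  "cadlag f \<longleftrightarrow>
     (\<forall>t\<ge>0. continuous (at_right t) f) \<and> (\<forall>t>0. \<exists>l. (f \<longlongrightarrow> l) (at_left t))"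

(* Time runs over [0, \<infinity>); the values X t for t < 0 are irrelevant. The assumption
   X 0 = 0 a.s. makes M play the role of the law \<P>^0. *)
locale levy_process = prob_space M for M :: "'a measure" +
  fixes X :: "real \<Rightarrow> 'a \<Rightarrow> real"
  assumes rv: "\<And>t. 0 \<le> t \<Longrightarrow> random_variable borel (X t)"
    and start_zero: "AE \<omega> in M. X 0 \<omega> = 0"
    and indep_increments:
      "\<And>(n::nat) (t::nat \<Rightarrow> real). \<lbrakk>0 \<le> t 0; \<And>i. i < n \<Longrightarrow> t i < t (Suc i)\<rbrakk> \<Longrightarrow>
         indep_vars (\<lambda>_. borel) (\<lambda>i \<omega>. X (t (Suc i)) \<omega> - X (t i) \<omega>) {..<n}"
    and stationary_increments:
      "\<And>s h. \<lbrakk>0 \<le> s; 0 \<le> h\<rbrakk> \<Longrightarrow>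
         distr M borel (\<lambda>\<omega>. X (s + h) \<omega> - X s \<omega>) = distr M borel (X h)"
    and cadlag_paths: "AE \<omega> in M. cadlag (\<lambda>t. X t \<omega>)"

(* X and -X have the same law as processes, i.e. on \<real>^[0, \<infinity>) with the product sigma-algebra. *)
definition symmetric_process :: "'a measure \<Rightarrow> (real \<Rightarrow> 'a \<Rightarrow> real) \<Rightarrow> bool" where
  "symmetric_process M X \<longleftrightarrow>
     distr M (\<Pi>\<^sub>M t\<in>{0..}. borel) (\<lambda>\<omega>. \<lambda>t\<in>{0..}. X t \<omega>) =
     distr M (\<Pi>\<^sub>M t\<in>{0..}. borel) (\<lambda>\<omega>. \<lambda>t\<in>{0..}. - X t \<omega>)"

definition has_char_exponent ::
    "'a measure \<Rightarrow> (real \<Rightarrow> 'a \<Rightarrow> real) \<Rightarrow> (real \<Rightarrow> complex) \<Rightarrow> bool" where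
  "has_char_exponent M X \<psi> \<longleftrightarrow>
     (\<forall>t\<ge>0. \<forall>\<xi>. char (distr M borel (X t)) \<xi> = exp (- (complex_of_real t * \<psi> \<xi>)))"

definition levy_measure :: "real measure \<Rightarrow> bool" where
  "levy_measure \<nu> \<longleftrightarrow> sets \<nu> = sets borel \<and> emeasure \<nu> {0} = 0 \<and>
     (\<integral>\<^sup>+x. ennreal (min 1 (x\<^sup>2)) \<partial>\<nu>) < \<infinity>"

(* The exponent of a symmetric Levy process without Gaussian part; by uniqueness in the
   Levy-Khintchine formula, \<nu> is the Levy measure of the process. *)
definition pure_jump_exponent :: "(real \<Rightarrow> real) \<Rightarrow> bool" where
  "pure_jump_exponent \<psi> \<longleftrightarrow>
     (\<exists>\<nu>. levy_measure \<nu> \<and> distr \<nu> borel uminus = \<nu> \<and>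
       (\<forall>\<xi>. \<psi> \<xi> = 2 * (LINT x:{0<..}|\<nu>. 1 - cos (x * \<xi>))))"

definition unimodal_with_mode :: "real measure \<Rightarrow> real \<Rightarrow> bool" where
  "unimodal_with_mode \<mu> a \<longleftrightarrow> sets \<mu> = sets borel \<and>
     (\<exists>c f. 0 \<le> c \<and> f \<in> borel_measurable borel \<and> (\<forall>x. 0 \<le> f x) \<and>
        mono_on {..<a} f \<and> antimono_on {a<..} f \<and>
        (\<forall>A\<in>sets borel. emeasure \<mu> A =
           ennreal c * indicator A a + (\<integral>\<^sup>+x\<in>A. ennreal (f x) \<partial>lborel)))"

definition unimodal_process :: "'a measure \<Rightarrow> (real \<Rightarrow> 'a \<Rightarrow> real) \<Rightarrow> bool" where
  "unimodal_process M X \<longleftrightarrow> (\<forall>t>0. \<exists>a. unimodal_with_mode (distr M borel (X t)) a)"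

definition WLSC :: "real \<Rightarrow> real \<Rightarrow> real \<Rightarrow> (real \<Rightarrow> real) set" where
  "WLSC \<alpha> \<theta>\<^sub>0 c = {\<psi>. 0 \<le> \<theta>\<^sub>0 \<and> 0 < c \<and> c \<le> 1 \<and>
     (\<forall>l\<ge>1. \<forall>\<theta>>\<theta>\<^sub>0. \<psi> (l * \<theta>) \<ge> c * l powr \<alpha> * \<psi> \<theta>)}"

definition WUSC :: "real \<Rightarrow> real \<Rightarrow> real \<Rightarrow> (real \<Rightarrow> real) set" where
  "WUSC \<alpha> \<theta>\<^sub>0 C = {\<psi>. 0 \<le> \<theta>\<^sub>0 \<and> 1 \<le> C \<and>
     (\<forall>l\<ge>1. \<forall>\<theta>>\<theta>\<^sub>0. \<psi> (l * \<theta>) \<le> C * l powr \<alpha> * \<psi> \<theta>)}"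

definition occupation_measure ::
    "(real \<Rightarrow> 'a \<Rightarrow> real) \<Rightarrow> real set \<Rightarrow> 'a \<Rightarrow> real measure" where
  "occupation_measure X A \<omega> = distr (restrict_space lborel A) borel (\<lambda>t. X t \<omega>)"

(* L x t \<omega> is the local time L(x, [0,t]). Nonnegativity is stated explicitly because
   ennreal sends negative reals to 0. *)
definition jointly_continuous_local_time ::
    "'a measure \<Rightarrow> (real \<Rightarrow> 'a \<Rightarrow> real) \<Rightarrow> (real \<Rightarrow> real \<Rightarrow> 'a \<Rightarrow> real) \<Rightarrow> bool" where
  "jointly_continuous_local_time M X L \<longleftrightarrow>
     (\<forall>x. \<forall>t\<ge>0. L x t \<in> borel_measurable M) \<and>
     (AE \<omega> in M. continuous_on (UNIV \<times> {0..}) (\<lambda>(x, t). L x t \<omega>) \<and>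
        (\<forall>t\<ge>0. (\<forall>x. 0 \<le> L x t \<omega>) \<and>
           density lborel (\<lambda>x. ennreal (L x t \<omega>)) = occupation_measure X {0..t} \<omega>))"

(* L(x, I) for a bounded interval I, whose endpoints are Inf I and Sup I. *)
definition local_time_on ::
    "(real \<Rightarrow> real \<Rightarrow> 'a \<Rightarrow> real) \<Rightarrow> real \<Rightarrow> real set \<Rightarrow> 'a \<Rightarrow> real" where
  "local_time_on L x I \<omega> = (if I = {} then 0 else L x (Sup I) \<omega> - L x (Inf I) \<omega>)"

definition max_local_time ::
    "(real \<Rightarrow> real \<Rightarrow> 'a \<Rightarrow> real) \<Rightarrow> real set \<Rightarrow> 'a \<Rightarrow> ereal" where
  "max_local_time L I \<omega> = (SUP x. ereal (local_time_on L x I \<omega>))"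

end

theory Submission
  imports Defs
begin

text \<open>
  Write \<open>A\<close> for an occupation functional \<open>\<integral> f (X u) du\<close> over a time interval \<open>[a, b]\<close> of length
  \<open>s\<close>, where \<open>f\<close> is a Gaussian density of small width centred at \<open>x\<close>, or the difference of two such
  densities whose centres are at distance \<open>h\<close>. The first kind converges to the local time
  \<open>L(x, [a, b])\<close> when the width tends to zero, the second one to an increment of the local time in the
  space variable. Everything rests on moment bounds for \<open>A\<close> that do not depend on the width.

  Moments come from Fourier inversion. Put \<open>\<Phi>\<^sub>p(\<zeta>, t) = E[y(X a) A(t)^p exp(i \<zeta> X t)]\<close>. Since
  \<open>A(t)^p = p \<integral> f(X u) A(u)^(p - 1) du\<close>, independence of \<open>X t - X u\<close> from the past and inversion of the
  Fourier transform \<open>F\<close> of \<open>f\<close> bound \<open>|\<Phi>\<^sub>p(\<zeta>, t)|\<close> by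
  \<open>p \<integral> exp (- (t - u) \<psi>(\<zeta>)) \<integral> |F(\<eta> - \<zeta>)| |\<Phi>\<^sub>p\<^sub>-\<^sub>1(\<eta>, u)| d\<eta> du\<close>. A Laplace transform in time at rate
  \<open>q\<close> turns the time convolution into multiplication by \<open>1 / (q + \<psi>(\<zeta>))\<close>, so that with a weight \<open>V\<close>
  such that \<open>|F(\<eta> - \<zeta>)| \<le> \<kappa> V(\<eta>) V(\<zeta>)\<close> and \<open>J = \<integral> V\<^sup>2 / (q + \<psi>)\<close> an induction gives
  \<open>|E[y(X a) A^p]| \<le> E|y(X a)| p! (\<kappa> J)^p exp (q s)\<close> (\<open>weighted_additive_moment_le\<close>). As \<open>\<psi>(\<xi>)\<close> is at
  least of order \<open>\<bar>\<xi>\<bar>^\<alpha>\<close> for large \<open>\<xi>\<close>, the weight \<open>V(\<xi>) = 1 + q^(-\<gamma>/\<alpha>) \<bar>\<xi>\<bar>^\<gamma>\<close> with small \<open>\<gamma>\<close> has \<open>J\<close> of order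
  \<open>q^(-(1 - 1/\<alpha>))\<close>, and \<open>\<kappa>\<close> is of order \<open>1\<close> for a density and \<open>(h q^(1/\<alpha>))^\<gamma>\<close> for a difference.

  The range of \<open>X\<close> is unbounded, so the supremum over all \<open>x\<close> is not controlled by a union bound.
  Splitting off the first factor of \<open>A^p\<close> instead of the last one, and integrating over the centre
  \<open>x\<close>, gives the same bound for \<open>E \<integral> A(x)^p dx\<close>, with one factor \<open>\<kappa> J\<close> replaced by \<open>s\<close>
  (\<open>integrated_additive_moment_le\<close>). Averages over the intervals \<open>[x, x + q^(-1/\<alpha>) 2^(-k)]\<close> then bound the
  supremum by \<open>L\<^sup>p\<close> norms of \<open>A\<close> and of its dyadic increments (\<open>chaining_bound\<close>), and Markov's inequality
  shows that the supremum exceeds a constant times \<open>p q^(-(1 - 1/\<alpha>))\<close> with probability at most \<open>exp (-p)\<close>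
  as soon as \<open>q s \<le> p\<close> (\<open>smoothed_tail\<close>). The rate \<open>q\<close> is free: \<open>q = p / s\<close> gives the threshold
  \<open>s^(1 - 1/\<alpha>) p^(1/\<alpha>)\<close>, so that the maximal local time over \<open>[a, b]\<close>, divided by \<open>s^(1 - 1/\<alpha>)\<close>, has a
  tail of order \<open>exp (-c u^\<alpha>)\<close> (\<open>local_time_tail\<close>).

  Both claims follow by Borel-Cantelli along \<open>r = 2^(-n)\<close>: at a fixed time \<open>p\<close> is of order \<open>ln n\<close>, that is,
  of order \<open>ln ln (1/r)\<close>; uniformly in \<open>[0, N]\<close> there are about \<open>N 2^n\<close> dyadic intervals, and \<open>p = 2 n\<close>,
  of order \<open>ln (1/r)\<close>, beats their number.
\<close>

section \<open>Powers of primitives\<close>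

lemma integrable_indicator_times:
  fixes g :: "real \<Rightarrow> real"
  assumes "integrable lborel g" and "A \<in> sets borel"
  shows "integrable lborel (\<lambda>x. indicator A x * g x)"
  using integrable_mult_indicator[of A lborel g] assms by simp

text \<open>Integration by parts for primitives, valid for merely integrable functions: the square is split
  along its diagonal.\<close>
lemma integral_product_split:
  fixes g k :: "real \<Rightarrow> real"
  assumes g: "integrable lborel g" and k: "integrable lborel k"
  shows "(LINT x|lborel. g x) * (LINT x|lborel. k x) =
     (LINT u|lborel. k u * (LINT v|lborel. indicator {..u} v * g v)) +
     (LINT u|lborel. g u * (LINT v|lborel. indicator {..u} v * k v))"
    and "integrable lborel (\<lambda>u. k u * (LINT v|lborel. indicator {..u} v * g v))"
proof -
  have [measurable]: "g \<in> borel_measurable borel" "k \<in> borel_measurable borel"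
    using g k by auto
  have prod: "integrable (lborel \<Otimes>\<^sub>M lborel) (\<lambda>(u, v). k u * g v)"
    using g k by (intro lborel_pair.Fubini_integrable) (auto simp: abs_mult intro!: integrable_mult_right)
  have low: "integrable (lborel \<Otimes>\<^sub>M lborel) (\<lambda>(u, v). k u * (indicator {..u} v * g v))"
    by (rule Bochner_Integration.integrable_bound[OF prod])
       (auto simp: split_beta' abs_mult indicator_def split: split_indicator)
  have up: "integrable (lborel \<Otimes>\<^sub>M lborel) (\<lambda>(u, v). k u * (indicator {u<..} v * g v))"
    by (rule Bochner_Integration.integrable_bound[OF prod])
       (auto simp: split_beta' abs_mult indicator_def split: split_indicator)
  show "integrable lborel (\<lambda>u. k u * (LINT v|lborel. indicator {..u} v * g v))"
    using lborel_pair.integrable_fst'[OF low] by simp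
  have "(LINT x|lborel. g x) * (LINT x|lborel. k x) =
      integral\<^sup>L (lborel \<Otimes>\<^sub>M lborel) (\<lambda>(u, v). k u * g v)"
    using lborel_pair.integral_fst'[OF prod] by (simp add: mult.commute)
  also have "\<dots> = integral\<^sup>L (lborel \<Otimes>\<^sub>M lborel) (\<lambda>z. (\<lambda>(u, v). k u * (indicator {..u} v * g v)) z +
      (\<lambda>(u, v). k u * (indicator {u<..} v * g v)) z)"
    by (rule Bochner_Integration.integral_cong) (auto split: split_indicator)
  also have "\<dots> = integral\<^sup>L (lborel \<Otimes>\<^sub>M lborel) (\<lambda>(u, v). k u * (indicator {..u} v * g v)) +
      integral\<^sup>L (lborel \<Otimes>\<^sub>M lborel) (\<lambda>(u, v). k u * (indicator {u<..} v * g v))"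
    by (rule Bochner_Integration.integral_add[OF low up])
  also have "integral\<^sup>L (lborel \<Otimes>\<^sub>M lborel) (\<lambda>(u, v). k u * (indicator {..u} v * g v)) =
      (LINT u|lborel. k u * (LINT v|lborel. indicator {..u} v * g v))"
    using lborel_pair.integral_fst'[OF low] by simp
  also have "integral\<^sup>L (lborel \<Otimes>\<^sub>M lborel) (\<lambda>(u, v). k u * (indicator {u<..} v * g v)) =
      (LINT v|lborel. LINT u|lborel. k u * (indicator {u<..} v * g v))"
    using lborel_pair.integral_snd[of "\<lambda>u v. k u * (indicator {u<..} v * g v)"] up by simp
  also have "\<dots> = (LINT v|lborel. g v * (LINT u|lborel. indicator {..v} u * k u))"
  proof (rule Bochner_Integration.integral_cong[OF refl])
    fix v :: real
    have "(LINT u|lborel. k u * (indicator {u<..} v * g v)) =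
        (LINT u|lborel. g v * (indicator {..v} u * k u))"
    proof (rule integral_cong_AE)
      have "AE u in lborel. u \<noteq> v" by (rule AE_lborel_singleton)
      then show "AE u in lborel. k u * (indicator {u<..} v * g v) = g v * (indicator {..v} u * k u)"
        by eventually_elim (auto split: split_indicator)
    qed (simp_all add: indicator_def)
    then show "(LINT u|lborel. k u * (indicator {u<..} v * g v)) =
        g v * (LINT u|lborel. indicator {..v} u * k u)" by simp
  qed
  finally show "(LINT x|lborel. g x) * (LINT x|lborel. k x) =
     (LINT u|lborel. k u * (LINT v|lborel. indicator {..u} v * g v)) +
     (LINT u|lborel. g u * (LINT v|lborel. indicator {..u} v * k v))" .
qed

text \<open>The chain rule for the \<open>n\<close>-th power of a primitive. Paths of a Levy process have jumps, so the
  primitive is not differentiable everywhere, and the identity is derived from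
  \<open>integral_product_split\<close> rather than from the fundamental theorem of calculus. It singles out the
  largest of the \<open>n + 1\<close> integration variables; \<open>power_integral_eq_backward\<close> singles out the smallest.\<close>
lemma power_integral_eq:
  fixes g :: "real \<Rightarrow> real"
  assumes g: "integrable lborel g"
  shows "(LINT x|lborel. g x) ^ Suc n =
      real (Suc n) * (LINT u|lborel. g u * (LINT v|lborel. indicator {..u} v * g v) ^ n)"
    and "integrable lborel (\<lambda>u. g u * (LINT v|lborel. indicator {..u} v * g v) ^ n)"
proof -
  have "(LINT x|lborel. g x) ^ Suc n =
      real (Suc n) * (LINT u|lborel. g u * (LINT v|lborel. indicator {..u} v * g v) ^ n) \<and>
      integrable lborel (\<lambda>u. g u * (LINT v|lborel. indicator {..u} v * g v) ^ n)"
    using g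
  proof (induction n arbitrary: g)
    case 0
    then show ?case by simp
  next
    case (Suc n)
    define P where "P u = (LINT v|lborel. indicator {..u} v * g v)" for u
    define k where "k u = real (Suc n) * (g u * P u ^ n)" for u
    have k_int: "integrable lborel k"
      using Suc.IH[OF Suc.prems] unfolding k_def P_def by (intro integrable_mult_right) auto
    have Pk: "(LINT v|lborel. indicator {..u} v * k v) = P u ^ Suc n" for u
    proof -
      have gi: "integrable lborel (\<lambda>x. indicator {..u} x * g x)"
        using Suc.prems by (rule integrable_indicator_times) auto
      have "P u ^ Suc n = real (Suc n) * (LINT w|lborel. (indicator {..u} w * g w) *
          (LINT v|lborel. indicator {..w} v * (indicator {..u} v * g v)) ^ n)"
        using Suc.IH[OF gi] unfolding P_def by blast
      also have "(LINT w|lborel. (indicator {..u} w * g w) *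
          (LINT v|lborel. indicator {..w} v * (indicator {..u} v * g v)) ^ n) =
          (LINT w|lborel. indicator {..u} w * (g w * P w ^ n))"
      proof (rule Bochner_Integration.integral_cong[OF refl])
        fix w :: real
        show "(indicator {..u} w * g w) *
          (LINT v|lborel. indicator {..w} v * (indicator {..u} v * g v)) ^ n =
          indicator {..u} w * (g w * P w ^ n)"
        proof (cases "w \<le> u")
          case True
          then have "(LINT v|lborel. indicator {..w} v * (indicator {..u} v * g v)) = P w"
            unfolding P_def
            by (intro Bochner_Integration.integral_cong) (auto split: split_indicator)
          then show ?thesis using True by simp
        qed simp
      qed
      finally show ?thesis
        unfolding k_def by (simp flip: integral_mult_right_zero add: mult.left_commute)
    qed
    have tot: "(LINT u|lborel. k u) = (LINT x|lborel. g x) ^ Suc n"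
      using Suc.IH[OF Suc.prems] unfolding k_def P_def by simp
    have "(LINT x|lborel. g x) ^ Suc (Suc n) = (LINT x|lborel. g x) * (LINT u|lborel. k u)"
      using tot by simp
    also have "\<dots> = (LINT u|lborel. k u * P u) + (LINT u|lborel. g u * P u ^ Suc n)"
      using integral_product_split(1)[OF Suc.prems k_int] unfolding Pk unfolding P_def by simp
    also have "(LINT u|lborel. k u * P u) = real (Suc n) * (LINT u|lborel. g u * P u ^ Suc n)"
      unfolding k_def by (simp flip: integral_mult_right_zero add: mult_ac)
    finally have 1: "(LINT x|lborel. g x) ^ Suc (Suc n) =
        real (Suc (Suc n)) * (LINT u|lborel. g u * P u ^ Suc n)"
      by (simp add: algebra_simps)
    have "integrable lborel (\<lambda>u. (1 / real (Suc n)) * (k u * P u))"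
      using integral_product_split(2)[OF Suc.prems k_int] unfolding P_def
      by (intro integrable_mult_right) auto
    also have "(\<lambda>u. (1 / real (Suc n)) * (k u * P u)) = (\<lambda>u. g u * P u ^ Suc n)"
      unfolding k_def by (auto simp: mult_ac)
    finally show ?case using 1 unfolding P_def by blast
  qed
  then show "(LINT x|lborel. g x) ^ Suc n =
      real (Suc n) * (LINT u|lborel. g u * (LINT v|lborel. indicator {..u} v * g v) ^ n)"
    and "integrable lborel (\<lambda>u. g u * (LINT v|lborel. indicator {..u} v * g v) ^ n)" by auto
qed

lemma power_integral_eq_backward:
  fixes g :: "real \<Rightarrow> real"
  assumes g: "integrable lborel g"
  shows "(LINT x|lborel. g x) ^ Suc n =
      real (Suc n) * (LINT u|lborel. g u * (LINT v|lborel. indicator {u..} v * g v) ^ n)"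
proof -
  have g': "integrable lborel (\<lambda>x. g (- x))"
    using lborel_integrable_real_affine[OF g, of "-1" 0] by simp
  have refl: "(LINT x|lborel. h x) = (LINT x|lborel. h (- x))" for h :: "real \<Rightarrow> real"
    using lborel_integral_real_affine[of "-1" h 0] by simp
  have "(LINT v|lborel. indicator {..u} v * g (- v)) = (LINT v|lborel. indicator {-u..} v * g v)" for u
    by (subst (2) refl) (auto intro!: Bochner_Integration.integral_cong split: split_indicator)
  then show ?thesis
    using power_integral_eq(1)[OF g', of n]
    by (subst (1 2) refl) simp
qed

section \<open>Additive functionals and the Markov property\<close>

lemma norm_integral_le_nn_integral:
  fixes f :: "'b \<Rightarrow> 'c :: {banach, second_countable_topology}"
  shows "ennreal (norm (integral\<^sup>L M f)) \<le> (\<integral>\<^sup>+x. ennreal (norm (f x)) \<partial>M)"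
  by (cases "integrable M f") (auto simp: not_integrable_integral_eq intro: integral_norm_bound_ennreal)

lemma abs_integral_interval_le:
  fixes h :: "real \<Rightarrow> real"
  assumes "a \<le> b" and bound: "\<And>r. \<bar>h r\<bar> \<le> B"
  shows "\<bar>LINT r|lborel. indicator {a..b} r * h r\<bar> \<le> B * (b - a)"
proof -
  have B: "0 \<le> B" using order_trans[OF abs_ge_zero bound] .
  have "ennreal \<bar>LINT r|lborel. indicator {a..b} r * h r\<bar> \<le>
      (\<integral>\<^sup>+r. ennreal (norm (indicator {a..b} r * h r)) \<partial>lborel)"
    using norm_integral_le_nn_integral[of lborel "\<lambda>r. indicator {a..b} r * h r"] by simp
  also have "\<dots> \<le> (\<integral>\<^sup>+r. ennreal B * indicator {a..b} r \<partial>lborel)"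
    using bound by (intro nn_integral_mono) (auto split: split_indicator intro!: ennreal_leI)
  also have "\<dots> = ennreal (B * (b - a))"
    using assms(1) B by (simp add: nn_integral_cmult ennreal_mult)
  finally show ?thesis using assms(1) B by (subst (asm) ennreal_le_iff) auto
qed

text \<open>What the moment bounds use of a Levy process: right-continuous paths, without an exceptional null
  set, and the joint law of a finite past and the next increment, tested against bounded functions of
  the past and characters of the increment. Only strictly positive times occur, so that the value of
  the process at time \<open>0\<close>, which is determined only almost surely, does not enter.\<close>
locale levy_paths = prob_space M for M :: "'a measure" +
  fixes X :: "real \<Rightarrow> 'a \<Rightarrow> real" and \<psi> :: "real \<Rightarrow> real"
  assumes rv_X: "\<And>t. X t \<in> borel_measurable M"
    and right_cont: "\<And>t \<omega>. ((\<lambda>s. X s \<omega>) \<longlongrightarrow> X t \<omega>) (at_right t)"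
    and \<psi>_measurable [measurable]: "\<psi> \<in> borel_measurable borel"
    and \<psi>_nonneg: "\<And>\<xi>. 0 \<le> \<psi> \<xi>"
    and past_increment: "\<And>(T :: nat \<Rightarrow> real) n t (G :: (nat \<Rightarrow> real) \<Rightarrow> complex) K \<zeta>.
      \<lbrakk>0 < T 0; \<And>i. i < n \<Longrightarrow> T i < T (Suc i); T n < t;
       G \<in> borel_measurable (PiM {..n} (\<lambda>_. borel)); \<And>z. norm (G z) \<le> K\<rbrakk> \<Longrightarrow>
      (CLINT \<omega>|M. G (\<lambda>j\<in>{..n}. X (T j) \<omega>) * iexp (\<zeta> * (X t \<omega> - X (T n) \<omega>))) =
      (CLINT \<omega>|M. G (\<lambda>j\<in>{..n}. X (T j) \<omega>)) * of_real (exp (- ((t - T n) * \<psi> \<zeta>)))"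
begin

text \<open>By right continuity, \<open>X\<close> is the limit of its values at the next point of a refining grid.\<close>
lemma X_joint: "(\<lambda>(t, \<omega>). X t \<omega>) \<in> borel_measurable (borel \<Otimes>\<^sub>M M)"
proof (rule borel_measurable_LIMSEQ_real)
  fix i :: nat
  have "(\<lambda>z. X ((real_of_int \<lfloor>real (Suc i) * fst z\<rfloor> + 1) / real (Suc i)) (snd z))
      \<in> borel_measurable (borel \<Otimes>\<^sub>M M)"
    by (rule measurable_compose_countable[where
          f = "\<lambda>k z. X ((real_of_int k + 1) / real (Suc i)) (snd z)"])
       (auto intro!: measurable_compose[OF measurable_snd] rv_X)
  then show "(\<lambda>(t, \<omega>). X ((real_of_int \<lfloor>real (Suc i) * t\<rfloor> + 1) / real (Suc i)) \<omega>)
      \<in> borel_measurable (borel \<Otimes>\<^sub>M M)"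
    by (simp add: split_beta')
next
  fix z :: "real \<times> 'a"
  obtain t \<omega> where z: "z = (t, \<omega>)" by (cases z)
  let ?T = "\<lambda>i. (real_of_int \<lfloor>real (Suc i) * t\<rfloor> + 1) / real (Suc i)"
  have gt: "t < ?T i" for i
    by (simp add: pos_less_divide_eq mult.commute del: of_nat_Suc)
  have le: "?T i \<le> t + 1 / real (Suc i)" for i
  proof -
    have "(t + 1 / real (Suc i)) * real (Suc i) = real (Suc i) * t + 1"
      by (simp add: field_simps del: of_nat_Suc)
    then show ?thesis
      using of_int_floor_le[of "real (Suc i) * t"]
      by (simp only: pos_divide_le_eq[OF of_nat_0_less_iff[THEN iffD2, OF zero_less_Suc]])
  qed
  have "?T \<longlonglongrightarrow> t"
  proof (rule tendsto_sandwich[where f = "\<lambda>_. t" and h = "\<lambda>i. t + 1 / real (Suc i)"])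
    show "(\<lambda>i. t + 1 / real (Suc i)) \<longlonglongrightarrow> t"
      using tendsto_add[OF tendsto_const[of t] LIMSEQ_inverse_real_of_nat] by (simp add: inverse_eq_divide)
  qed (use less_imp_le[OF gt] le in \<open>auto intro!: always_eventually simp del: of_nat_Suc\<close>)
  then have "filterlim ?T (at_right t) sequentially"
    using gt unfolding filterlim_at by (intro conjI always_eventually allI) (simp_all add: less_imp_neq[symmetric] del: of_nat_Suc)
  from filterlim_compose[OF right_cont this]
  show "(\<lambda>i. (\<lambda>(t, \<omega>). X ((real_of_int \<lfloor>real (Suc i) * t\<rfloor> + 1) / real (Suc i)) \<omega>) z)
      \<longlonglongrightarrow> (\<lambda>(t, \<omega>). X t \<omega>) z"
    unfolding z by simp
qed

lemma X_compose [measurable (raw)]: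
  assumes "T \<in> borel_measurable N" "W \<in> measurable N M"
  shows "(\<lambda>x. X (T x) (W x)) \<in> borel_measurable N"
  using measurable_compose[OF measurable_Pair[OF assms] X_joint] by simp

definition additive :: "(real \<Rightarrow> real) \<Rightarrow> real \<Rightarrow> real \<Rightarrow> 'a \<Rightarrow> real" where
  "additive f a t \<omega> = (LINT r|lborel. indicator {a..t} r * f (X r \<omega>))"

lemma additive_measurable [measurable (raw)]:
  assumes [measurable]: "f \<in> borel_measurable borel" "S \<in> borel_measurable N"
    "T \<in> borel_measurable N" "W \<in> measurable N M"
  shows "(\<lambda>x. additive f (S x) (T x) (W x)) \<in> borel_measurable N"
proof -
  have [measurable]: "(\<lambda>z. indicat_real {S (fst z)..T (fst z)} (snd z))
      \<in> borel_measurable (N \<Otimes>\<^sub>M lborel)"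
    by (simp add: indicator_def)
  show ?thesis unfolding additive_def
    by (rule lborel.borel_measurable_lebesgue_integral) (simp add: split_beta')
qed

lemma integrable_along_path:
  fixes f :: "real \<Rightarrow> real"
  assumes "\<omega> \<in> space M" and [measurable]: "f \<in> borel_measurable borel"
    and "\<And>x. \<bar>f x\<bar> \<le> B"
  shows "integrable lborel (\<lambda>r. indicator {a..t} r * f (X r \<omega>))"
proof -
  have "integrable lborel (\<lambda>r. indicator {a..t} r *\<^sub>R f (X r \<omega>))"
    using assms by (intro integrableI_bounded_set_indicator[where B = B])
      (auto simp: emeasure_lborel_Icc_eq)
  then show ?thesis by simp
qed

lemma abs_additive_le:
  assumes "\<And>x. \<bar>f x\<bar> \<le> B" "a \<le> t"
  shows "\<bar>additive f a t \<omega>\<bar> \<le> B * (t - a)"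
  unfolding additive_def using assms by (intro abs_integral_interval_le)

lemma expectation_time_integral:
  fixes W :: "real \<Rightarrow> 'a \<Rightarrow> 'c :: {banach, second_countable_topology}"
  assumes [measurable]: "(\<lambda>(\<omega>, u). W u \<omega>) \<in> borel_measurable (M \<Otimes>\<^sub>M lborel)"
    and bound: "\<And>u \<omega>. u \<in> {a..b} \<Longrightarrow> norm (W u \<omega>) \<le> K"
  shows "(LINT \<omega>|M. LINT u|lborel. indicator {a..b} u *\<^sub>R W u \<omega>) =
    (LINT u|lborel. LINT \<omega>|M. indicator {a..b} u *\<^sub>R W u \<omega>)"
proof -
  interpret P: pair_sigma_finite M "lborel :: real measure" ..
  have "integrable (M \<Otimes>\<^sub>M lborel) (\<lambda>z. indicator (space M \<times> {a..b}) z *\<^sub>R (\<lambda>(\<omega>, u). W u \<omega>) z)"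
    by (rule integrableI_bounded_set_indicator[where B = K])
       (use bound in \<open>auto simp: lborel.emeasure_pair_measure_Times emeasure_space_1 emeasure_lborel_Icc_eq\<close>)
  moreover have "integrable (M \<Otimes>\<^sub>M lborel) (\<lambda>z. indicator (space M \<times> {a..b}) z *\<^sub>R (\<lambda>(\<omega>, u). W u \<omega>) z) \<longleftrightarrow>
      integrable (M \<Otimes>\<^sub>M lborel) (\<lambda>(\<omega>, u). indicator {a..b} u *\<^sub>R W u \<omega>)"
    by (intro Bochner_Integration.integrable_cong)
       (auto simp: space_pair_measure indicator_def)
  ultimately show ?thesis
    by (intro P.Fubini_integral[symmetric]) blast
qed

text \<open>The increment after time \<open>u\<close> is independent of a functional of the whole path up to \<open>u\<close>. The
  functional is the limit of the same functional of the path sampled at finitely many times, because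
  the sampled path converges by right continuity at every time before \<open>u\<close>.\<close>
lemma additive_functional_past_increment:
  fixes f y :: "real \<Rightarrow> real"
  assumes times: "0 < a" "a < u" "u < t"
    and f: "continuous_on UNIV f" "\<And>x. \<bar>f x\<bar> \<le> B"
    and y [measurable]: "y \<in> borel_measurable borel" and y_bound: "\<And>x. \<bar>y x\<bar> \<le> Y"
  shows "(CLINT \<omega>|M. (of_real (y (X a \<omega>) * additive f a u \<omega> ^ p * f (X u \<omega>)) * iexp (\<zeta> * X u \<omega>)) *
        iexp (\<zeta> * (X t \<omega> - X u \<omega>))) =
    (CLINT \<omega>|M. of_real (y (X a \<omega>) * additive f a u \<omega> ^ p * f (X u \<omega>)) * iexp (\<zeta> * X u \<omega>)) *
      of_real (exp (- ((t - u) * \<psi> \<zeta>)))"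
    (is "(CLINT \<omega>|M. ?G \<omega> * ?I \<omega>) = _")
proof -
  have f_meas [measurable]: "f \<in> borel_measurable borel"
    using f(1) by (rule borel_measurable_continuous_onI)
  have B: "0 \<le> B" and Y: "0 \<le> Y"
    using order_trans[OF abs_ge_zero f(2)] order_trans[OF abs_ge_zero y_bound] by auto
  define T where "T n j = a + real j * (u - a) / real (Suc n)" for n j :: nat
  \<comment> \<open>The index of the first grid point strictly after \<open>r\<close>; truncation keeps it inside the grid for
    \<open>r \<ge> u\<close>.\<close>
  define idx where "idx n r = min (Suc n) (nat (\<lfloor>real (Suc n) * (r - a) / (u - a)\<rfloor> + 1))" for n r
  define D where "D n z = (LINT r|lborel. indicator {a..u} r * f (z (idx n r)))"
    for n and z :: "nat \<Rightarrow> real"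
  define G where "G n z = of_real (y (z 0) * D n z ^ p * f (z (Suc n))) * iexp (\<zeta> * z (Suc n))"
    for n and z :: "nat \<Rightarrow> real"
  define Z where "Z n \<omega> = (\<lambda>j\<in>{..Suc n}. X (T n j) \<omega>)" for n \<omega>
  have T0: "T n 0 = a" and TN: "T n (Suc n) = u" for n
    by (auto simp: T_def simp del: of_nat_Suc)
  have Tmono: "T n i < T n (Suc i)" for n i
    using times by (simp add: T_def divide_strict_right_mono del: of_nat_Suc)
  have idx_le: "idx n r \<le> Suc n" for n r by (simp add: idx_def)
  have D_bound: "\<bar>D n z\<bar> \<le> B * (u - a)" for n z
    unfolding D_def using times f(2) by (intro abs_integral_interval_le) auto
  have D_meas [measurable]: "D n \<in> borel_measurable (PiM {..Suc n} (\<lambda>_. borel))" for n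
    unfolding D_def
  proof (rule lborel.borel_measurable_lebesgue_integral)
    have "(\<lambda>x. fst x (idx n (snd x))) \<in> borel_measurable (PiM {..Suc n} (\<lambda>_. borel) \<Otimes>\<^sub>M lborel)"
    proof (rule measurable_compose_countable'[where I = "{..Suc n}" and f = "\<lambda>i x. fst x i"])
      show "(\<lambda>x. idx n (snd x)) \<in> PiM {..Suc n} (\<lambda>_. borel) \<Otimes>\<^sub>M lborel \<rightarrow>\<^sub>M count_space {..Suc n}"
        by (rule measurable_count_space_extend[OF subset_UNIV])
           (auto simp: idx_le idx_def[abs_def])
    qed (auto intro!: measurable_compose[OF measurable_fst] measurable_component_singleton)
    then have [measurable]: "(\<lambda>x. fst x (idx n (snd x))) \<in> borel_measurable (PiM {..Suc n} (\<lambda>_. borel) \<Otimes>\<^sub>M lborel)" .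
    show "(\<lambda>(z, r). indicator {a..u} r * f (z (idx n r))) \<in> borel_measurable (PiM {..Suc n} (\<lambda>_. borel) \<Otimes>\<^sub>M lborel)"
      by (simp add: split_beta')
  qed
  have G_meas [measurable]: "G n \<in> borel_measurable (PiM {..Suc n} (\<lambda>_. borel))" for n
  proof -
    have [measurable]: "(\<lambda>z. z 0) \<in> borel_measurable (PiM {..Suc n} (\<lambda>_. borel :: real measure))"
      "(\<lambda>z. z (Suc n)) \<in> borel_measurable (PiM {..Suc n} (\<lambda>_. borel :: real measure))"
      by (auto intro!: measurable_component_singleton)
    show ?thesis unfolding G_def by measurable
  qed
  define K where "K = Y * (B * (u - a)) ^ p * B"
  have G_bound: "norm (G n z) \<le> K" for n z
    unfolding G_def K_def using D_bound[of n z] y_bound f(2) times B Y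
    by (auto simp: norm_mult abs_mult power_abs simp del: of_real_mult of_real_power
             intro!: mult_mono power_mono)
  have Z_meas [measurable]: "Z n \<in> measurable M (PiM {..Suc n} (\<lambda>_. borel))" for n
    unfolding Z_def by (intro measurable_restrict) (auto intro: rv_X)
  have eq: "(CLINT \<omega>|M. G n (Z n \<omega>) * ?I \<omega>) =
      (CLINT \<omega>|M. G n (Z n \<omega>)) * of_real (exp (- ((t - u) * \<psi> \<zeta>)))" for n
    using past_increment[of "T n" "Suc n" t "G n" K \<zeta>] times Tmono G_bound
    unfolding Z_def TN T0 by simp
  have lim: "(\<lambda>n. G n (Z n \<omega>)) \<longlonglongrightarrow> ?G \<omega>" if \<omega>: "\<omega> \<in> space M" for \<omega>
  proof -
    have "(\<lambda>n. D n (Z n \<omega>)) \<longlonglongrightarrow> additive f a u \<omega>"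
      unfolding D_def additive_def
    proof (rule integral_dominated_convergence[where w = "\<lambda>r. B * indicator {a..u} r"])
      show "integrable lborel (\<lambda>r. B * indicat_real {a..u} r)"
        by (intro integrable_mult_right) (auto simp: emeasure_lborel_Icc_eq)
      have "(\<lambda>n. indicator {a..u} r * f (Z n \<omega> (idx n r))) \<longlonglongrightarrow> indicator {a..u} r * f (X r \<omega>)"
        if "r \<noteq> u" for r
      proof (cases "r \<in> {a..u}")
        case True
        define k where "k n = nat (\<lfloor>real (Suc n) * (r - a) / (u - a)\<rfloor> + 1)" for n
        have nonneg: "0 \<le> real (Suc n) * (r - a) / (u - a)" for n
          using True times by auto
        have k_eq: "real (k n) = of_int \<lfloor>real (Suc n) * (r - a) / (u - a)\<rfloor> + 1" for n
          unfolding k_def using nonneg[of n] by (simp del: of_nat_Suc)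
        have "real (k n) > real (Suc n) * (r - a) / (u - a)" for n
          unfolding k_eq by linarith
        then have gt: "T n (k n) > r" for n
          using times by (simp add: T_def field_simps del: of_nat_Suc)
        have "real (k n) \<le> real (Suc n) * (r - a) / (u - a) + 1" for n
          unfolding k_eq by linarith
        then have "real (k n) * (u - a) / real (Suc n) \<le>
            (real (Suc n) * (r - a) / (u - a) + 1) * (u - a) / real (Suc n)" for n
          using times by (intro divide_right_mono mult_right_mono) auto
        also have "(real (Suc n) * (r - a) / (u - a) + 1) * (u - a) / real (Suc n) =
            (r - a) + (u - a) / real (Suc n)" for n
          using times by (simp add: field_simps del: of_nat_Suc)
        finally have "real (k n) * (u - a) / real (Suc n) \<le> (r - a) + (u - a) / real (Suc n)" for n .
        then have le: "T n (k n) \<le> r + (u - a) / real (Suc n)" for n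
          unfolding T_def by (smt (verit))
        have "real (Suc n) * (r - a) / (u - a) < real (Suc n)" for n
          using True that times by (simp add: field_simps del: of_nat_Suc)
        then have "k n \<le> Suc n" for n
          unfolding k_def by (simp add: nat_le_iff floor_less_iff del: of_nat_Suc) (smt (verit) floor_less_iff of_int_of_nat_eq)
        then have idx: "idx n r = k n" for n unfolding idx_def k_def by simp
        have "(\<lambda>n. T n (k n)) \<longlonglongrightarrow> r"
        proof (rule tendsto_sandwich[where f = "\<lambda>_. r" and h = "\<lambda>n. r + (u - a) / real (Suc n)"])
          show "(\<lambda>n. r + (u - a) / real (Suc n)) \<longlonglongrightarrow> r"
            using tendsto_add[OF tendsto_const[of r] tendsto_mult[OF tendsto_const[of "u - a"] LIMSEQ_inverse_real_of_nat]]
            by (simp add: divide_inverse)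
        qed (use less_imp_le[OF gt] le in \<open>auto intro!: always_eventually simp del: of_nat_Suc\<close>)
        then have "filterlim (\<lambda>n. T n (k n)) (at_right r) sequentially"
          using gt by (auto simp: filterlim_at intro!: always_eventually)
        from filterlim_compose[OF right_cont this]
        have "(\<lambda>n. X (T n (k n)) \<omega>) \<longlonglongrightarrow> X r \<omega>" .
        then have "(\<lambda>n. f (X (T n (k n)) \<omega>)) \<longlonglongrightarrow> f (X r \<omega>)"
          by (rule continuous_on_tendsto_compose[OF f(1)]) auto
        moreover have "Z n \<omega> (idx n r) = X (T n (k n)) \<omega>" for n
          unfolding Z_def using idx_le[of n r] by (simp add: idx)
        ultimately show ?thesis using True by simp
      qed simp
      with AE_lborel_singleton[of u]
      show "AE r in lborel. (\<lambda>n. indicator {a..u} r * f (Z n \<omega> (idx n r))) \<longlonglongrightarrow> indicator {a..u} r * f (X r \<omega>)"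
        by auto
      show "(\<lambda>r. indicator {a..u} r * f (X r \<omega>)) \<in> borel_measurable lborel"
        using \<omega> by measurable
      show "(\<lambda>r. indicator {a..u} r * f (Z n \<omega> (idx n r))) \<in> borel_measurable lborel" for n
      proof -
        have "(\<lambda>r. Z n \<omega> (idx n r)) \<in> borel_measurable lborel"
          by (rule measurable_compose_countable[where f = "\<lambda>i r. Z n \<omega> i"])
             (auto simp: idx_def[abs_def])
        then show ?thesis by measurable
      qed
      show "AE r in lborel. norm (indicator {a..u} r * f (Z n \<omega> (idx n r))) \<le> B * indicator {a..u} r" for n
        using f(2) by (auto split: split_indicator)
    qed
    then show ?thesis
      unfolding G_def by (auto simp: Z_def T0 TN intro!: tendsto_intros)
  qed
  have "(\<lambda>n. CLINT \<omega>|M. G n (Z n \<omega>) * ?I \<omega>) \<longlonglongrightarrow> (CLINT \<omega>|M. ?G \<omega> * ?I \<omega>)"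
  proof (rule integral_dominated_convergence[where w = "\<lambda>_. K"])
    show "AE \<omega> in M. (\<lambda>n. G n (Z n \<omega>) * ?I \<omega>) \<longlonglongrightarrow> ?G \<omega> * ?I \<omega>"
      by (intro AE_I2 tendsto_mult tendsto_const lim)
  qed (auto simp: norm_mult G_bound)
  moreover have "(\<lambda>n. CLINT \<omega>|M. G n (Z n \<omega>)) \<longlonglongrightarrow> (CLINT \<omega>|M. ?G \<omega>)"
  proof (rule integral_dominated_convergence[where w = "\<lambda>_. K"])
    show "AE \<omega> in M. (\<lambda>n. G n (Z n \<omega>)) \<longlonglongrightarrow> ?G \<omega>"
      by (intro AE_I2 lim)
  qed (auto simp: G_bound)
  then have "(\<lambda>n. (CLINT \<omega>|M. G n (Z n \<omega>)) * of_real (exp (- ((t - u) * \<psi> \<zeta>)))) \<longlonglongrightarrow>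
      (CLINT \<omega>|M. ?G \<omega>) * of_real (exp (- ((t - u) * \<psi> \<zeta>)))"
    by (intro tendsto_mult tendsto_const)
  ultimately show ?thesis unfolding eq by (rule LIMSEQ_unique)
qed

end

section \<open>A Fourier recursion for the moments\<close>

lemma nn_integral_exp_atLeast:
  fixes c u :: real
  assumes "0 < c"
  shows "(\<integral>\<^sup>+t. ennreal (exp (- (c * (t - u)))) * indicator {u..} t \<partial>lborel) = ennreal (1 / c)"
proof -
  have "(\<integral>\<^sup>+t. ennreal (exp (- (c * (t - u)))) * indicator {u..} t \<partial>lborel) =
      ennreal (0 - (- exp (- (c * (u - u))) / c))"
  proof (rule nn_integral_FTC_atLeast[where F = "\<lambda>t. - exp (- (c * (t - u))) / c"])
    show "((\<lambda>t. - exp (- (c * (t - u))) / c) has_real_derivative exp (- (c * (t - u)))) (at t)" for t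
      using assms by (auto intro!: derivative_eq_intros)
    have "LIM t at_top. - u + t :> at_top"
      by (rule filterlim_tendsto_add_at_top[OF tendsto_const filterlim_ident])
    then have "LIM t at_top. c * (- u + t) :> at_top"
      using assms by (intro filterlim_tendsto_pos_mult_at_top[OF tendsto_const])
    then have "LIM t at_top. c * (t - u) :> at_top"
      by (simp add: algebra_simps)
    then have "((\<lambda>t. exp (- (c * (t - u)))) \<longlongrightarrow> 0) at_top"
      by (intro filterlim_compose[OF exp_at_bot]) (simp add: filterlim_uminus_at_top[symmetric])
    then show "((\<lambda>t. - exp (- (c * (t - u))) / c) \<longlongrightarrow> 0) at_top"
      using tendsto_mult_right[of _ 0 _ "- 1 / c"] by fastforce
  qed auto
  then show ?thesis by simp
qed

context levy_paths
begin

definition moment :: "(real \<Rightarrow> real) \<Rightarrow> (real \<Rightarrow> real) \<Rightarrow> real \<Rightarrow> nat \<Rightarrow> real \<Rightarrow> real \<Rightarrow> complex" where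
  "moment f y a p \<zeta> t = (CLINT \<omega>|M. of_real (y (X a \<omega>) * additive f a t \<omega> ^ p) * iexp (\<zeta> * X t \<omega>))"

lemma moment_measurable [measurable (raw)]:
  assumes [measurable]: "f \<in> borel_measurable borel" "y \<in> borel_measurable borel"
    "Z \<in> borel_measurable N" "T \<in> borel_measurable N"
  shows "(\<lambda>x. moment f y a p (Z x) (T x)) \<in> borel_measurable N"
  unfolding moment_def
  by (rule borel_measurable_lebesgue_integral) (simp add: split_beta')

lemma norm_moment_0_le:
  assumes times: "0 < a" "a < t"
    and y [measurable]: "y \<in> borel_measurable borel" and y_bound: "\<And>x. \<bar>y x\<bar> \<le> Y"
  shows "norm (moment f y a 0 \<zeta> t) \<le> expectation (\<lambda>\<omega>. \<bar>y (X a \<omega>)\<bar>) * exp (- ((t - a) * \<psi> \<zeta>))"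
proof -
  let ?G = "\<lambda>z. of_real (y (z 0)) * iexp (\<zeta> * z 0)"
  have [measurable]: "(\<lambda>z. z 0) \<in> borel_measurable (PiM {..0::nat} (\<lambda>_. borel :: real measure))"
    by (rule measurable_component_singleton) auto
  have "moment f y a 0 \<zeta> t = (CLINT \<omega>|M. ?G (\<lambda>j\<in>{..0::nat}. X a \<omega>) * iexp (\<zeta> * (X t \<omega> - X a \<omega>)))"
    unfolding moment_def
    by (intro Bochner_Integration.integral_cong) (auto simp: mult.assoc ring_distribs simp flip: exp_add)
  also have "\<dots> = (CLINT \<omega>|M. ?G (\<lambda>j\<in>{..0::nat}. X a \<omega>)) * of_real (exp (- ((t - a) * \<psi> \<zeta>)))"
    using times y_bound
    by (intro past_increment[where T = "\<lambda>_. a" and K = Y]) (auto simp: norm_mult)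
  finally have "norm (moment f y a 0 \<zeta> t) =
      norm (CLINT \<omega>|M. ?G (\<lambda>j\<in>{..0::nat}. X a \<omega>)) * exp (- ((t - a) * \<psi> \<zeta>))"
    by (simp add: norm_mult)
  moreover have "norm (CLINT \<omega>|M. ?G (\<lambda>j\<in>{..0::nat}. X a \<omega>)) \<le> expectation (\<lambda>\<omega>. \<bar>y (X a \<omega>)\<bar>)"
    using integral_norm_bound[of M "\<lambda>\<omega>. ?G (\<lambda>j\<in>{..0::nat}. X a \<omega>)"] by (simp add: norm_mult)
  ultimately show ?thesis by (simp add: mult_right_mono)
qed

text \<open>Writing \<open>f (X u)\<close> as a superposition of characters shifts the frequency \<open>\<zeta>\<close> of the moment to
  \<open>\<eta> = \<zeta> + \<xi>\<close>.\<close>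
lemma norm_expectation_fourier_le:
  fixes f y :: "real \<Rightarrow> real" and F :: "real \<Rightarrow> complex"
  assumes f [measurable]: "f \<in> borel_measurable borel" and f_bound: "\<And>x. \<bar>f x\<bar> \<le> B" and au: "a \<le> u"
    and F: "integrable lborel F"
    and inv: "\<And>x. complex_of_real (f x) = (CLINT \<xi>|lborel. F \<xi> * iexp (\<xi> * x))"
    and y [measurable]: "y \<in> borel_measurable borel" and y_bound: "\<And>x. \<bar>y x\<bar> \<le> Y"
  shows "ennreal (norm (CLINT \<omega>|M. of_real (y (X a \<omega>) * additive f a u \<omega> ^ p * f (X u \<omega>)) * iexp (\<zeta> * X u \<omega>)))
    \<le> (\<integral>\<^sup>+\<eta>. ennreal (norm (F (\<eta> - \<zeta>)) * norm (moment f y a p \<eta> u)) \<partial>lborel)"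
proof -
  interpret P: pair_sigma_finite M "lborel :: real measure" ..
  have [measurable]: "F \<in> borel_measurable borel" using F by auto
  have B: "0 \<le> B" and Y: "0 \<le> Y"
    using order_trans[OF abs_ge_zero f_bound] order_trans[OF abs_ge_zero y_bound] by auto
  define c where "c \<omega> = complex_of_real (y (X a \<omega>) * additive f a u \<omega> ^ p)" for \<omega>
  have c_meas [measurable]: "c \<in> borel_measurable M" unfolding c_def by measurable
  define K where "K = Y * (B * (u - a)) ^ p"
  have K: "0 \<le> K" unfolding K_def using B Y au by simp
  have c_bound: "norm (c \<omega>) \<le> K" for \<omega>
    unfolding c_def K_def using abs_additive_le[OF f_bound au, where \<omega> = \<omega>] y_bound B Y au
    by (auto simp: norm_mult abs_mult power_abs simp del: of_real_mult of_real_power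
             intro!: mult_mono power_mono)
  have bd: "integrable (M \<Otimes>\<^sub>M lborel) (\<lambda>(\<omega>, \<xi>). K * norm (F \<xi>))"
    using F K by (intro P.Fubini_integrable) (auto simp: split_beta' intro!: integrable_mult_right integrable_norm)
  have int: "integrable (M \<Otimes>\<^sub>M lborel) (\<lambda>(\<omega>, \<xi>). F \<xi> * (c \<omega> * iexp ((\<zeta> + \<xi>) * X u \<omega>)))"
    using c_bound K
    by (intro Bochner_Integration.integrable_bound[OF bd])
       (auto simp: split_beta' norm_mult mult.commute[of K] intro!: mult_left_mono AE_I2)
  have "(CLINT \<omega>|M. of_real (y (X a \<omega>) * additive f a u \<omega> ^ p * f (X u \<omega>)) * iexp (\<zeta> * X u \<omega>)) =
      (CLINT \<omega>|M. CLINT \<xi>|lborel. F \<xi> * (c \<omega> * iexp ((\<zeta> + \<xi>) * X u \<omega>)))"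
  proof (rule Bochner_Integration.integral_cong[OF refl])
    fix \<omega>
    have "of_real (y (X a \<omega>) * additive f a u \<omega> ^ p * f (X u \<omega>)) * iexp (\<zeta> * X u \<omega>) =
        c \<omega> * iexp (\<zeta> * X u \<omega>) * (CLINT \<xi>|lborel. F \<xi> * iexp (\<xi> * X u \<omega>))"
      unfolding c_def inv[symmetric] by simp
    also have "\<dots> = (CLINT \<xi>|lborel. F \<xi> * (c \<omega> * iexp ((\<zeta> + \<xi>) * X u \<omega>)))"
    proof -
      have "c \<omega> * iexp (\<zeta> * X u \<omega>) * (CLINT \<xi>|lborel. F \<xi> * iexp (\<xi> * X u \<omega>)) =
          (CLINT \<xi>|lborel. c \<omega> * iexp (\<zeta> * X u \<omega>) * (F \<xi> * iexp (\<xi> * X u \<omega>)))"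
        by (rule integral_mult_right_zero[symmetric])
      then show ?thesis by (simp add: ring_distribs exp_add mult_ac)
    qed
    finally show "of_real (y (X a \<omega>) * additive f a u \<omega> ^ p * f (X u \<omega>)) * iexp (\<zeta> * X u \<omega>) =
        (CLINT \<xi>|lborel. F \<xi> * (c \<omega> * iexp ((\<zeta> + \<xi>) * X u \<omega>)))" .
  qed
  also have "\<dots> = (CLINT \<xi>|lborel. CLINT \<omega>|M. F \<xi> * (c \<omega> * iexp ((\<zeta> + \<xi>) * X u \<omega>)))"
    using P.Fubini_integral[OF int] by simp
  also have "\<dots> = (CLINT \<xi>|lborel. F \<xi> * moment f y a p (\<zeta> + \<xi>) u)"
    unfolding moment_def c_def by simp
  also have "ennreal (norm \<dots>) \<le> (\<integral>\<^sup>+\<xi>. ennreal (norm (F \<xi> * moment f y a p (\<zeta> + \<xi>) u)) \<partial>lborel)"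
    by (rule norm_integral_le_nn_integral)
  also have "\<dots> = (\<integral>\<^sup>+\<eta>. ennreal (norm (F (\<eta> - \<zeta>)) * norm (moment f y a p \<eta> u)) \<partial>lborel)"
    by (subst nn_integral_real_affine[where c = 1 and t = "-\<zeta>"]) (auto simp: norm_mult)
  finally show ?thesis .
qed

text \<open>One step of the Fourier recursion: the latest of the \<open>p + 1\<close> time variables is called \<open>u\<close>, the
  increment after \<open>u\<close> contributes the exponential factor, and \<open>f (X u)\<close> is expanded into characters.\<close>
lemma norm_moment_Suc_le:
  fixes f y :: "real \<Rightarrow> real" and F :: "real \<Rightarrow> complex"
  assumes times: "0 < a" "a \<le> t"
    and f: "continuous_on UNIV f" and f_bound: "\<And>x. \<bar>f x\<bar> \<le> B"
    and F: "integrable lborel F"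
    and inv: "\<And>x. complex_of_real (f x) = (CLINT \<xi>|lborel. F \<xi> * iexp (\<xi> * x))"
    and y [measurable]: "y \<in> borel_measurable borel" and y_bound: "\<And>x. \<bar>y x\<bar> \<le> Y"
  shows "ennreal (norm (moment f y a (Suc p) \<zeta> t)) \<le> ennreal (Suc p) *
    (\<integral>\<^sup>+u. indicator {a..t} u * ennreal (exp (- ((t - u) * \<psi> \<zeta>))) *
      (\<integral>\<^sup>+\<eta>. ennreal (norm (F (\<eta> - \<zeta>)) * norm (moment f y a p \<eta> u)) \<partial>lborel) \<partial>lborel)"
proof -
  let ?R = "\<lambda>u. indicator {a..t} u * ennreal (exp (- ((t - u) * \<psi> \<zeta>))) *
      (\<integral>\<^sup>+\<eta>. ennreal (norm (F (\<eta> - \<zeta>)) * norm (moment f y a p \<eta> u)) \<partial>lborel)"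
  have f_meas [measurable]: "f \<in> borel_measurable borel"
    using f by (rule borel_measurable_continuous_onI)
  have B: "0 \<le> B" and Y: "0 \<le> Y"
    using order_trans[OF abs_ge_zero f_bound] order_trans[OF abs_ge_zero y_bound] by auto
  define W where "W u \<omega> = complex_of_real (y (X a \<omega>) * additive f a u \<omega> ^ p * f (X u \<omega>)) * iexp (\<zeta> * X t \<omega>)"
    for u \<omega>
  define K where "K = Y * (B * (t - a)) ^ p * B"
  have W_bound: "norm (W u \<omega>) \<le> K" if "u \<in> {a..t}" for u \<omega>
  proof -
    have "\<bar>additive f a u \<omega>\<bar> \<le> B * (u - a)"
      using that by (intro abs_additive_le[OF f_bound]) auto
    also have "\<dots> \<le> B * (t - a)" using that B by (intro mult_left_mono) auto
    finally show ?thesis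
      unfolding W_def K_def using y_bound f_bound B Y times
      by (auto simp: norm_mult abs_mult power_abs simp del: of_real_mult of_real_power
               intro!: mult_mono power_mono)
  qed
  have [measurable]: "(\<lambda>(\<omega>, u). W u \<omega>) \<in> borel_measurable (M \<Otimes>\<^sub>M lborel)"
    unfolding W_def by (simp add: split_beta')
  have "moment f y a (Suc p) \<zeta> t = (CLINT \<omega>|M. of_nat (Suc p) * (CLINT u|lborel. indicator {a..t} u * W u \<omega>))"
    unfolding moment_def
  proof (rule Bochner_Integration.integral_cong[OF refl])
    fix \<omega> assume \<omega>: "\<omega> \<in> space M"
    let ?g = "\<lambda>r. indicator {a..t} r * f (X r \<omega>)"
    have sub: "(LINT v|lborel. indicator {..u} v * ?g v) = additive f a u \<omega>" if "u \<in> {a..t}" for u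
      unfolding additive_def using that
      by (intro Bochner_Integration.integral_cong) (auto split: split_indicator)
    have "additive f a t \<omega> ^ Suc p = real (Suc p) * (LINT u|lborel. ?g u * (LINT v|lborel. indicator {..u} v * ?g v) ^ p)"
      unfolding additive_def
      by (rule power_integral_eq(1)[OF integrable_along_path[OF \<omega> f_meas f_bound]])
    also have "(LINT u|lborel. ?g u * (LINT v|lborel. indicator {..u} v * ?g v) ^ p) =
        (LINT u|lborel. indicator {a..t} u * (additive f a u \<omega> ^ p * f (X u \<omega>)))"
      using sub by (intro Bochner_Integration.integral_cong) (auto split: split_indicator)
    finally have "complex_of_real (y (X a \<omega>) * additive f a t \<omega> ^ Suc p) * iexp (\<zeta> * X t \<omega>) =
        of_nat (Suc p) * (complex_of_real (LINT u|lborel. indicator {a..t} u * (additive f a u \<omega> ^ p * f (X u \<omega>))) *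
          (of_real (y (X a \<omega>)) * iexp (\<zeta> * X t \<omega>)))"
      by (simp add: mult_ac del: power_Suc of_nat_Suc)
    also have "complex_of_real (LINT u|lborel. indicator {a..t} u * (additive f a u \<omega> ^ p * f (X u \<omega>))) *
          (of_real (y (X a \<omega>)) * iexp (\<zeta> * X t \<omega>)) = (CLINT u|lborel. indicator {a..t} u * W u \<omega>)"
    proof -
      have "complex_of_real (LINT u|lborel. indicator {a..t} u * (additive f a u \<omega> ^ p * f (X u \<omega>))) *
            (of_real (y (X a \<omega>)) * iexp (\<zeta> * X t \<omega>)) =
          (CLINT u|lborel. complex_of_real (indicator {a..t} u * (additive f a u \<omega> ^ p * f (X u \<omega>))) *
            (of_real (y (X a \<omega>)) * iexp (\<zeta> * X t \<omega>)))"
        unfolding integral_complex_of_real[symmetric] by (rule integral_mult_left_zero[symmetric])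
      also have "\<dots> = (CLINT u|lborel. indicator {a..t} u * W u \<omega>)"
        unfolding W_def
        by (intro Bochner_Integration.integral_cong) (auto split: split_indicator)
      finally show ?thesis .
    qed
    finally show "complex_of_real (y (X a \<omega>) * additive f a t \<omega> ^ Suc p) * iexp (\<zeta> * X t \<omega>) =
        of_nat (Suc p) * (CLINT u|lborel. indicator {a..t} u * W u \<omega>)" .
  qed
  also have "\<dots> = of_nat (Suc p) * (CLINT \<omega>|M. CLINT u|lborel. indicator {a..t} u * W u \<omega>)"
    by simp
  also have "(CLINT \<omega>|M. CLINT u|lborel. indicator {a..t} u * W u \<omega>) =
      (CLINT u|lborel. CLINT \<omega>|M. indicator {a..t} u * W u \<omega>)"
  proof -
    have "indicat_real {a..t} u *\<^sub>R w = indicator {a..t} u * w" for u and w :: complex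
      by (simp split: split_indicator)
    then show ?thesis using expectation_time_integral[of W a t K] W_bound by simp
  qed
  finally have "ennreal (norm (moment f y a (Suc p) \<zeta> t)) =
      ennreal (Suc p) * ennreal (norm (CLINT u|lborel. CLINT \<omega>|M. indicator {a..t} u * W u \<omega>))"
    by (simp add: norm_mult ennreal_mult del: of_nat_Suc)
  also have "\<dots> \<le> ennreal (Suc p) * (\<integral>\<^sup>+u. ennreal (norm (CLINT \<omega>|M. indicator {a..t} u * W u \<omega>)) \<partial>lborel)"
    by (intro mult_left_mono norm_integral_le_nn_integral) auto
  also have "\<dots> \<le> ennreal (Suc p) * (\<integral>\<^sup>+u. ?R u \<partial>lborel)"
  proof (intro mult_left_mono nn_integral_mono_AE)
    have "ennreal (norm (CLINT \<omega>|M. indicator {a..t} u * W u \<omega>)) \<le> ?R u"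
      if ne: "u \<noteq> a" "u \<noteq> t" for u
    proof (cases "u \<in> {a..t}")
      case True
      then have u: "a < u" "u < t" using ne by auto
      let ?G = "\<lambda>\<omega>. of_real (y (X a \<omega>) * additive f a u \<omega> ^ p * f (X u \<omega>)) * iexp (\<zeta> * X u \<omega>)"
      have "(CLINT \<omega>|M. W u \<omega>) = (CLINT \<omega>|M. ?G \<omega> * iexp (\<zeta> * (X t \<omega> - X u \<omega>)))"
        unfolding W_def
        by (intro Bochner_Integration.integral_cong) (auto simp: mult.assoc ring_distribs simp flip: exp_add)
      also have "\<dots> = (CLINT \<omega>|M. ?G \<omega>) * of_real (exp (- ((t - u) * \<psi> \<zeta>)))"
        by (rule additive_functional_past_increment[OF times(1) u f f_bound y y_bound])
      finally have "norm (CLINT \<omega>|M. W u \<omega>) = exp (- ((t - u) * \<psi> \<zeta>)) * norm (CLINT \<omega>|M. ?G \<omega>)"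
        by (simp add: norm_mult)
      then have "ennreal (norm (CLINT \<omega>|M. W u \<omega>)) =
          ennreal (exp (- ((t - u) * \<psi> \<zeta>))) * ennreal (norm (CLINT \<omega>|M. ?G \<omega>))"
        by (simp add: ennreal_mult)
      also have "\<dots> \<le> ennreal (exp (- ((t - u) * \<psi> \<zeta>))) *
          (\<integral>\<^sup>+\<eta>. ennreal (norm (F (\<eta> - \<zeta>)) * norm (moment f y a p \<eta> u)) \<partial>lborel)"
        using u by (intro mult_left_mono norm_expectation_fourier_le[OF f_meas f_bound _ F inv y y_bound]) auto
      finally show ?thesis using True by simp
    qed simp
    then show "AE u in lborel. ennreal (norm (CLINT \<omega>|M. indicator {a..t} u * W u \<omega>)) \<le> ?R u"
      using AE_lborel_singleton[of a] AE_lborel_singleton[of t] by auto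
  qed auto
  finally show ?thesis .
qed

end

section \<open>Moment bounds for additive functionals\<close>

text \<open>A test function \<open>f\<close> with Fourier transform \<open>F\<close>, together with a weight \<open>V\<close> that makes the kernel
  \<open>F (\<eta> - \<zeta>)\<close> of the recursion comparable with a product. The product form lets the induction over
  \<open>p\<close> reproduce the same bound with one more factor \<open>\<kappa> * J\<close>.\<close>
locale levy_functional = levy_paths +
  fixes f :: "real \<Rightarrow> real" and F :: "real \<Rightarrow> complex" and V :: "real \<Rightarrow> real"
    and B \<kappa> J q :: real
  assumes f_cont: "continuous_on UNIV f" and f_bound: "\<And>x. \<bar>f x\<bar> \<le> B"
    and F_int: "integrable lborel F"
    and inversion: "\<And>x. complex_of_real (f x) = (CLINT \<xi>|lborel. F \<xi> * iexp (\<xi> * x))"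
    and V_measurable [measurable]: "V \<in> borel_measurable borel"
    and V_ge_1: "\<And>\<xi>. 1 \<le> V \<xi>" and V_0: "V 0 = 1"
    and kernel: "\<And>\<eta> \<zeta>. norm (F (\<eta> - \<zeta>)) \<le> \<kappa> * V \<eta> * V \<zeta>"
    and \<kappa>_nonneg: "0 \<le> \<kappa>" and J_nonneg: "0 \<le> J" and q_pos: "0 < q"
    and resolvent: "(\<integral>\<^sup>+\<eta>. ennreal (V \<eta> ^ 2 / (q + \<psi> \<eta>)) \<partial>lborel) \<le> ennreal J"
begin

lemma f_measurable [measurable]: "f \<in> borel_measurable borel"
  using f_cont by (rule borel_measurable_continuous_onI)

lemma F_measurable [measurable]: "F \<in> borel_measurable borel"
  using F_int by auto

lemma q_plus_pos: "0 < q + \<psi> \<xi>"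
  using q_pos \<psi>_nonneg[of \<xi>] by simp

text \<open>After time and frequency are exchanged, the Laplace transforms in the hypothesis are integrated
  against the product kernel, and the two factors \<open>V \<eta>\<close> combine with \<open>1 / (q + \<psi> \<eta>)\<close> into
  the integrand of \<open>J\<close>.\<close>
lemma fourier_step_le:
  assumes [measurable]: "y \<in> borel_measurable borel" and C: "0 \<le> C"
    and laplace: "\<And>\<eta>. (\<integral>\<^sup>+t. indicator {a..b} t * ennreal (exp (- (q * (t - a)))) *
        ennreal (norm (moment f y a p \<eta> t)) \<partial>lborel) \<le> ennreal (C * V \<eta> / (q + \<psi> \<eta>))"
  shows "(\<integral>\<^sup>+u. indicator {a..b} u * ennreal (exp (- (q * (u - a)))) *
      (\<integral>\<^sup>+\<eta>. ennreal (norm (F (\<eta> - \<zeta>)) * norm (moment f y a p \<eta> u)) \<partial>lborel) \<partial>lborel)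
    \<le> ennreal (C * (\<kappa> * J) * V \<zeta>)"
proof -
  have nn: "0 \<le> V \<xi>" for \<xi> using V_ge_1[of \<xi>] by simp
  have "(\<integral>\<^sup>+u. indicator {a..b} u * ennreal (exp (- (q * (u - a)))) *
      (\<integral>\<^sup>+\<eta>. ennreal (norm (F (\<eta> - \<zeta>)) * norm (moment f y a p \<eta> u)) \<partial>lborel) \<partial>lborel) =
    (\<integral>\<^sup>+u. \<integral>\<^sup>+\<eta>. ennreal (norm (F (\<eta> - \<zeta>))) * (indicator {a..b} u * ennreal (exp (- (q * (u - a)))) *
        ennreal (norm (moment f y a p \<eta> u))) \<partial>lborel \<partial>lborel)"
    by (subst nn_integral_cmult[symmetric])
       (auto intro!: nn_integral_cong simp: ennreal_mult mult_ac)
  also have "\<dots> = (\<integral>\<^sup>+\<eta>. \<integral>\<^sup>+u. ennreal (norm (F (\<eta> - \<zeta>))) * (indicator {a..b} u * ennreal (exp (- (q * (u - a)))) *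
        ennreal (norm (moment f y a p \<eta> u))) \<partial>lborel \<partial>lborel)"
    by (rule lborel_pair.Fubini') (simp add: split_beta')
  also have "\<dots> = (\<integral>\<^sup>+\<eta>. ennreal (norm (F (\<eta> - \<zeta>))) * (\<integral>\<^sup>+u. indicator {a..b} u * ennreal (exp (- (q * (u - a)))) *
        ennreal (norm (moment f y a p \<eta> u)) \<partial>lborel) \<partial>lborel)"
    by (simp add: nn_integral_cmult)
  also have "\<dots> \<le> (\<integral>\<^sup>+\<eta>. ennreal (\<kappa> * V \<eta> * V \<zeta>) * ennreal (C * V \<eta> / (q + \<psi> \<eta>)) \<partial>lborel)"
    using kernel laplace by (intro nn_integral_mono mult_mono ennreal_leI) auto
  also have "\<dots> = (\<integral>\<^sup>+\<eta>. ennreal (C * \<kappa> * V \<zeta>) * ennreal (V \<eta> ^ 2 / (q + \<psi> \<eta>)) \<partial>lborel)"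
    using C nn \<kappa>_nonneg q_plus_pos
    by (intro nn_integral_cong)
       (simp add: ennreal_mult[symmetric] less_imp_le power2_eq_square mult_ac)
  also have "\<dots> = ennreal (C * \<kappa> * V \<zeta>) * (\<integral>\<^sup>+\<eta>. ennreal (V \<eta> ^ 2 / (q + \<psi> \<eta>)) \<partial>lborel)"
    by (rule nn_integral_cmult) measurable
  also have "\<dots> \<le> ennreal (C * \<kappa> * V \<zeta>) * ennreal J"
    by (intro mult_left_mono resolvent) auto
  also have "\<dots> = ennreal (C * (\<kappa> * J) * V \<zeta>)"
    using C nn \<kappa>_nonneg J_nonneg by (simp add: ennreal_mult[symmetric] mult_ac)
  finally show ?thesis .
qed

text \<open>The Laplace transform in time at rate \<open>q\<close> turns the convolution with \<open>exp (- t * \<psi> \<zeta>)\<close> in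
  \<open>norm_moment_Suc_le\<close> into a division by \<open>q + \<psi> \<zeta>\<close>. The estimate is uniform in the end point \<open>b\<close> of the
  time interval; all dependence on its length enters later, through a single factor
  \<open>exp (q * (b - a))\<close>.\<close>
lemma laplace_moment_le:
  assumes a: "0 < a"
    and y [measurable]: "y \<in> borel_measurable borel" and y_bound: "\<And>x. \<bar>y x\<bar> \<le> Y"
  shows "(\<integral>\<^sup>+t. indicator {a..b} t * ennreal (exp (- (q * (t - a)))) *
        ennreal (norm (moment f y a p \<zeta> t)) \<partial>lborel)
    \<le> ennreal (expectation (\<lambda>\<omega>. \<bar>y (X a \<omega>)\<bar>) * fact p * (\<kappa> * J) ^ p * V \<zeta> / (q + \<psi> \<zeta>))"
proof -
  let ?E = "expectation (\<lambda>\<omega>. \<bar>y (X a \<omega>)\<bar>)"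
  have E: "0 \<le> ?E" by (intro integral_nonneg_AE) auto
  let ?D = "\<lambda>t. indicator {a..b} t * ennreal (exp (- (q * (t - a))))"
  note c = q_plus_pos
  show ?thesis
  proof (induction p arbitrary: \<zeta>)
    case 0
    let ?T = "\<lambda>u t. ennreal (exp (- ((q + \<psi> \<zeta>) * (t - u)))) * indicator {u..} t"
    have "(\<integral>\<^sup>+t. ?D t * ennreal (norm (moment f y a 0 \<zeta> t)) \<partial>lborel) \<le>
        (\<integral>\<^sup>+t. ennreal ?E * ?T a t \<partial>lborel)"
    proof (rule nn_integral_mono_AE)
      have "?D t * ennreal (norm (moment f y a 0 \<zeta> t)) \<le> ennreal ?E * ?T a t" if "t \<noteq> a" for t
      proof (cases "t \<in> {a..b}")
        case True
        then have "a < t" using that by auto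
        from norm_moment_0_le[OF a this y y_bound]
        have "exp (- (q * (t - a))) * norm (moment f y a 0 \<zeta> t) \<le>
            exp (- (q * (t - a))) * (?E * exp (- ((t - a) * \<psi> \<zeta>)))"
          by (intro mult_left_mono) auto
        also have "\<dots> = ?E * (exp (- (q * (t - a))) * exp (- ((t - a) * \<psi> \<zeta>)))" by simp
        also have "\<dots> = ?E * exp (- ((q + \<psi> \<zeta>) * (t - a)))"
          unfolding exp_add[symmetric] by (simp add: algebra_simps)
        finally show ?thesis using True E
          by (simp add: ennreal_mult[symmetric])
      qed simp
      then show "AE t in lborel. ?D t * ennreal (norm (moment f y a 0 \<zeta> t)) \<le> ennreal ?E * ?T a t"
        using AE_lborel_singleton[of a] by auto
    qed
    also have "\<dots> = ennreal ?E * ennreal (1 / (q + \<psi> \<zeta>))"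
      using nn_integral_exp_atLeast[OF c] by (subst nn_integral_cmult) auto
    also have "\<dots> = ennreal (?E / (q + \<psi> \<zeta>))"
      using E c[of \<zeta>] by (simp add: ennreal_mult[symmetric])
    also have "\<dots> \<le> ennreal (?E * V \<zeta> / (q + \<psi> \<zeta>))"
      using mult_left_mono[OF V_ge_1[of \<zeta>] E] c[of \<zeta>]
      by (intro ennreal_leI divide_right_mono) auto
    finally show ?case by simp
  next
    case (Suc p)
    let ?C = "?E * fact p * (\<kappa> * J) ^ p"
    have C: "0 \<le> ?C" using E \<kappa>_nonneg J_nonneg by simp
    let ?\<Psi> = "\<lambda>u. \<integral>\<^sup>+\<eta>. ennreal (norm (F (\<eta> - \<zeta>)) * norm (moment f y a p \<eta> u)) \<partial>lborel"
    let ?T = "\<lambda>u t. ennreal (exp (- ((q + \<psi> \<zeta>) * (t - u)))) * indicator {u..} t"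
    let ?g = "\<lambda>t u. ennreal (Suc p) * (indicator {a..b} t * indicator {a..t} u *
        ennreal (exp (- (q * (t - a)))) * ennreal (exp (- ((t - u) * \<psi> \<zeta>))) * ?\<Psi> u)"
    let ?G = "\<lambda>t. \<integral>\<^sup>+u. indicator {a..t} u * ennreal (exp (- ((t - u) * \<psi> \<zeta>))) * ?\<Psi> u \<partial>lborel"
    have "(\<integral>\<^sup>+t. ?D t * ennreal (norm (moment f y a (Suc p) \<zeta> t)) \<partial>lborel) \<le> (\<integral>\<^sup>+t. ?D t *
          (ennreal (Suc p) * ?G t) \<partial>lborel)"
    proof (rule nn_integral_mono)
      fix t
      show "?D t * ennreal (norm (moment f y a (Suc p) \<zeta> t)) \<le> ?D t * (ennreal (Suc p) * ?G t)"
      proof (cases "a \<le> t")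
        case True
        show ?thesis
          by (intro mult_left_mono norm_moment_Suc_le[OF a True f_cont f_bound F_int inversion y y_bound]) auto
      qed simp
    qed
    also have "\<dots> = (\<integral>\<^sup>+t. \<integral>\<^sup>+u. ?g t u \<partial>lborel \<partial>lborel)"
    proof (rule nn_integral_cong)
      fix t
      have [measurable]: "(\<lambda>u. indicator {a..t} u * ennreal (exp (- ((t - u) * \<psi> \<zeta>))) * ?\<Psi> u) \<in> borel_measurable lborel"
        by measurable
      show "?D t * (ennreal (Suc p) * ?G t) = (\<integral>\<^sup>+u. ?g t u \<partial>lborel)"
        by (subst nn_integral_cmult[symmetric], simp, subst nn_integral_cmult[symmetric], simp)
           (auto intro!: nn_integral_cong simp: mult_ac)
    qed
    also have "\<dots> = (\<integral>\<^sup>+u. \<integral>\<^sup>+t. ?g t u \<partial>lborel \<partial>lborel)"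
    proof (rule lborel_pair.Fubini')
      have [measurable]: "(\<lambda>x. indicator {a..snd x} (fst x)) \<in> borel_measurable (borel \<Otimes>\<^sub>M borel)"
        by (simp add: indicator_def)
      show "(\<lambda>(u, t). ?g t u) \<in> borel_measurable (lborel \<Otimes>\<^sub>M lborel)"
        by (simp add: split_beta')
    qed
    also have "\<dots> \<le> (\<integral>\<^sup>+u. ennreal (Suc p / (q + \<psi> \<zeta>)) * (?D u * ?\<Psi> u) \<partial>lborel)"
    proof (rule nn_integral_mono)
      fix u
      have "(\<integral>\<^sup>+t. ?g t u \<partial>lborel) \<le> (\<integral>\<^sup>+t. (ennreal (Suc p) * (?D u * ?\<Psi> u)) * ?T u t \<partial>lborel)"
      proof (rule nn_integral_mono)
        fix t
        have "ennreal (exp (- (q * (t - a)))) * ennreal (exp (- ((t - u) * \<psi> \<zeta>))) =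
            ennreal (exp (- (q * (u - a)))) * ennreal (exp (- ((q + \<psi> \<zeta>) * (t - u))))"
          unfolding ennreal_mult[OF exp_ge_zero exp_ge_zero, symmetric] exp_add[symmetric]
          by (simp add: algebra_simps)
        then show "?g t u \<le> (ennreal (Suc p) * (?D u * ?\<Psi> u)) * ?T u t"
          by (auto split: split_indicator simp: mult.assoc intro!: mult_left_mono)
             (auto simp: mult_ac)
      qed
      also have "\<dots> = (ennreal (Suc p) * (?D u * ?\<Psi> u)) * ennreal (1 / (q + \<psi> \<zeta>))"
        using nn_integral_exp_atLeast[OF c] by (subst nn_integral_cmult) auto
      also have "\<dots> = (ennreal (Suc p) * ennreal (1 / (q + \<psi> \<zeta>))) * (?D u * ?\<Psi> u)"
        by (simp add: mult_ac)
      also have "ennreal (Suc p) * ennreal (1 / (q + \<psi> \<zeta>)) = ennreal (Suc p / (q + \<psi> \<zeta>))"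
        using c[of \<zeta>] by (subst ennreal_mult[symmetric]) auto
      finally show "(\<integral>\<^sup>+t. ?g t u \<partial>lborel) \<le> ennreal (Suc p / (q + \<psi> \<zeta>)) * (?D u * ?\<Psi> u)" .
    qed
    also have "\<dots> = ennreal (Suc p / (q + \<psi> \<zeta>)) * (\<integral>\<^sup>+u. ?D u * ?\<Psi> u \<partial>lborel)"
      by (rule nn_integral_cmult) measurable
    also have "\<dots> \<le> ennreal (Suc p / (q + \<psi> \<zeta>)) * ennreal (?C * (\<kappa> * J) * V \<zeta>)"
      by (intro mult_left_mono fourier_step_le[OF y C Suc.IH]) auto
    also have "\<dots> = ennreal (?E * fact (Suc p) * (\<kappa> * J) ^ Suc p * V \<zeta> / (q + \<psi> \<zeta>))"
      using C c[of \<zeta>] \<kappa>_nonneg J_nonneg V_ge_1[of \<zeta>]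
      by (subst ennreal_mult[symmetric]) (auto simp: field_simps)
    finally show ?case .
  qed
qed

text \<open>The function \<open>y\<close> of the initial position makes this a bound conditional on \<open>X a\<close>, uniformly in the
  position. Inverting the Laplace transform costs at most the factor \<open>exp (q * (b - a))\<close>.\<close>
lemma weighted_additive_moment_le:
  assumes a: "0 < a" "a \<le> b"
    and y [measurable]: "y \<in> borel_measurable borel" and y_bound: "\<And>x. \<bar>y x\<bar> \<le> Y"
  shows "\<bar>expectation (\<lambda>\<omega>. y (X a \<omega>) * additive f a b \<omega> ^ p)\<bar> \<le>
    expectation (\<lambda>\<omega>. \<bar>y (X a \<omega>)\<bar>) * fact p * (\<kappa> * J) ^ p * exp (q * (b - a))"
proof (cases p)
  case 0
  have "\<bar>expectation (\<lambda>\<omega>. y (X a \<omega>))\<bar> \<le> expectation (\<lambda>\<omega>. \<bar>y (X a \<omega>)\<bar>)"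
    by (rule integral_abs_bound)
  also have "\<dots> \<le> expectation (\<lambda>\<omega>. \<bar>y (X a \<omega>)\<bar>) * exp (q * (b - a))"
  proof -
    have "0 \<le> expectation (\<lambda>\<omega>. \<bar>y (X a \<omega>)\<bar>)" by (intro integral_nonneg_AE) auto
    then show ?thesis
      using mult_left_mono[of 1 "exp (q * (b - a))" "expectation (\<lambda>\<omega>. \<bar>y (X a \<omega>)\<bar>)"] a q_pos by simp
  qed
  finally show ?thesis using 0 by simp
next
  case (Suc m)
  let ?E = "expectation (\<lambda>\<omega>. \<bar>y (X a \<omega>)\<bar>)"
  have E: "0 \<le> ?E" by (intro integral_nonneg_AE) auto
  let ?C = "?E * fact m * (\<kappa> * J) ^ m"
  have C: "0 \<le> ?C" using E \<kappa>_nonneg J_nonneg by simp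
  let ?\<Psi> = "\<lambda>u. \<integral>\<^sup>+\<eta>. ennreal (norm (F (\<eta> - 0)) * norm (moment f y a m \<eta> u)) \<partial>lborel"
  have "moment f y a p 0 b = of_real (expectation (\<lambda>\<omega>. y (X a \<omega>) * additive f a b \<omega> ^ p))"
    unfolding moment_def by (simp flip: integral_complex_of_real)
  then have "ennreal \<bar>expectation (\<lambda>\<omega>. y (X a \<omega>) * additive f a b \<omega> ^ p)\<bar> = ennreal (norm (moment f y a (Suc m) 0 b))"
    using Suc by simp
  also have "\<dots> \<le> ennreal (Suc m) * (\<integral>\<^sup>+u. indicator {a..b} u * ennreal (exp (- ((b - u) * \<psi> 0))) * ?\<Psi> u \<partial>lborel)"
    by (rule norm_moment_Suc_le[OF a f_cont f_bound F_int inversion y y_bound])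
  also have "\<dots> \<le> ennreal (Suc m) * (\<integral>\<^sup>+u. ennreal (exp (q * (b - a))) *
      (indicator {a..b} u * ennreal (exp (- (q * (u - a)))) * ?\<Psi> u) \<partial>lborel)"
  proof (intro mult_left_mono nn_integral_mono)
    fix u
    show "indicator {a..b} u * ennreal (exp (- ((b - u) * \<psi> 0))) * ?\<Psi> u \<le> ennreal (exp (q * (b - a))) *
      (indicator {a..b} u * ennreal (exp (- (q * (u - a)))) * ?\<Psi> u)"
    proof (cases "u \<in> {a..b}")
      case True
      have "exp (- ((b - u) * \<psi> 0)) \<le> 1" using True \<psi>_nonneg by auto
      also have "1 \<le> exp (q * (b - a)) * exp (- (q * (u - a)))"
        unfolding exp_add[symmetric] using True q_pos
        by (simp add: algebra_simps mult_left_mono)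
      finally have "ennreal (exp (- ((b - u) * \<psi> 0))) \<le> ennreal (exp (q * (b - a))) * ennreal (exp (- (q * (u - a))))"
        by (simp add: ennreal_mult[symmetric] ennreal_leI)
      then show ?thesis using True by (auto simp: mult.assoc[symmetric] intro!: mult_right_mono)
    qed simp
  qed simp
  also have "\<dots> = ennreal (Suc m) * (ennreal (exp (q * (b - a))) * (\<integral>\<^sup>+u. 
      (indicator {a..b} u * ennreal (exp (- (q * (u - a)))) * ?\<Psi> u) \<partial>lborel))"
    by (subst nn_integral_cmult) auto
  also have "\<dots> \<le> ennreal (Suc m) * (ennreal (exp (q * (b - a))) * ennreal (?C * (\<kappa> * J) * V 0))"
    by (intro mult_left_mono fourier_step_le[OF y C] laplace_moment_le[OF a(1) y y_bound]) auto
  also have "\<dots> = ennreal (?E * fact p * (\<kappa> * J) ^ p * exp (q * (b - a)))"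
    using C J_nonneg \<kappa>_nonneg unfolding Suc V_0
    by (simp add: ennreal_mult[symmetric] mult_ac distrib_left del: of_nat_Suc)
  finally show ?thesis
    using E J_nonneg \<kappa>_nonneg by (subst (asm) ennreal_le_iff) auto
qed

lemma translate: "levy_functional M X \<psi> (\<lambda>z. f (z - x)) (\<lambda>\<xi>. F \<xi> * iexp (- (\<xi> * x))) V B \<kappa> J q"
proof -
  have "complex_of_real (f (z - x)) = (CLINT \<xi>|lborel. F \<xi> * iexp (- (\<xi> * x)) * iexp (\<xi> * z))" for z
    unfolding inversion
    by (intro Bochner_Integration.integral_cong)
       (auto simp: mult.assoc algebra_simps simp flip: exp_add)
  moreover have "integrable lborel (\<lambda>\<xi>. F \<xi> * iexp (- (\<xi> * x)))"
    by (rule Bochner_Integration.integrable_bound[OF F_int]) (auto simp: norm_mult)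
  moreover have "norm (F (\<eta> - \<zeta>) * iexp (- ((\<eta> - \<zeta>) * x))) \<le> \<kappa> * V \<eta> * V \<zeta>" for \<eta> \<zeta>
    using kernel[of \<eta> \<zeta>] by (simp add: norm_mult)
  moreover have "continuous_on UNIV (\<lambda>z. f (z - x))"
    by (intro continuous_on_compose2[OF f_cont]) (auto intro!: continuous_intros)
  ultimately show ?thesis
    by unfold_locales
       (use f_bound V_ge_1 V_0 \<kappa>_nonneg J_nonneg q_pos resolvent in auto)
qed

text \<open>The earliest time variable \<open>u\<close> of \<open>A\<^sup>m\<^sup>+\<^sup>1\<close> is singled out, and the remaining power is estimated
  conditionally on \<open>X u\<close>. The factor \<open>\<bar>f (X u)\<bar>\<close> is kept, because its integral over all translates of
  \<open>f\<close> does not depend on the law of \<open>X u\<close>.\<close>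
lemma additive_moment_le:
  assumes a: "0 \<le> a" "a < b"
  shows "ennreal \<bar>expectation (\<lambda>\<omega>. additive f a b \<omega> ^ Suc m)\<bar> \<le>
    ennreal (fact (Suc m) * (\<kappa> * J) ^ m * exp (q * (b - a))) *
    (\<integral>\<^sup>+u. indicator {a..b} u * (\<integral>\<^sup>+\<omega>. ennreal \<bar>f (X u \<omega>)\<bar> \<partial>M) \<partial>lborel)"
proof -
  let ?N = "\<lambda>u. \<integral>\<^sup>+\<omega>. ennreal \<bar>f (X u \<omega>)\<bar> \<partial>M" and ?E = "\<lambda>u. expectation (\<lambda>\<omega>. \<bar>f (X u \<omega>)\<bar>)"
  have B: "0 \<le> B" using order_trans[OF abs_ge_zero f_bound] .
  define W where "W u \<omega> = f (X u \<omega>) * additive f u b \<omega> ^ m" for u \<omega>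
  define K where "K = B * (B * (b - a)) ^ m"
  have W_bound: "\<bar>W u \<omega>\<bar> \<le> K" if "u \<in> {a..b}" for u \<omega>
  proof -
    have "\<bar>additive f u b \<omega>\<bar> \<le> B * (b - u)"
      using that by (intro abs_additive_le[OF f_bound]) auto
    also have "\<dots> \<le> B * (b - a)" using that B by (intro mult_left_mono) auto
    finally show ?thesis
      unfolding W_def K_def using f_bound B a
      by (auto simp: abs_mult power_abs intro!: mult_mono power_mono)
  qed
  have [measurable]: "(\<lambda>(\<omega>, u). W u \<omega>) \<in> borel_measurable (M \<Otimes>\<^sub>M lborel)"
    unfolding W_def by (simp add: split_beta')
  have "expectation (\<lambda>\<omega>. additive f a b \<omega> ^ Suc m) =
      (LINT \<omega>|M. real (Suc m) * (LINT u|lborel. indicator {a..b} u * W u \<omega>))"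
  proof (rule Bochner_Integration.integral_cong[OF refl])
    fix \<omega> assume \<omega>: "\<omega> \<in> space M"
    let ?g = "\<lambda>r. indicator {a..b} r * f (X r \<omega>)"
    have sub: "(LINT v|lborel. indicator {u..} v * ?g v) = additive f u b \<omega>" if "u \<in> {a..b}" for u
      unfolding additive_def using that
      by (intro Bochner_Integration.integral_cong) (auto split: split_indicator)
    have "additive f a b \<omega> ^ Suc m = real (Suc m) * (LINT u|lborel. ?g u * (LINT v|lborel. indicator {u..} v * ?g v) ^ m)"
      unfolding additive_def
      by (rule power_integral_eq_backward[OF integrable_along_path[OF \<omega> f_measurable f_bound]])
    also have "(LINT u|lborel. ?g u * (LINT v|lborel. indicator {u..} v * ?g v) ^ m) =
        (LINT u|lborel. indicator {a..b} u * W u \<omega>)"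
      unfolding W_def using sub by (intro Bochner_Integration.integral_cong) (auto split: split_indicator)
    finally show "additive f a b \<omega> ^ Suc m = real (Suc m) * (LINT u|lborel. indicator {a..b} u * W u \<omega>)" .
  qed
  also have "\<dots> = real (Suc m) * (LINT \<omega>|M. LINT u|lborel. indicator {a..b} u * W u \<omega>)"
    by simp
  also have "(LINT \<omega>|M. LINT u|lborel. indicator {a..b} u * W u \<omega>) =
      (LINT u|lborel. LINT \<omega>|M. indicator {a..b} u * W u \<omega>)"
    using expectation_time_integral[of W a b K] W_bound by simp
  finally have "ennreal \<bar>expectation (\<lambda>\<omega>. additive f a b \<omega> ^ Suc m)\<bar> =
      ennreal (Suc m) * ennreal (norm (LINT u|lborel. LINT \<omega>|M. indicator {a..b} u * W u \<omega>))"
    by (simp add: abs_mult ennreal_mult del: of_nat_Suc)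
  also have "\<dots> \<le> ennreal (Suc m) * (\<integral>\<^sup>+u. ennreal (norm (LINT \<omega>|M. indicator {a..b} u * W u \<omega>)) \<partial>lborel)"
    by (intro mult_left_mono norm_integral_le_nn_integral) auto
  also have "\<dots> \<le> ennreal (Suc m) * (\<integral>\<^sup>+u. ennreal (fact m * (\<kappa> * J) ^ m * exp (q * (b - a))) *
      (indicator {a..b} u * ?N u) \<partial>lborel)"
  proof (intro mult_left_mono nn_integral_mono_AE)
    have "ennreal (norm (LINT \<omega>|M. indicator {a..b} u * W u \<omega>)) \<le>
        ennreal (fact m * (\<kappa> * J) ^ m * exp (q * (b - a))) *
        (indicator {a..b} u * ?N u)" if ne: "u \<noteq> a" for u
    proof (cases "u \<in> {a..b}")
      case True
      then have u: "0 < u" "u \<le> b" using a ne by auto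
      have Ef: "?N u = ennreal (?E u)"
        by (intro nn_integral_eq_integral integrable_const_bound[where B = B]) (auto simp: f_bound)
      have E: "0 \<le> ?E u" by (intro integral_nonneg_AE) auto
      have "\<bar>expectation (\<lambda>\<omega>. W u \<omega>)\<bar> \<le> ?E u * fact m * (\<kappa> * J) ^ m * exp (q * (b - u))"
        unfolding W_def by (rule weighted_additive_moment_le[OF u f_measurable f_bound])
      also have "\<dots> \<le> ?E u * fact m * (\<kappa> * J) ^ m * exp (q * (b - a))"
        using E J_nonneg \<kappa>_nonneg True q_pos by (intro mult_left_mono) auto
      also have "\<dots> = (fact m * (\<kappa> * J) ^ m * exp (q * (b - a))) * ?E u"
        by simp
      finally have "ennreal \<bar>expectation (\<lambda>\<omega>. W u \<omega>)\<bar> \<le>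
          ennreal (fact m * (\<kappa> * J) ^ m * exp (q * (b - a))) * ennreal (?E u)"
        using E J_nonneg \<kappa>_nonneg by (subst ennreal_mult[symmetric]) (auto intro!: ennreal_leI)
      then show ?thesis using True Ef by simp
    qed simp
    then show "AE u in lborel. ennreal (norm (LINT \<omega>|M. indicator {a..b} u * W u \<omega>)) \<le>
        ennreal (fact m * (\<kappa> * J) ^ m * exp (q * (b - a))) * (indicator {a..b} u * ?N u)"
      using AE_lborel_singleton[of a] by auto
  qed simp
  also have "\<dots> = ennreal (Suc m) * (ennreal (fact m * (\<kappa> * J) ^ m * exp (q * (b - a))) *
      (\<integral>\<^sup>+u. indicator {a..b} u * ?N u \<partial>lborel))"
    by (subst nn_integral_cmult) auto
  also have "\<dots> = ennreal (real (Suc m) * (fact m * (\<kappa> * J) ^ m * exp (q * (b - a)))) *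
      (\<integral>\<^sup>+u. indicator {a..b} u * ?N u \<partial>lborel)"
    using J_nonneg \<kappa>_nonneg by (subst ennreal_mult) (auto simp: mult.assoc)
  also have "real (Suc m) * (fact m * (\<kappa> * J) ^ m * exp (q * (b - a))) =
      fact (Suc m) * (\<kappa> * J) ^ m * exp (q * (b - a))"
    by (simp only: fact_Suc mult.assoc)
  finally show ?thesis .
qed

text \<open>Integrability in the centre \<open>x\<close> over the whole line: this replaces any control on the range of the
  path. An even \<open>p\<close> makes the power nonnegative.\<close>
lemma integrated_additive_moment_le:
  assumes a: "0 \<le> a" "a < b" and p: "even p" "0 < p"
    and mass: "(\<integral>\<^sup>+z. ennreal \<bar>f z\<bar> \<partial>lborel) \<le> ennreal c" and c: "0 \<le> c"
  shows "(\<integral>\<^sup>+\<omega>. (\<integral>\<^sup>+x. ennreal (additive (\<lambda>z. f (z - x)) a b \<omega> ^ p) \<partial>lborel) \<partial>M) \<le>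
    ennreal (c * (b - a) * fact p * (\<kappa> * J) ^ (p - 1) * exp (q * (b - a)))"
proof -
  interpret P: pair_sigma_finite M "lborel :: real measure" ..
  have B: "0 \<le> B" using order_trans[OF abs_ge_zero f_bound] .
  obtain m where m: "p = Suc m" using p(2) by (cases p) auto
  let ?N = "\<lambda>u x. \<integral>\<^sup>+\<omega>. ennreal \<bar>f (X u \<omega> - x)\<bar> \<partial>M"
  let ?A = "\<lambda>x \<omega>. ennreal (additive (\<lambda>z. f (z - x)) a b \<omega> ^ p)"
  let ?C = "fact (Suc m) * (\<kappa> * J) ^ m * exp (q * (b - a))"
  have meas [measurable]: "(\<lambda>z. additive (\<lambda>w. f (w - snd z)) a b (fst z)) \<in> borel_measurable (M \<Otimes>\<^sub>M lborel)"
    unfolding additive_def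
    by (rule lborel.borel_measurable_lebesgue_integral) (simp add: split_beta')
  have "(\<integral>\<^sup>+\<omega>. (\<integral>\<^sup>+x. ?A x \<omega> \<partial>lborel) \<partial>M) = (\<integral>\<^sup>+x. (\<integral>\<^sup>+\<omega>. ?A x \<omega> \<partial>M) \<partial>lborel)"
    by (rule P.Fubini'[symmetric]) (simp add: split_beta')
  also have "\<dots> \<le> (\<integral>\<^sup>+x. ennreal ?C * (\<integral>\<^sup>+u. indicator {a..b} u * ?N u x \<partial>lborel) \<partial>lborel)"
  proof (rule nn_integral_mono)
    fix x
    interpret t: levy_functional M X \<psi> "\<lambda>z. f (z - x)" "\<lambda>\<xi>. F \<xi> * iexp (- (\<xi> * x))" V B \<kappa> J q
      by (rule translate)
    have "(\<integral>\<^sup>+\<omega>. ?A x \<omega> \<partial>M) = ennreal (expectation (\<lambda>\<omega>. additive (\<lambda>z. f (z - x)) a b \<omega> ^ p))"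
    proof (intro nn_integral_eq_integral integrable_const_bound[where B = "(B * (b - a)) ^ p"])
      show "AE \<omega> in M. norm (additive (\<lambda>z. f (z - x)) a b \<omega> ^ p) \<le> (B * (b - a)) ^ p"
        using abs_additive_le[OF t.f_bound less_imp_le[OF a(2)]]
        by (intro AE_I2) (auto simp: power_abs intro!: power_mono)
    qed (use p(1) in \<open>auto intro!: AE_I2 zero_le_even_power\<close>)
    also have "\<dots> \<le> ennreal \<bar>expectation (\<lambda>\<omega>. additive (\<lambda>z. f (z - x)) a b \<omega> ^ p)\<bar>"
      by (intro ennreal_leI) auto
    also have "\<dots> \<le> ennreal ?C * (\<integral>\<^sup>+u. indicator {a..b} u * ?N u x \<partial>lborel)"
      unfolding m by (rule t.additive_moment_le[OF a])
    finally show "(\<integral>\<^sup>+\<omega>. ?A x \<omega> \<partial>M) \<le> ennreal ?C * (\<integral>\<^sup>+u. indicator {a..b} u * ?N u x \<partial>lborel)" .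
  qed
  also have "\<dots> = ennreal ?C * (\<integral>\<^sup>+x. \<integral>\<^sup>+u. indicator {a..b} u * ?N u x \<partial>lborel \<partial>lborel)"
    by (rule nn_integral_cmult) measurable
  also have "(\<integral>\<^sup>+x. \<integral>\<^sup>+u. indicator {a..b} u * ?N u x \<partial>lborel \<partial>lborel) =
      (\<integral>\<^sup>+u. \<integral>\<^sup>+x. indicator {a..b} u * ?N u x \<partial>lborel \<partial>lborel)"
    by (rule lborel_pair.Fubini') (simp add: split_beta')
  also have "\<dots> = (\<integral>\<^sup>+u. indicator {a..b} u * (\<integral>\<^sup>+x. ?N u x \<partial>lborel) \<partial>lborel)"
    by (intro nn_integral_cong nn_integral_cmult) measurable
  also have "\<dots> \<le> (\<integral>\<^sup>+u. ennreal c * indicator {a..b} u \<partial>lborel)"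
  proof (rule nn_integral_mono)
    fix u
    have "(\<integral>\<^sup>+x. ?N u x \<partial>lborel) = (\<integral>\<^sup>+\<omega>. (\<integral>\<^sup>+x. ennreal \<bar>f (X u \<omega> - x)\<bar> \<partial>lborel) \<partial>M)"
      by (rule P.Fubini') (simp add: split_beta')
    also have "\<dots> = (\<integral>\<^sup>+\<omega>. (\<integral>\<^sup>+z. ennreal \<bar>f z\<bar> \<partial>lborel) \<partial>M)"
    proof (rule nn_integral_cong)
      fix \<omega>
      show "(\<integral>\<^sup>+x. ennreal \<bar>f (X u \<omega> - x)\<bar> \<partial>lborel) = (\<integral>\<^sup>+z. ennreal \<bar>f z\<bar> \<partial>lborel)"
        using nn_integral_real_affine[of "\<lambda>z. ennreal \<bar>f z\<bar>" "-1" "X u \<omega>"] by simp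
    qed
    also have "\<dots> \<le> ennreal c" using mass by (simp add: emeasure_space_1)
    finally show "indicator {a..b} u * (\<integral>\<^sup>+x. ?N u x \<partial>lborel) \<le> ennreal c * indicator {a..b} u"
      by (auto split: split_indicator)
  qed
  also have "\<dots> = ennreal c * ennreal (b - a)"
    using a by (simp add: nn_integral_cmult)
  finally have "(\<integral>\<^sup>+\<omega>. (\<integral>\<^sup>+x. ?A x \<omega> \<partial>lborel) \<partial>M) \<le> ennreal ?C * (ennreal c * ennreal (b - a))"
    by (simp add: mult_left_mono)
  also have "\<dots> = ennreal (c * (b - a) * fact p * (\<kappa> * J) ^ (p - 1) * exp (q * (b - a)))"
    using c a J_nonneg \<kappa>_nonneg unfolding m
    by (simp add: ennreal_mult[symmetric] mult_ac del: fact_Suc)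
  finally show ?thesis .
qed

end

section \<open>Chaining and Gaussian mollification\<close>

lemma integrable_indicator_Icc_times_continuous:
  fixes g :: "real \<Rightarrow> real"
  assumes "continuous_on UNIV g"
  shows "integrable lborel (\<lambda>t. indicator {a..b} t * g t)"
  using borel_integrable_atLeastAtMost'[OF continuous_on_subset[OF assms subset_UNIV], of a b]
  by (simp add: set_integrable_def)

text \<open>A bound of an average by an \<open>L\<^sup>p\<close> norm. The factor \<open>2\<close> is lost by an elementary pointwise argument in
  place of Jensen's inequality.\<close>
lemma abs_average_le:
  fixes g :: "real \<Rightarrow> real"
  assumes g: "continuous_on UNIV g" and p: "even p" "0 < p" and pos: "0 < h" "0 < l"
    and le: "(\<integral>\<^sup>+x. ennreal (g x ^ p) \<partial>lborel) \<le> ennreal (h * l ^ p)"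
  shows "\<bar>LINT t|lborel. indicator {x..x + h} t * g t\<bar> \<le> 2 * l * h"
proof -
  have [measurable]: "g \<in> borel_measurable borel"
    using g by (rule borel_measurable_continuous_onI)
  obtain m where m: "p = Suc m" using p(2) by (cases p) auto
  have pointwise: "\<bar>y\<bar> \<le> l + y ^ p / l ^ m" for y :: real
  proof (cases "\<bar>y\<bar> \<le> l")
    case True
    moreover have "0 \<le> y ^ p / l ^ m" using p(1) pos by (auto simp: zero_le_even_power)
    ultimately show ?thesis by simp
  next
    case False
    then have "\<bar>y\<bar> * l ^ m \<le> \<bar>y\<bar> * \<bar>y\<bar> ^ m"
      using pos by (intro mult_left_mono power_mono) auto
    also have "\<dots> = y ^ p" using p(1) unfolding m by (metis power_Suc power_even_abs)
    finally have "\<bar>y\<bar> \<le> y ^ p / l ^ m" using pos by (simp add: field_simps)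
    then show ?thesis using pos by simp
  qed
  have nn: "0 \<le> y ^ p" for y :: real using p(1) by (rule zero_le_even_power)
  have "ennreal \<bar>LINT t|lborel. indicator {x..x + h} t * g t\<bar> \<le>
      (\<integral>\<^sup>+t. ennreal (norm (indicator {x..x + h} t * g t)) \<partial>lborel)"
    using norm_integral_le_nn_integral[of lborel "\<lambda>t. indicator {x..x + h} t * g t"] by simp
  also have "\<dots> \<le> (\<integral>\<^sup>+t. ennreal l * indicator {x..x + h} t + ennreal (1 / l ^ m) * ennreal (g t ^ p) \<partial>lborel)"
  proof (rule nn_integral_mono)
    fix t
    show "ennreal (norm (indicator {x..x + h} t * g t)) \<le>
        ennreal l * indicator {x..x + h} t + ennreal (1 / l ^ m) * ennreal (g t ^ p)"
    proof (cases "t \<in> {x..x + h}")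
      case True
      then have "ennreal (norm (indicator {x..x + h} t * g t)) \<le> ennreal (l + g t ^ p / l ^ m)"
        using pointwise by (auto intro!: ennreal_leI)
      also have "\<dots> = ennreal l + ennreal (1 / l ^ m) * ennreal (g t ^ p)"
        using pos nn[of "g t"] by (simp add: ennreal_plus ennreal_mult[symmetric])
      finally show ?thesis using True by simp
    qed simp
  qed
  also have "\<dots> = ennreal l * ennreal h + ennreal (1 / l ^ m) * (\<integral>\<^sup>+x. ennreal (g x ^ p) \<partial>lborel)"
    using pos by (simp add: nn_integral_add nn_integral_cmult)
  also have "\<dots> \<le> ennreal l * ennreal h + ennreal (1 / l ^ m) * ennreal (h * l ^ p)"
    by (intro add_left_mono mult_left_mono le) simp
  also have "\<dots> = ennreal (2 * l * h)"
    using pos unfolding m by (simp add: ennreal_mult[symmetric] ennreal_plus[symmetric] mult_ac del: ennreal_plus)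
  finally show ?thesis using pos by (subst (asm) ennreal_le_iff) auto
qed

lemma average_tendsto:
  fixes g :: "real \<Rightarrow> real"
  assumes g: "continuous_on UNIV g" and h: "\<And>n. 0 < h n" "h \<longlonglongrightarrow> 0"
  shows "(\<lambda>n. (LINT t|lborel. indicator {x..x + h n} t * g t) / h n) \<longlonglongrightarrow> g x"
proof (rule LIMSEQ_I)
  fix e :: real assume "0 < e"
  then obtain d where d: "0 < d" "\<And>t. dist t x < d \<Longrightarrow> dist (g t) (g x) < e / 2"
    using g unfolding continuous_on_iff by (metis UNIV_I half_gt_zero)
  obtain N where N: "\<And>n. n \<ge> N \<Longrightarrow> h n < d"
    using order_tendstoD(2)[OF h(2) d(1)] unfolding eventually_sequentially by auto
  have "norm ((LINT t|lborel. indicator {x..x + h n} t * g t) / h n - g x) < e" if n: "n \<ge> N" for n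
  proof -
    have "\<bar>LINT t|lborel. indicator {x..x + h n} t * (if t \<in> {x..x + h n} then g t - g x else 0)\<bar>
        \<le> e / 2 * (x + h n - x)"
    proof (rule abs_integral_interval_le)
      fix t
      show "\<bar>if t \<in> {x..x + h n} then g t - g x else 0\<bar> \<le> e / 2"
        using d(2)[of t] N[OF n] \<open>0 < e\<close> by (auto simp: dist_real_def)
    qed (use h in \<open>simp add: less_imp_le\<close>)
    also have "(LINT t|lborel. indicator {x..x + h n} t * (if t \<in> {x..x + h n} then g t - g x else 0)) =
        (LINT t|lborel. indicator {x..x + h n} t * g t - indicator {x..x + h n} t * g x)"
      by (intro Bochner_Integration.integral_cong) (auto split: split_indicator)
    also have "\<dots> = (LINT t|lborel. indicator {x..x + h n} t * g t) - h n * g x"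
      using integrable_indicator_Icc_times_continuous[OF g]
        integrable_indicator_Icc_times_continuous[of "\<lambda>_. g x"] h(1)[of n]
      by (subst Bochner_Integration.integral_diff) auto
    finally have "\<bar>(LINT t|lborel. indicator {x..x + h n} t * g t) - h n * g x\<bar> \<le> e / 2 * h n"
      by simp
    then have "\<bar>((LINT t|lborel. indicator {x..x + h n} t * g t) - h n * g x) / h n\<bar> \<le> e / 2"
      using h(1)[of n] by (simp add: abs_divide pos_divide_le_eq)
    then show ?thesis using h(1)[of n] \<open>0 < e\<close> by (simp add: diff_divide_distrib)
  qed
  then show "\<exists>no. \<forall>n\<ge>no. norm ((LINT t|lborel. indicator {x..x + h n} t * g t) / h n - g x) < e" by blast
qed

text \<open>An embedding of Sobolev type along dyadic scales. The averages of \<open>g\<close> over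
  \<open>[x, x + \<delta> / 2^k]\<close> converge to \<open>g x\<close>, and two consecutive ones differ by half an average of a single
  increment of \<open>g\<close>, so an \<open>L\<^sup>p\<close> bound for each dyadic increment suffices.\<close>
lemma chaining_bound:
  fixes g :: "real \<Rightarrow> real" and l :: "nat \<Rightarrow> real"
  assumes g: "continuous_on UNIV g" and p: "even p" "0 < p" and \<delta>: "0 < \<delta>"
    and l: "\<And>k. 0 < l k" "summable l"
    and base: "(\<integral>\<^sup>+x. ennreal (g x ^ p) \<partial>lborel) \<le> ennreal (\<delta> * l 0 ^ p)"
    and step: "\<And>k. (\<integral>\<^sup>+x. ennreal ((g (x + \<delta> / 2 ^ Suc k) - g x) ^ p) \<partial>lborel)
        \<le> ennreal (\<delta> / 2 ^ Suc k * l (Suc k) ^ p)"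
  shows "g x \<le> 2 * suminf l"
proof -
  define I where "I h x = (LINT t|lborel. indicator {x..x + h} t * g t)" for h x
  define m where "m k = I (\<delta> / 2 ^ k) x / (\<delta> / 2 ^ k)" for k
  have m0: "m 0 \<le> 2 * l 0"
    using abs_average_le[OF g p \<delta> l(1) base, of x] \<delta> unfolding m_def I_def
    by (simp add: pos_divide_le_eq abs_le_iff)
  have diff: "m (Suc k) \<le> m k + l (Suc k)" for k
  proof -
    define h where "h = \<delta> / 2 ^ Suc k"
    have h: "0 < h" "\<delta> / 2 ^ k = 2 * h" using \<delta> unfolding h_def by auto
    have gi: "integrable lborel (\<lambda>t. indicator {a..b} t * g t)" for a b
      by (rule integrable_indicator_Icc_times_continuous[OF g])
    have gh: "continuous_on UNIV (\<lambda>t. g (t + h) - g t)"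
      by (intro continuous_on_diff g continuous_on_compose2[OF g]) (auto intro!: continuous_intros)
    have gsh: "continuous_on UNIV (\<lambda>t. g (t + h))"
      by (intro continuous_on_compose2[OF g]) (auto intro!: continuous_intros)
    have [measurable]: "g \<in> borel_measurable borel"
      using g by (rule borel_measurable_continuous_onI)
    have split: "I (2 * h) x = I h x + I h (x + h)"
    proof -
      have "I (2 * h) x = (LINT t|lborel. indicator {x..x + h} t * g t + indicator {x + h..x + h + h} t * g t)"
        unfolding I_def
      proof (rule integral_cong_AE)
        show "AE t in lborel. indicator {x..x + 2 * h} t * g t =
            indicator {x..x + h} t * g t + indicator {x + h..x + h + h} t * g t"
          using AE_lborel_singleton[of "x + h"]
          by eventually_elim (use h in \<open>auto split: split_indicator\<close>)
      qed measurable
      then show ?thesis using gi unfolding I_def by simp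
    qed
    have shift: "I h (x + h) = (LINT t|lborel. indicator {x..x + h} t * g (t + h))"
    proof -
      have "I h (x + h) = (LINT t|lborel. indicator {x + h..x + h + h} (h + 1 * t) * g (h + 1 * t))"
        unfolding I_def by (subst lborel_integral_real_affine[of 1 _ h]) auto
      also have "\<dots> = (LINT t|lborel. indicator {x..x + h} t * g (t + h))"
        by (intro Bochner_Integration.integral_cong) (auto split: split_indicator simp: add.commute)
      finally show ?thesis .
    qed
    have "I h (x + h) - I h x = (LINT t|lborel. indicator {x..x + h} t * (g (t + h) - g t))"
      unfolding shift using gi integrable_indicator_Icc_times_continuous[OF gsh]
      by (simp add: I_def right_diff_distrib)
    also have "\<bar>\<dots>\<bar> \<le> 2 * l (Suc k) * h"
      using step[of k] by (intro abs_average_le[OF gh p h(1) l(1)]) (simp add: h_def)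
    finally have *: "I h x - I h (x + h) \<le> 2 * l (Suc k) * h" by linarith
    have "m (Suc k) - m k = (I h x - I h (x + h)) / (2 * h)"
      unfolding m_def h(2) h_def[symmetric] split using h(1) by (simp add: field_simps)
    also have "\<dots> \<le> (2 * l (Suc k) * h) / (2 * h)"
      using * h(1) by (intro divide_right_mono) auto
    also have "\<dots> = l (Suc k)" using h(1) by simp
    finally show ?thesis by simp
  qed
  have "m n \<le> 2 * (\<Sum>k<Suc n. l k)" for n
  proof (induction n)
    case 0
    then show ?case using m0 by simp
  next
    case (Suc n)
    then show ?case using diff[of n] l(1)[of "Suc n"] by simp
  qed
  also have "2 * (\<Sum>k<Suc n. l k) \<le> 2 * suminf l" for n
    using sum_le_suminf[OF l(2), of "{..<Suc n}"] l(1) by (simp add: less_imp_le)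
  finally have le: "m n \<le> 2 * suminf l" for n .
  have "(\<lambda>n. \<delta> / 2 ^ n) \<longlonglongrightarrow> 0"
    using tendsto_mult[OF tendsto_const[of \<delta>] LIMSEQ_inverse_realpow_zero[of 2]]
    by (simp add: divide_inverse)
  then have "m \<longlonglongrightarrow> g x"
    unfolding m_def I_def using \<delta> by (intro average_tendsto[OF g]) auto
  then show ?thesis by (rule LIMSEQ_le_const2) (use le in auto)
qed

text \<open>The Fourier transform of the centred normal density with deviation \<open>\<sigma>\<close>, normalised so that the
  inversion formula has no further constant. It is itself a multiple of a normal density, whence both
  its integrability and the inversion formula.\<close>
definition gauss_fourier :: "real \<Rightarrow> real \<Rightarrow> complex" where
  "gauss_fourier \<sigma> \<xi> = of_real (exp (- (\<sigma>\<^sup>2 * \<xi>\<^sup>2 / 2)) / (2 * pi))"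

lemma gauss_fourier_eq:
  assumes "0 < \<sigma>"
  shows "gauss_fourier \<sigma> \<xi> = of_real (normal_density 0 (1 / \<sigma>) \<xi> / (\<sigma> * sqrt (2 * pi)))"
proof -
  have "sqrt (2 * pi * (1 / \<sigma>)\<^sup>2) = sqrt (2 * pi) * (1 / \<sigma>)"
    using assms by (subst real_sqrt_mult, subst real_sqrt_abs) simp
  then have "sqrt (2 * pi * (1 / \<sigma>)\<^sup>2) * (\<sigma> * sqrt (2 * pi)) = sqrt (2 * pi) * sqrt (2 * pi)"
    using assms by simp
  also have "\<dots> = 2 * pi" by (rule real_sqrt_mult_self[THEN trans]) simp
  finally have "sqrt (2 * pi * (1 / \<sigma>)\<^sup>2) * (\<sigma> * sqrt (2 * pi)) = 2 * pi" .
  then have "1 / sqrt (2 * pi * (1 / \<sigma>)\<^sup>2) / (\<sigma> * sqrt (2 * pi)) = 1 / (2 * pi)"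
    using assms by (simp add: divide_divide_eq_left)
  then show ?thesis
    unfolding gauss_fourier_def normal_density_def using assms
    by (simp add: field_simps power_divide)
qed

lemma integrable_gauss_fourier:
  assumes "0 < \<sigma>" shows "integrable lborel (gauss_fourier \<sigma>)"
proof -
  have "integrable lborel (\<lambda>\<xi>. complex_of_real (normal_density 0 (1 / \<sigma>) \<xi> / (\<sigma> * sqrt (2 * pi))))"
    using assms by (intro integrable_of_real integrable_divide) auto
  then show ?thesis using gauss_fourier_eq[OF assms] by (simp add: ext cong: Bochner_Integration.integrable_cong)
qed

lemma normal_density_fourier:
  assumes \<sigma>: "0 < \<sigma>"
  shows "complex_of_real (normal_density 0 \<sigma> x) = (CLINT \<xi>|lborel. gauss_fourier \<sigma> \<xi> * iexp (\<xi> * x))"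
proof -
  have "(CLINT \<xi>|lborel. std_normal_density \<xi> *\<^sub>R iexp (x / \<sigma> * \<xi>)) = of_real (exp (- ((x / \<sigma>)\<^sup>2) / 2))"
    using char_std_normal_distribution[THEN fun_cong, of "x / \<sigma>"]
    unfolding char_def by (subst (asm) integral_density) (auto simp: normal_density_nonneg)
  then have "of_real (exp (- ((x / \<sigma>)\<^sup>2) / 2)) =
      (CLINT \<xi>|lborel. std_normal_density \<xi> *\<^sub>R iexp (x / \<sigma> * \<xi>))" by simp
  also have "\<dots> = \<sigma> *\<^sub>R (CLINT \<xi>|lborel. std_normal_density (0 + \<sigma> * \<xi>) *\<^sub>R iexp (x / \<sigma> * (0 + \<sigma> * \<xi>)))"
    using \<sigma> by (subst lborel_integral_real_affine[of \<sigma> _ 0]) auto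
  also have "\<dots> = \<sigma> *\<^sub>R (CLINT \<xi>|lborel. of_real (sqrt (2 * pi)) * (gauss_fourier \<sigma> \<xi> * iexp (\<xi> * x)))"
  proof -
    have "1 / sqrt (2 * pi) = sqrt (2 * pi) / (2 * pi)"
      by (simp add: field_simps flip: real_sqrt_mult)
    then have "std_normal_density (0 + \<sigma> * \<xi>) *\<^sub>R iexp (x / \<sigma> * (0 + \<sigma> * \<xi>)) =
        of_real (sqrt (2 * pi)) * (gauss_fourier \<sigma> \<xi> * iexp (\<xi> * x))" for \<xi>
      using \<sigma> unfolding gauss_fourier_def std_normal_density_def
      by (simp add: scaleR_conv_of_real power_mult_distrib mult_ac)
    then show ?thesis by simp
  qed
  also have "\<dots> = of_real (\<sigma> * sqrt (2 * pi)) * (CLINT \<xi>|lborel. gauss_fourier \<sigma> \<xi> * iexp (\<xi> * x))"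
    by (simp add: scaleR_conv_of_real)
  finally have "of_real (exp (- ((x / \<sigma>)\<^sup>2) / 2)) / of_real (\<sigma> * sqrt (2 * pi)) =
      (CLINT \<xi>|lborel. gauss_fourier \<sigma> \<xi> * iexp (\<xi> * x))"
    using \<sigma> by (simp add: field_simps)
  moreover have "normal_density 0 \<sigma> x = exp (- ((x / \<sigma>)\<^sup>2) / 2) / (\<sigma> * sqrt (2 * pi))"
    unfolding normal_density_def using \<sigma>
    by (simp add: real_sqrt_mult power_divide field_simps)
  ultimately show ?thesis by simp
qed

lemma norm_gauss_fourier_le: "norm (gauss_fourier \<sigma> \<xi>) \<le> 1 / 2"
proof -
  have "exp (- (\<sigma>\<^sup>2 * \<xi>\<^sup>2 / 2)) / (2 * pi) \<le> 1 / 2"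
    using pi_ge_two by (auto simp: divide_simps intro: order_trans[of _ 1])
  then show ?thesis unfolding gauss_fourier_def by (simp add: norm_divide norm_mult)
qed

lemma continuous_normal_density: "0 < \<sigma> \<Longrightarrow> continuous_on A (normal_density 0 \<sigma>)"
  unfolding normal_density_def by (intro continuous_intros) auto

lemma normal_density_le: "0 < \<sigma> \<Longrightarrow> normal_density 0 \<sigma> x \<le> normal_density 0 \<sigma> 0"
  unfolding normal_density_def by (intro mult_left_mono) auto

section \<open>Weights, resolvents and the chaining levels\<close>

lemma nn_integral_powr_tail_finite:
  fixes s :: real
  assumes "1 < s"
  shows "(\<integral>\<^sup>+u. ennreal (u powr (- s)) * indicator {1..} u \<partial>lborel) < \<infinity>"
proof -
  have "(\<integral>\<^sup>+u. ennreal (u powr (- s)) * indicator {1..} u \<partial>lborel) =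
      ennreal (0 - 1 powr (1 - s) / (1 - s))"
  proof (rule nn_integral_FTC_atLeast[where F = "\<lambda>u. u powr (1 - s) / (1 - s)"])
    show "((\<lambda>u. u powr (1 - s) / (1 - s)) has_real_derivative u powr (- s)) (at u)" if "1 \<le> u" for u
      using that assms by (auto intro!: derivative_eq_intros)
    have "((\<lambda>u. u powr (1 - s)) \<longlongrightarrow> 0) at_top"
      using assms by (intro tendsto_neg_powr filterlim_ident) auto
    from tendsto_divide[OF this tendsto_const[of "1 - s"]]
    show "((\<lambda>u. u powr (1 - s) / (1 - s)) \<longlongrightarrow> 0) at_top" using assms by simp
  qed auto
  then show ?thesis by simp
qed

lemma nn_integral_resolvent_weight_finite:
  fixes \<alpha> \<gamma> :: real
  assumes "0 < \<gamma>" "2 * \<gamma> < \<alpha> - 1"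
  shows "(\<integral>\<^sup>+u. ennreal ((1 + \<bar>u\<bar> powr \<gamma>)\<^sup>2 / (1 + \<bar>u\<bar> powr \<alpha>)) \<partial>lborel) < \<infinity>"
proof -
  let ?w = "\<lambda>u. (1 + \<bar>u\<bar> powr \<gamma>)\<^sup>2 / (1 + \<bar>u\<bar> powr \<alpha>)"
  define s where "s = \<alpha> - 2 * \<gamma>"
  have s: "1 < s" using assms unfolding s_def by simp
  let ?T = "\<lambda>u. ennreal (u powr (- s)) * indicator {1..} u"
  have "(\<integral>\<^sup>+u. ennreal (?w u) \<partial>lborel) \<le>
      (\<integral>\<^sup>+u. 4 * (indicator {-1..1} u + (?T u + ?T (0 + - 1 * u))) \<partial>lborel)"
  proof (rule nn_integral_mono)
    fix u :: real
    show "ennreal (?w u) \<le> 4 * (indicator {-1..1} u + (?T u + ?T (0 + - 1 * u)))"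
    proof (cases "\<bar>u\<bar> \<le> 1")
      case True
      then have "\<bar>u\<bar> powr \<gamma> \<le> 1" using assms by (simp add: powr_le1)
      then have "(1 + \<bar>u\<bar> powr \<gamma>)\<^sup>2 \<le> 2\<^sup>2" by (intro power_mono) auto
      also have "\<dots> \<le> 4 * (1 + \<bar>u\<bar> powr \<alpha>)" by simp
      finally have "?w u \<le> 4"
        by (simp add: pos_divide_le_eq add_pos_nonneg)
      then have "ennreal (?w u) \<le> ennreal 4" by (rule ennreal_leI)
      also have "\<dots> \<le> 4 * (1 + (?T u + ?T (0 + - 1 * u)))" by (simp add: distrib_left)
      finally show ?thesis using True by (simp add: abs_le_iff)
    next
      case False
      then have u: "1 < \<bar>u\<bar>" by simp
      have "1 \<le> \<bar>u\<bar> powr \<gamma>" using u assms by (simp add: ge_one_powr_ge_zero)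
      then have "(1 + \<bar>u\<bar> powr \<gamma>)\<^sup>2 \<le> (2 * \<bar>u\<bar> powr \<gamma>)\<^sup>2" by (intro power_mono) auto
      also have "\<dots> = 4 * \<bar>u\<bar> powr (2 * \<gamma>)"
        by (simp add: power_mult_distrib power2_eq_square flip: powr_add)
      also have "\<dots> = 4 * \<bar>u\<bar> powr (- s) * \<bar>u\<bar> powr \<alpha>"
        unfolding s_def by (simp flip: powr_add)
      also have "\<dots> \<le> 4 * \<bar>u\<bar> powr (- s) * (1 + \<bar>u\<bar> powr \<alpha>)"
        by (intro mult_left_mono) auto
      finally have "?w u \<le> 4 * \<bar>u\<bar> powr (- s)"
        by (simp add: pos_divide_le_eq add_pos_nonneg)
      then have "ennreal (?w u) \<le> ennreal (4 * \<bar>u\<bar> powr (- s))"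
        by (rule ennreal_leI)
      also have "\<dots> = 4 * ennreal (\<bar>u\<bar> powr (- s))" by (simp add: ennreal_mult)
      also have "\<dots> \<le> 4 * (indicator {-1..1} u + (?T u + ?T (0 + - 1 * u)))"
        using u by (intro mult_left_mono) (auto split: split_indicator)
      finally show ?thesis .
    qed
  qed
  also have "\<dots> = 4 * (2 + ((\<integral>\<^sup>+u. ?T u \<partial>lborel) + (\<integral>\<^sup>+u. ?T (0 + - 1 * u) \<partial>lborel)))"
    by (simp add: nn_integral_cmult nn_integral_add)
  also have "(\<integral>\<^sup>+u. ?T (0 + - 1 * u) \<partial>lborel) = (\<integral>\<^sup>+u. ?T u \<partial>lborel)"
    using nn_integral_real_affine[of ?T "-1" 0] by simp
  also have "4 * (2 + ((\<integral>\<^sup>+u. ?T u \<partial>lborel) + (\<integral>\<^sup>+u. ?T u \<partial>lborel))) < \<infinity>"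
    using nn_integral_powr_tail_finite[OF s] by (simp add: ennreal_mult_less_top)
  finally show ?thesis .
qed

text \<open>The factor in front of \<open>\<bar>\<xi>\<bar> powr \<gamma>\<close> makes the weight invariant under the scaling of frequencies by
  \<open>q powr (1 / \<alpha>)\<close>.\<close>
definition weight :: "real \<Rightarrow> real \<Rightarrow> real \<Rightarrow> real \<Rightarrow> real" where
  "weight \<alpha> \<gamma> q \<xi> = 1 + q powr (- \<gamma> / \<alpha>) * \<bar>\<xi>\<bar> powr \<gamma>"

text \<open>After the substitution \<open>\<eta> = q powr (1 / \<alpha>) * u\<close> the integral is a fixed finite constant times
  \<open>q powr (1 / \<alpha>) / q\<close>; convergence at infinity needs \<open>2 * \<gamma> - \<alpha> < - 1\<close>.\<close>
lemma resolvent_weight_bound: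
  fixes \<alpha> \<gamma> c\<^sub>0 :: real
  assumes \<alpha>: "1 < \<alpha>" and \<gamma>: "0 < \<gamma>" "2 * \<gamma> < \<alpha> - 1" and c\<^sub>0: "0 < c\<^sub>0" "c\<^sub>0 \<le> 1"
    and [measurable]: "\<psi> \<in> borel_measurable borel"
    and lower: "\<And>\<xi>. c\<^sub>0 * (1 + \<bar>\<xi>\<bar> powr \<alpha>) \<le> 1 + \<psi> \<xi>"
  obtains C where "1 \<le> C" "\<And>q. 1 \<le> q \<Longrightarrow>
    (\<integral>\<^sup>+\<eta>. ennreal (weight \<alpha> \<gamma> q \<eta> ^ 2 / (q + \<psi> \<eta>)) \<partial>lborel) \<le> ennreal (C * q powr (- (1 - 1 / \<alpha>)))"
proof -
  let ?w = "\<lambda>u. (1 + \<bar>u\<bar> powr \<gamma>)\<^sup>2 / (1 + \<bar>u\<bar> powr \<alpha>)"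
  obtain I where I: "0 \<le> I" "(\<integral>\<^sup>+u. ennreal (?w u) \<partial>lborel) = ennreal I"
    using nn_integral_resolvent_weight_finite[OF \<gamma>]
    by (cases "\<integral>\<^sup>+u. ennreal (?w u) \<partial>lborel") auto
  show ?thesis
  proof (rule that[of "max 1 (I / c\<^sub>0)"])
    fix q :: real assume q: "1 \<le> q"
    define t where "t = q powr (1 / \<alpha>)"
    have t: "0 < t" using q unfolding t_def by simp
    have t\<alpha>: "t powr \<alpha> = q" using q \<alpha> unfolding t_def by (simp add: powr_powr)
    have t\<gamma>: "q powr (- \<gamma> / \<alpha>) * t powr \<gamma> = 1"
      using q \<alpha> unfolding t_def by (simp add: powr_powr flip: powr_add)
    have tq: "t / q = q powr (- (1 - 1 / \<alpha>))"
      using q unfolding t_def by (simp add: powr_diff powr_minus_divide field_simps flip: powr_add)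
    have "(\<integral>\<^sup>+\<eta>. ennreal (weight \<alpha> \<gamma> q \<eta> ^ 2 / (q + \<psi> \<eta>)) \<partial>lborel) \<le>
        (\<integral>\<^sup>+\<eta>. ennreal (weight \<alpha> \<gamma> q \<eta> ^ 2 / (c\<^sub>0 * (q + \<bar>\<eta>\<bar> powr \<alpha>))) \<partial>lborel)"
    proof (intro nn_integral_mono ennreal_leI divide_left_mono)
      fix \<eta>
      have "c\<^sub>0 * (q - 1) \<le> q - 1" using q c\<^sub>0 by (simp add: mult_left_le_one_le)
      then show le: "c\<^sub>0 * (q + \<bar>\<eta>\<bar> powr \<alpha>) \<le> q + \<psi> \<eta>"
        using lower[of \<eta>] by (simp add: algebra_simps)
      have pos: "0 < c\<^sub>0 * (q + \<bar>\<eta>\<bar> powr \<alpha>)"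
        using c\<^sub>0 q by (intro mult_pos_pos add_pos_nonneg) auto
      then show "0 < (q + \<psi> \<eta>) * (c\<^sub>0 * (q + \<bar>\<eta>\<bar> powr \<alpha>))"
        using le by (intro mult_pos_pos[OF less_le_trans[OF pos le] pos])
    qed simp
    also have "\<dots> = ennreal t * (\<integral>\<^sup>+u. ennreal (weight \<alpha> \<gamma> q (0 + t * u) ^ 2 / (c\<^sub>0 * (q + \<bar>0 + t * u\<bar> powr \<alpha>))) \<partial>lborel)"
      using t unfolding weight_def by (subst nn_integral_real_affine[of _ t 0]) auto
    also have "(\<integral>\<^sup>+u. ennreal (weight \<alpha> \<gamma> q (0 + t * u) ^ 2 / (c\<^sub>0 * (q + \<bar>0 + t * u\<bar> powr \<alpha>))) \<partial>lborel) =
        (\<integral>\<^sup>+u. ennreal (1 / (c\<^sub>0 * q)) * ennreal (?w u) \<partial>lborel)"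
    proof (rule nn_integral_cong)
      fix u :: real
      have 1: "weight \<alpha> \<gamma> q (0 + t * u) = 1 + \<bar>u\<bar> powr \<gamma>"
        unfolding weight_def using t t\<gamma> by (simp add: abs_mult powr_mult mult.assoc[symmetric])
      have 2: "c\<^sub>0 * (q + \<bar>0 + t * u\<bar> powr \<alpha>) = (c\<^sub>0 * q) * (1 + \<bar>u\<bar> powr \<alpha>)"
        using t t\<alpha> by (simp add: abs_mult powr_mult algebra_simps)
      show "ennreal (weight \<alpha> \<gamma> q (0 + t * u) ^ 2 / (c\<^sub>0 * (q + \<bar>0 + t * u\<bar> powr \<alpha>))) =
          ennreal (1 / (c\<^sub>0 * q)) * ennreal (?w u)"
        unfolding 1 2 using c\<^sub>0 q by (subst ennreal_mult[symmetric]) auto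
    qed
    also have "\<dots> = ennreal (1 / (c\<^sub>0 * q)) * ennreal I"
      unfolding I(2)[symmetric] by (rule nn_integral_cmult) measurable
    also have "ennreal t * \<dots> = ennreal (I / c\<^sub>0 * (t / q))"
      using t c\<^sub>0 q I(1) by (simp add: ennreal_mult[symmetric] mult_ac)
    also have "\<dots> \<le> ennreal (max 1 (I / c\<^sub>0) * q powr (- (1 - 1 / \<alpha>)))"
      unfolding tq by (intro ennreal_leI mult_right_mono) auto
    finally show "(\<integral>\<^sup>+\<eta>. ennreal (weight \<alpha> \<gamma> q \<eta> ^ 2 / (q + \<psi> \<eta>)) \<partial>lborel) \<le>
        ennreal (max 1 (I / c\<^sub>0) * q powr (- (1 - 1 / \<alpha>)))" .
  qed simp
qed

text \<open>Interpolation between the bounds \<open>2\<close> and \<open>\<bar>\<xi> * h\<bar>\<close> for \<open>\<bar>exp (- i \<xi> h) - 1\<bar>\<close> produces the factor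
  \<open>h powr \<gamma>\<close>, at the price of a growth \<open>\<bar>\<xi>\<bar> powr \<gamma>\<close> in the frequency.\<close>
lemma norm_gauss_increment_fourier_le:
  fixes \<gamma> :: real
  assumes \<gamma>: "0 < \<gamma>" "\<gamma> \<le> 1" and h: "0 < h"
  shows "norm (gauss_fourier \<sigma> (\<eta> - \<zeta>) * (iexp (- ((\<eta> - \<zeta>) * h)) - 1)) \<le>
    2 * h powr \<gamma> * (\<bar>\<eta>\<bar> powr \<gamma> + \<bar>\<zeta>\<bar> powr \<gamma>)"
proof -
  define x where "x = \<bar>(\<eta> - \<zeta>) * h\<bar>"
  have "norm (iexp (- ((\<eta> - \<zeta>) * h)) - 1) \<le> x"
    using iexp_approx1[of "- ((\<eta> - \<zeta>) * h)" 0] by (simp add: x_def)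
  moreover have "norm (iexp (- ((\<eta> - \<zeta>) * h)) - 1) \<le> 2"
    using norm_triangle_ineq4[of "iexp (- ((\<eta> - \<zeta>) * h))" 1] by simp
  moreover have "min 2 x \<le> 2 * x powr \<gamma>"
  proof (cases "x \<le> 1")
    case True
    then have "x \<le> x powr \<gamma>"
      using powr_mono'[of \<gamma> 1 x] \<gamma> by (cases "x = 0") (auto simp: x_def)
    then show ?thesis by (auto simp: min_def intro: order_trans[of _ "x powr \<gamma>"])
  next
    case False
    then have "1 \<le> x powr \<gamma>" using \<gamma> by (simp add: ge_one_powr_ge_zero)
    then show ?thesis by (auto simp: min_def)
  qed
  ultimately have "norm (iexp (- ((\<eta> - \<zeta>) * h)) - 1) \<le> 2 * x powr \<gamma>" by linarith
  then have "norm (gauss_fourier \<sigma> (\<eta> - \<zeta>) * (iexp (- ((\<eta> - \<zeta>) * h)) - 1)) \<le> (1 / 2) * (2 * x powr \<gamma>)"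
    unfolding norm_mult by (intro mult_mono norm_gauss_fourier_le) auto
  also have "\<dots> = h powr \<gamma> * \<bar>\<eta> - \<zeta>\<bar> powr \<gamma>"
    using h unfolding x_def by (simp add: abs_mult powr_mult)
  finally have 1: "norm (gauss_fourier \<sigma> (\<eta> - \<zeta>) * (iexp (- ((\<eta> - \<zeta>) * h)) - 1)) \<le>
      h powr \<gamma> * \<bar>\<eta> - \<zeta>\<bar> powr \<gamma>" .
  have "\<bar>\<eta> - \<zeta>\<bar> powr \<gamma> \<le> (2 * max \<bar>\<eta>\<bar> \<bar>\<zeta>\<bar>) powr \<gamma>"
    using \<gamma> by (intro powr_mono2) auto
  also have "\<dots> = 2 powr \<gamma> * max \<bar>\<eta>\<bar> \<bar>\<zeta>\<bar> powr \<gamma>" by (simp add: powr_mult)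
  also have "\<dots> \<le> 2 * (\<bar>\<eta>\<bar> powr \<gamma> + \<bar>\<zeta>\<bar> powr \<gamma>)"
  proof (rule mult_mono)
    show "2 powr \<gamma> \<le> 2" using powr_mono[of \<gamma> 1 2] \<gamma> by simp
    show "max \<bar>\<eta>\<bar> \<bar>\<zeta>\<bar> powr \<gamma> \<le> \<bar>\<eta>\<bar> powr \<gamma> + \<bar>\<zeta>\<bar> powr \<gamma>" by (auto simp: max_def)
  qed auto
  finally have "\<bar>\<eta> - \<zeta>\<bar> powr \<gamma> \<le> 2 * (\<bar>\<eta>\<bar> powr \<gamma> + \<bar>\<zeta>\<bar> powr \<gamma>)" .
  from mult_left_mono[OF this, of "h powr \<gamma>"] 1 show ?thesis by (simp only: mult_ac) simp
qed

text \<open>Markov's inequality at level \<open>k\<close> of the chaining, in numbers: on the left the moment bound for the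
  dyadic increment, on the right the probability granted to the level times the \<open>p\<close>-th power of its
  threshold. Thresholds decay like \<open>2 powr (- k * \<gamma> / 4)\<close> and the increments like
  \<open>2 powr (- k * \<gamma>)\<close>; the gap pays for the factor \<open>2 ^ k\<close> of the length scale and for summability in \<open>k\<close>
  once \<open>p * \<gamma> \<ge> 4\<close>. The constant \<open>8 * exp 3\<close> absorbs \<open>exp (2 * p)\<close>, coming from \<open>exp (q * s)\<close> and
  from \<open>q * s \<le> p \<le> exp p\<close>, and leaves \<open>exp (- p)\<close>.\<close>
lemma chaining_level_estimate:
  fixes \<gamma> \<alpha> C q s :: real and p k :: nat
  assumes \<gamma>: "0 < \<gamma>" "\<gamma> \<le> 1" and C: "1 \<le> C" and q: "1 \<le> q" and s: "0 < s" "q * s \<le> real p"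
    and p: "4 / \<gamma> \<le> real p" "0 < p"
  shows "2 * s * fact p * (2 * 2 powr (- (real k * \<gamma>)) * (C * q powr (- (1 - 1 / \<alpha>)))) ^ (p - 1) * exp (q * s)
    \<le> (exp (- real p) * (1 / 2) ^ Suc k) * (q powr (- 1 / \<alpha>) / 2 ^ k *
      (8 * exp 3 * C * real p * q powr (- (1 - 1 / \<alpha>)) * 2 powr (- (real k * \<gamma> / 4))) ^ p)"
proof -
  obtain m where m: "p = Suc m" using p(2) by (cases p) auto
  define \<beta> where "\<beta> = q powr (- (1 - 1 / \<alpha>))"
  define \<delta> where "\<delta> = q powr (- 1 / \<alpha>)"
  define v where "v = 2 powr (- (real k * \<gamma>))"
  define w where "w = 2 powr (- (real k * \<gamma> / 4))"
  have pos: "0 < \<beta>" "0 < \<delta>" "0 < v" "0 < w" using q unfolding \<beta>_def \<delta>_def v_def w_def by auto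
  have "\<delta> * \<beta> = q powr (- 1)"
    unfolding \<delta>_def \<beta>_def by (simp flip: powr_add)
  then have "\<delta> * \<beta> = 1 / q"
    using q by (simp add: powr_minus_divide)
  then have "s = (q * s) * (\<delta> * \<beta>)" using q by simp
  also have "\<dots> \<le> exp (real p) * (\<delta> * \<beta>)"
  proof (rule mult_right_mono)
    show "q * s \<le> exp (real p)" using s(2) exp_ge_add_one_self[of "real p"] by linarith
  qed (use pos in simp)
  finally have 1: "s \<le> exp (real p) * (\<delta> * \<beta>)" .
  have 2: "fact p \<le> real p ^ p" using fact_le_power[of p, where 'a = real] by simp
  have 3: "v ^ m \<le> w ^ p * (1 / 4) ^ k"
  proof -
    have "4 \<le> \<gamma> * real p" using p(1) \<gamma>(1) by (simp add: pos_divide_le_eq mult.commute)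
    then have "2 + \<gamma> * real p / 4 \<le> \<gamma> * real p - \<gamma>"
      using \<gamma>(2) by linarith
    also have "\<dots> = \<gamma> * real m" unfolding m by (simp add: algebra_simps)
    finally have "real k * (2 + \<gamma> * real p / 4) \<le> real k * (\<gamma> * real m)"
      by (intro mult_left_mono) auto
    then have le: "- (real k * \<gamma>) * real m \<le> - (real k * \<gamma> / 4) * real p + (- 2) * real k"
      by (simp add: algebra_simps)
    have "v ^ m = 2 powr (- (real k * \<gamma>) * real m)"
      unfolding v_def by (simp add: powr_powr flip: powr_realpow)
    also have "\<dots> \<le> 2 powr (- (real k * \<gamma> / 4) * real p + (- 2) * real k)"
      using le by (intro powr_mono) auto
    also have "\<dots> = w ^ p * (2 powr (- 2)) ^ k"
      unfolding w_def powr_add by (simp add: powr_powr flip: powr_realpow)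
    also have "(2::real) powr (- 2) = 1 / 4" by (simp add: powr_minus_divide)
    finally show ?thesis .
  qed
  have 4: "(2 * C) ^ m \<le> (2 * C) ^ p" using C unfolding m by (intro power_increasing) auto
  have 5: "exp (q * s) \<le> exp (real p)" using s by simp
  have 6: "4 * exp (real p) * exp (real p) \<le> exp (- real p) * 4 ^ p * (exp 3) ^ p"
  proof -
    have "exp (- real p) * (exp 3) ^ p = exp (real p) * exp (real p)"
      by (simp flip: exp_add exp_of_nat_mult)
    then have "exp (- real p) * 4 ^ p * (exp 3) ^ p = 4 ^ p * (exp (real p) * exp (real p))"
      by (metis mult.assoc mult.commute)
    moreover have "(4::real) \<le> 4 ^ p" unfolding m by simp
    then have "4 * (exp (real p) * exp (real p)) \<le> 4 ^ p * (exp (real p) * exp (real p))"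
      by (rule mult_right_mono) simp
    ultimately show ?thesis by (simp only: mult.assoc)
  qed
  have "2 * s * fact p * (2 * v * (C * \<beta>)) ^ m * exp (q * s) =
      2 * (s * fact p * (2 * C) ^ m * v ^ m * exp (q * s)) * \<beta> ^ m"
    by (simp add: power_mult_distrib mult_ac)
  also have "\<dots> \<le> 2 * ((exp (real p) * (\<delta> * \<beta>)) * real p ^ p * (2 * C) ^ p * (w ^ p * (1 / 4) ^ k) * exp (real p)) * \<beta> ^ m"
    using 1 2 3 4 5 s pos C
    by (intro mult_left_mono mult_right_mono mult_mono) auto
  also have "\<dots> = (4 * exp (real p) * exp (real p)) * (\<delta> * real p ^ p * (2 * C) ^ p * w ^ p * (1 / 4) ^ k * \<beta> ^ p / 2)"
    unfolding m by simp
  also have "\<dots> \<le> (exp (- real p) * 4 ^ p * (exp 3) ^ p) * (\<delta> * real p ^ p * (2 * C) ^ p * w ^ p * (1 / 4) ^ k * \<beta> ^ p / 2)"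
    using 6 pos C by (intro mult_right_mono) auto
  also have "\<dots> = (exp (- real p) * (1 / 2) ^ Suc k) * (\<delta> / 2 ^ k * (8 * exp 3 * C * real p * \<beta> * w) ^ p)"
  proof -
    have "(8::real) ^ p = 4 ^ p * 2 ^ p" by (simp flip: power_mult_distrib)
    moreover have "(1 / 4 :: real) ^ k = (1 / 2) ^ k * (1 / 2) ^ k" by (simp flip: power_mult_distrib)
    ultimately show ?thesis by (simp add: power_mult_distrib power_one_over mult_ac)
  qed
  finally show ?thesis unfolding \<beta>_def \<delta>_def v_def w_def m by simp
qed

section \<open>Tails of mollified local times\<close>

text \<open>The lower bound is stated with \<open>1 +\<close> on both sides so that it holds for all frequencies although
  the exponent is controlled only at high ones. Rates \<open>q \<ge> 1\<close>
  do not see the difference.\<close>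
locale stable_paths = levy_paths +
  fixes \<alpha> c\<^sub>0 :: real
  assumes \<alpha>_gt_1: "1 < \<alpha>" and c\<^sub>0: "0 < c\<^sub>0" "c\<^sub>0 \<le> 1"
    and \<psi>_lower: "\<And>\<xi>. c\<^sub>0 * (1 + \<bar>\<xi>\<bar> powr \<alpha>) \<le> 1 + \<psi> \<xi>"
begin

text \<open>The Hoelder exponent in space used in the chaining. Any positive \<open>\<gamma> \<le> 1\<close> below \<open>(\<alpha> - 1) / 2\<close> would do.\<close>
definition \<gamma> :: real where "\<gamma> = min 1 ((\<alpha> - 1) / 4)"

lemma \<gamma>: "0 < \<gamma>" "\<gamma> \<le> 1" "2 * \<gamma> < \<alpha> - 1"
  using \<alpha>_gt_1 unfolding \<gamma>_def by (auto simp: min_def)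

text \<open>The test functions of the chaining levels: level \<open>0\<close> is the Gaussian itself, level \<open>k > 0\<close> its
  increment over the distance \<open>q powr (- 1 / \<alpha>) / 2 ^ k\<close>.\<close>
definition increment_kernel :: "real \<Rightarrow> real \<Rightarrow> nat \<Rightarrow> real \<Rightarrow> real" where
  "increment_kernel \<sigma> q k z = (if k = 0 then normal_density 0 \<sigma> z else
     normal_density 0 \<sigma> (z - q powr (- 1 / \<alpha>) / 2 ^ k) - normal_density 0 \<sigma> z)"

definition increment_kernel_fourier :: "real \<Rightarrow> real \<Rightarrow> nat \<Rightarrow> real \<Rightarrow> complex" where
  "increment_kernel_fourier \<sigma> q k \<xi> = (if k = 0 then gauss_fourier \<sigma> \<xi> else
     gauss_fourier \<sigma> \<xi> * (iexp (- (\<xi> * (q powr (- 1 / \<alpha>) / 2 ^ k))) - 1))"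

text \<open>The factor \<open>q powr (- \<gamma> / \<alpha>)\<close> contained in \<open>h powr \<gamma>\<close> for the distance
  \<open>h = q powr (- 1 / \<alpha>) / 2 ^ k\<close> is exactly the one in the weight, so only the decay in \<open>k\<close> remains in
  the constant. None of the constants except the uniform bound on the kernel depends on \<open>\<sigma>\<close>.\<close>
lemma levy_functional_increment_kernel:
  assumes \<sigma>: "0 < \<sigma>" and q: "1 \<le> q" and J: "0 \<le> J"
    "(\<integral>\<^sup>+\<eta>. ennreal (weight \<alpha> \<gamma> q \<eta> ^ 2 / (q + \<psi> \<eta>)) \<partial>lborel) \<le> ennreal J"
  shows "levy_functional M X \<psi> (increment_kernel \<sigma> q k) (increment_kernel_fourier \<sigma> q k)
    (weight \<alpha> \<gamma> q) (normal_density 0 \<sigma> 0) (2 * 2 powr (- (real k * \<gamma>))) J q"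
proof -
  define h where "h = q powr (- 1 / \<alpha>) / 2 ^ k"
  have h: "0 < h" using q unfolding h_def by simp
  have gi: "integrable lborel (gauss_fourier \<sigma>)" by (rule integrable_gauss_fourier[OF \<sigma>])
  have gi': "integrable lborel (\<lambda>\<xi>. gauss_fourier \<sigma> \<xi> * iexp (\<xi> * x))" for x
    by (rule Bochner_Integration.integrable_bound[OF gi])
       (use borel_measurable_integrable[OF gi] in \<open>auto simp: norm_mult\<close>)
  have K: "increment_kernel \<sigma> q k = (if k = 0 then normal_density 0 \<sigma> else
      (\<lambda>z. normal_density 0 \<sigma> (z - h) - normal_density 0 \<sigma> z))"
    and FK: "increment_kernel_fourier \<sigma> q k = (if k = 0 then gauss_fourier \<sigma> else
      (\<lambda>\<xi>. gauss_fourier \<sigma> \<xi> * (iexp (- (\<xi> * h)) - 1)))"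
    unfolding increment_kernel_def[abs_def] increment_kernel_fourier_def[abs_def] h_def by (auto simp: fun_eq_iff)
  have gi_h: "integrable lborel (\<lambda>\<xi>. gauss_fourier \<sigma> \<xi> * (iexp (- (\<xi> * h)) - 1))"
    using Bochner_Integration.integrable_diff[OF gi'[of "-h"] gi] by (simp add: right_diff_distrib)
  have 1: "continuous_on UNIV (increment_kernel \<sigma> q k)"
    unfolding K using continuous_normal_density[OF \<sigma>]
    by (auto intro!: continuous_on_diff continuous_on_compose2[OF continuous_normal_density[OF \<sigma>, of UNIV]] continuous_intros)
  have 2: "\<bar>increment_kernel \<sigma> q k z\<bar> \<le> normal_density 0 \<sigma> 0" for z
    using normal_density_le[OF \<sigma>, of z] normal_density_le[OF \<sigma>, of "z - h"]
      normal_density_nonneg[of 0 \<sigma> z] normal_density_nonneg[of 0 \<sigma> "z - h"]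
    unfolding K by (auto simp del: normal_density_nonneg)
  have 3: "integrable lborel (increment_kernel_fourier \<sigma> q k)"
    unfolding FK using gi gi_h by simp
  have 4: "complex_of_real (increment_kernel \<sigma> q k x) =
      (CLINT \<xi>|lborel. increment_kernel_fourier \<sigma> q k \<xi> * iexp (\<xi> * x))" for x
  proof (cases "k = 0")
    case True
    then show ?thesis unfolding K FK by (simp add: normal_density_fourier[OF \<sigma>])
  next
    case False
    have "complex_of_real (increment_kernel \<sigma> q k x) =
        (CLINT \<xi>|lborel. gauss_fourier \<sigma> \<xi> * iexp (\<xi> * (x - h))) - (CLINT \<xi>|lborel. gauss_fourier \<sigma> \<xi> * iexp (\<xi> * x))"
      unfolding K using False by (simp only: normal_density_fourier[OF \<sigma>, symmetric]) simp
    also have "\<dots> = (CLINT \<xi>|lborel. gauss_fourier \<sigma> \<xi> * iexp (\<xi> * (x - h)) - gauss_fourier \<sigma> \<xi> * iexp (\<xi> * x))"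
      by (rule Bochner_Integration.integral_diff[OF gi' gi', symmetric])
    also have "\<dots> = (CLINT \<xi>|lborel. increment_kernel_fourier \<sigma> q k \<xi> * iexp (\<xi> * x))"
    proof (rule Bochner_Integration.integral_cong[OF refl])
      fix \<xi>
      have "iexp (\<xi> * (x - h)) = iexp (- (\<xi> * h)) * iexp (\<xi> * x)"
        by (simp add: exp_add[symmetric] algebra_simps)
      then show "gauss_fourier \<sigma> \<xi> * iexp (\<xi> * (x - h)) - gauss_fourier \<sigma> \<xi> * iexp (\<xi> * x) =
          increment_kernel_fourier \<sigma> q k \<xi> * iexp (\<xi> * x)"
        unfolding FK using False by (simp only: if_False) (simp only: left_diff_distrib right_diff_distrib mult_1_left mult_1_right mult.assoc)
    qed
    finally show ?thesis .
  qed
  have W: "1 \<le> weight \<alpha> \<gamma> q \<xi>" for \<xi> unfolding weight_def by simp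
  have 5: "norm (increment_kernel_fourier \<sigma> q k (\<eta> - \<zeta>)) \<le>
      2 * 2 powr (- (real k * \<gamma>)) * weight \<alpha> \<gamma> q \<eta> * weight \<alpha> \<gamma> q \<zeta>" for \<eta> \<zeta>
  proof (cases "k = 0")
    case True
    have "1 * 1 \<le> weight \<alpha> \<gamma> q \<eta> * weight \<alpha> \<gamma> q \<zeta>" using W by (intro mult_mono) (auto intro: order_trans[OF zero_le_one])
    then show ?thesis unfolding FK using True norm_gauss_fourier_le[of \<sigma> "\<eta> - \<zeta>"] by simp
  next
    case False
    define \<theta> where "\<theta> = q powr (- \<gamma> / \<alpha>)"
    have \<theta>: "0 < \<theta>" using q unfolding \<theta>_def by simp
    have "h powr \<gamma> = \<theta> * 2 powr (- (real k * \<gamma>))"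
      using q unfolding h_def \<theta>_def
      by (simp add: powr_divide powr_mult powr_powr powr_minus_divide flip: powr_realpow)
    then have "2 * h powr \<gamma> * (\<bar>\<eta>\<bar> powr \<gamma> + \<bar>\<zeta>\<bar> powr \<gamma>) =
        2 * 2 powr (- (real k * \<gamma>)) * (\<theta> * \<bar>\<eta>\<bar> powr \<gamma> + \<theta> * \<bar>\<zeta>\<bar> powr \<gamma>)"
      by (simp add: algebra_simps)
    also have "\<dots> \<le> 2 * 2 powr (- (real k * \<gamma>)) * (weight \<alpha> \<gamma> q \<eta> * weight \<alpha> \<gamma> q \<zeta>)"
    proof (rule mult_left_mono)
      have "0 \<le> \<theta> * \<bar>\<eta>\<bar> powr \<gamma> * (\<theta> * \<bar>\<zeta>\<bar> powr \<gamma>)" using \<theta> by simp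
      then show "\<theta> * \<bar>\<eta>\<bar> powr \<gamma> + \<theta> * \<bar>\<zeta>\<bar> powr \<gamma> \<le> weight \<alpha> \<gamma> q \<eta> * weight \<alpha> \<gamma> q \<zeta>"
        unfolding weight_def \<theta>_def[symmetric] by (simp add: algebra_simps)
    qed simp
    finally show ?thesis
      unfolding FK using False norm_gauss_increment_fourier_le[OF \<gamma>(1,2) h, of \<sigma> \<eta> \<zeta>]
      by (simp only: if_False mult.assoc)
  qed
  have 6: "weight \<alpha> \<gamma> q \<in> borel_measurable borel" "weight \<alpha> \<gamma> q 0 = 1"
    unfolding weight_def using \<gamma> by auto
  show ?thesis
    by unfold_locales (use 1 2 3 4 5 6 W J q in auto)
qed

lemma nn_integral_increment_kernel_le:
  assumes \<sigma>: "0 < \<sigma>"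
  shows "(\<integral>\<^sup>+z. ennreal \<bar>increment_kernel \<sigma> q k z\<bar> \<partial>lborel) \<le> ennreal 2"
proof -
  define h where "h = q powr (- 1 / \<alpha>) / 2 ^ k"
  have one: "(\<integral>\<^sup>+z. ennreal (normal_density 0 \<sigma> z) \<partial>lborel) = 1"
    using \<sigma> by (subst nn_integral_eq_integral) auto
  have one': "(\<integral>\<^sup>+z. ennreal (normal_density 0 \<sigma> (z - h)) \<partial>lborel) = 1"
    using nn_integral_real_affine[of "\<lambda>z. ennreal (normal_density 0 \<sigma> z)" 1 "-h"] one by simp
  have "(\<integral>\<^sup>+z. ennreal \<bar>increment_kernel \<sigma> q k z\<bar> \<partial>lborel) \<le>
      (\<integral>\<^sup>+z. ennreal (normal_density 0 \<sigma> (z - h)) + ennreal (normal_density 0 \<sigma> z) \<partial>lborel)"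
  proof (rule nn_integral_mono)
    fix z
    have "\<bar>increment_kernel \<sigma> q k z\<bar> \<le> normal_density 0 \<sigma> (z - h) + normal_density 0 \<sigma> z"
      unfolding increment_kernel_def h_def[symmetric]
      using normal_density_nonneg[of 0 \<sigma> z] normal_density_nonneg[of 0 \<sigma> "z - h"]
      by (auto simp del: normal_density_nonneg)
    then show "ennreal \<bar>increment_kernel \<sigma> q k z\<bar> \<le> ennreal (normal_density 0 \<sigma> (z - h)) + ennreal (normal_density 0 \<sigma> z)"
      by (simp add: ennreal_plus[symmetric] ennreal_leI del: ennreal_plus)
  qed
  also have "\<dots> = 2" using one one' by (simp add: nn_integral_add)
  finally show ?thesis by simp
qed

definition smoothed :: "real \<Rightarrow> real \<Rightarrow> real \<Rightarrow> 'a \<Rightarrow> real \<Rightarrow> real" where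
  "smoothed \<sigma> a b \<omega> x = additive (\<lambda>z. normal_density 0 \<sigma> (z - x)) a b \<omega>"

lemma continuous_smoothed:
  assumes \<sigma>: "0 < \<sigma>" and \<omega> [measurable]: "\<omega> \<in> space M"
  shows "continuous_on UNIV (smoothed \<sigma> a b \<omega>)"
proof -
  have "isCont (smoothed \<sigma> a b \<omega>) x" for x
    unfolding continuous_at_sequentially
  proof (intro allI impI)
    fix Y assume Y: "Y \<longlonglongrightarrow> x"
    show "(smoothed \<sigma> a b \<omega> \<circ> Y) \<longlonglongrightarrow> smoothed \<sigma> a b \<omega> x"
      unfolding comp_def smoothed_def additive_def
    proof (rule integral_dominated_convergence[where w = "\<lambda>r. normal_density 0 \<sigma> 0 * indicator {a..b} r"])
      show "integrable lborel (\<lambda>r. normal_density 0 \<sigma> 0 * indicat_real {a..b} r)"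
        by (intro integrable_mult_right) (auto simp: emeasure_lborel_Icc_eq)
      have "isCont (normal_density 0 \<sigma>) z" for z
        using continuous_normal_density[OF \<sigma>, of UNIV] by (simp add: continuous_on_eq_continuous_at)
      then show "AE r in lborel. (\<lambda>n. indicator {a..b} r * normal_density 0 \<sigma> (X r \<omega> - Y n))
          \<longlonglongrightarrow> indicator {a..b} r * normal_density 0 \<sigma> (X r \<omega> - x)"
        by (intro AE_I2 tendsto_mult tendsto_const isCont_tendsto_compose[where g = "normal_density 0 \<sigma>"] tendsto_diff Y)
      show "AE r in lborel. norm (indicator {a..b} r * normal_density 0 \<sigma> (X r \<omega> - Y n)) \<le>
          normal_density 0 \<sigma> 0 * indicator {a..b} r" for n
        using normal_density_le[OF \<sigma>] by (intro AE_I2) (auto split: split_indicator)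
    qed measurable
  qed
  then show ?thesis by (simp add: continuous_on_eq_continuous_at)
qed

lemma additive_increment_kernel:
  assumes \<sigma>: "0 < \<sigma>" and \<omega>: "\<omega> \<in> space M"
  shows "additive (\<lambda>z. increment_kernel \<sigma> q k (z - x)) a b \<omega> =
    (if k = 0 then smoothed \<sigma> a b \<omega> x else
      smoothed \<sigma> a b \<omega> (x + q powr (- 1 / \<alpha>) / 2 ^ k) - smoothed \<sigma> a b \<omega> x)"
proof (cases "k = 0")
  case True
  then show ?thesis unfolding increment_kernel_def smoothed_def by simp
next
  case False
  have int: "integrable lborel (\<lambda>r. indicator {a..b} r * normal_density 0 \<sigma> (X r \<omega> - x))" for x
    using normal_density_le[OF \<sigma>]
    by (intro integrable_along_path[OF \<omega>, where f = "\<lambda>z. normal_density 0 \<sigma> (z - x)" and B = "normal_density 0 \<sigma> 0"]) auto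
  show ?thesis
    using False Bochner_Integration.integral_diff[OF int[of "x + q powr (- 1 / \<alpha>) / 2 ^ k"] int[of x]]
    unfolding increment_kernel_def smoothed_def additive_def
    by (simp add: right_diff_distrib diff_diff_eq)
qed

text \<open>The exceptional set is the union over the levels \<open>k\<close> of the events that the \<open>p\<close>-th power integral of
  the increment exceeds its threshold; off this set \<open>chaining_bound\<close> applies path by path. The constant
  \<open>\<Lambda>\<close> depends neither on \<open>\<sigma>\<close> nor on \<open>p\<close>, \<open>q\<close> and the time interval.\<close>
lemma smoothed_tail:
  obtains \<Lambda> where "0 < \<Lambda>"
    "\<And>\<sigma> p a b q. \<lbrakk>0 < \<sigma>; even p; 0 < p; 4 / \<gamma> \<le> real p; 0 \<le> a; a < b; 1 \<le> q; q * (b - a) \<le> real p\<rbrakk> \<Longrightarrow>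
      \<exists>E\<in>sets M. prob E \<le> exp (- real p) \<and>
        (\<forall>\<omega>\<in>space M - E. \<forall>x. smoothed \<sigma> a b \<omega> x \<le> \<Lambda> * real p * q powr (- (1 - 1 / \<alpha>)))"
proof -
  obtain C where C: "1 \<le> C" "\<And>q. 1 \<le> q \<Longrightarrow>
    (\<integral>\<^sup>+\<eta>. ennreal (weight \<alpha> \<gamma> q \<eta> ^ 2 / (q + \<psi> \<eta>)) \<partial>lborel) \<le> ennreal (C * q powr (- (1 - 1 / \<alpha>)))"
    using resolvent_weight_bound[OF \<alpha>_gt_1 \<gamma>(1,3) c\<^sub>0 \<psi>_measurable \<psi>_lower] by blast
  define w where "w = 2 powr (- (\<gamma> / 4))"
  have w: "0 < w" "w < 1" using \<gamma> unfolding w_def by (auto simp: powr_less_one)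
  define \<Lambda> where "\<Lambda> = 2 * (8 * exp 3 * C) / (1 - w)"
  show ?thesis
  proof (rule that[of \<Lambda>])
    show "0 < \<Lambda>" using w C unfolding \<Lambda>_def by simp
    fix \<sigma> a b q :: real and p :: nat
    assume \<sigma>: "0 < \<sigma>" and p: "even p" "0 < p" "4 / \<gamma> \<le> real p" and ab: "0 \<le> a" "a < b"
      and q: "1 \<le> q" "q * (b - a) \<le> real p"
    define \<beta> where "\<beta> = q powr (- (1 - 1 / \<alpha>))"
    define \<delta> where "\<delta> = q powr (- 1 / \<alpha>)"
    have pos: "0 < \<beta>" "0 < \<delta>" using q unfolding \<beta>_def \<delta>_def by auto
    define l where "l k = 8 * exp 3 * C * real p * \<beta> * 2 powr (- (real k * \<gamma> / 4))" for k :: nat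
    have l_eq: "l k = (8 * exp 3 * C * real p * \<beta>) * w ^ k" for k
      unfolding l_def w_def by (simp add: powr_powr mult.commute flip: powr_realpow)
    have l_pos: "0 < l k" for k using C p pos w unfolding l_eq by simp
    have l_sums: "l sums ((8 * exp 3 * C * real p * \<beta>) * (1 / (1 - w)))"
      unfolding l_eq using w by (intro sums_mult geometric_sums) auto
    define I where "I k \<omega> = (\<integral>\<^sup>+x. ennreal (additive (\<lambda>z. increment_kernel \<sigma> q k (z - x)) a b \<omega> ^ p) \<partial>lborel)"
      for k \<omega>
    have [measurable]: "increment_kernel \<sigma> q k \<in> borel_measurable borel" for k
      unfolding increment_kernel_def by measurable
    have [measurable]: "I k \<in> borel_measurable M" for k
      unfolding I_def additive_def
      by (intro lborel.borel_measurable_nn_integral) (simp add: split_beta')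
    define d where "d k = \<delta> / 2 ^ k * l k ^ p" for k
    have d_pos: "0 < d k" for k using pos l_pos unfolding d_def by simp
    have EI: "(\<integral>\<^sup>+\<omega>. I k \<omega> \<partial>M) \<le> ennreal ((exp (- real p) * (1 / 2) ^ Suc k) * d k)" for k
    proof -
      interpret K: levy_functional M X \<psi> "increment_kernel \<sigma> q k" "increment_kernel_fourier \<sigma> q k"
        "weight \<alpha> \<gamma> q" "normal_density 0 \<sigma> 0" "2 * 2 powr (- (real k * \<gamma>))" "C * \<beta>" q
        using C(1) C(2)[OF q(1)] pos unfolding \<beta>_def
        by (intro levy_functional_increment_kernel \<sigma> q) auto
      have "(\<integral>\<^sup>+\<omega>. I k \<omega> \<partial>M) \<le>
          ennreal (2 * (b - a) * fact p * (2 * 2 powr (- (real k * \<gamma>)) * (C * \<beta>)) ^ (p - 1) * exp (q * (b - a)))"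
        unfolding I_def
        by (rule K.integrated_additive_moment_le[OF ab p(1,2) nn_integral_increment_kernel_le[OF \<sigma>]]) simp
      also have "\<dots> \<le> ennreal ((exp (- real p) * (1 / 2) ^ Suc k) * d k)"
        unfolding d_def l_def \<beta>_def \<delta>_def using ab q
        by (intro ennreal_leI chaining_level_estimate \<gamma>(1,2) C(1) p) auto
      finally show ?thesis .
    qed
    define E where "E k = {\<omega>\<in>space M. 1 \<le> ennreal (1 / d k) * I k \<omega>}" for k
    have E_sets [measurable]: "E k \<in> sets M" for k unfolding E_def by measurable
    have prob_E: "prob (E k) \<le> exp (- real p) * (1 / 2) ^ Suc k" for k
    proof -
      have "emeasure M (E k) \<le> ennreal (1 / d k) * (\<integral>\<^sup>+\<omega>. I k \<omega> * indicator (space M) \<omega> \<partial>M)"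
        unfolding E_def by (rule nn_integral_Markov_inequality) auto
      also have "(\<integral>\<^sup>+\<omega>. I k \<omega> * indicator (space M) \<omega> \<partial>M) = (\<integral>\<^sup>+\<omega>. I k \<omega> \<partial>M)"
        by (intro nn_integral_cong) auto
      also have "ennreal (1 / d k) * \<dots> \<le> ennreal (1 / d k) * ennreal ((exp (- real p) * (1 / 2) ^ Suc k) * d k)"
        by (intro mult_left_mono EI) auto
      also have "\<dots> = ennreal (exp (- real p) * (1 / 2) ^ Suc k)"
        using d_pos[of k] by (subst ennreal_mult[symmetric]) (auto simp: less_imp_le)
      finally show ?thesis unfolding emeasure_eq_measure by (subst (asm) ennreal_le_iff) auto
    qed
    have half: "(\<lambda>k. exp (- real p) * (1 / 2) ^ Suc k) sums (exp (- real p) * 1)"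
      by (intro sums_mult power_half_series)
    have summable: "summable (\<lambda>k. prob (E k))"
      by (rule summable_comparison_test'[OF sums_summable[OF half]]) (use prob_E in auto)
    have "prob (\<Union>k. E k) \<le> (\<Sum>k. prob (E k))"
      by (rule finite_measure_subadditive_countably[OF _ summable]) auto
    also have "\<dots> \<le> exp (- real p)"
      using suminf_le[OF prob_E summable sums_summable[OF half]] sums_unique[OF half] by simp
    finally have prob_le: "prob (\<Union>k. E k) \<le> exp (- real p)" .
    have "smoothed \<sigma> a b \<omega> x \<le> \<Lambda> * real p * \<beta>" if \<omega>: "\<omega> \<in> space M - (\<Union>k. E k)" for \<omega> x
    proof -
      have \<omega>M: "\<omega> \<in> space M" using \<omega> by simp
      have I_le: "I k \<omega> \<le> ennreal (d k)" for k
      proof -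
        have "ennreal (1 / d k) * I k \<omega> < 1" using \<omega> by (auto simp: E_def not_le)
        then have "ennreal (d k) * (ennreal (1 / d k) * I k \<omega>) \<le> ennreal (d k) * 1"
          by (intro mult_left_mono) auto
        then show ?thesis
          using d_pos[of k] by (simp add: mult.assoc[symmetric] ennreal_mult[symmetric] less_imp_le)
      qed
      have "smoothed \<sigma> a b \<omega> x \<le> 2 * suminf l"
      proof (rule chaining_bound[OF continuous_smoothed[OF \<sigma> \<omega>M] p(1,2) pos(2) l_pos sums_summable[OF l_sums]])
        show "(\<integral>\<^sup>+x. ennreal (smoothed \<sigma> a b \<omega> x ^ p) \<partial>lborel) \<le> ennreal (\<delta> * l 0 ^ p)"
          using I_le[of 0] unfolding I_def d_def additive_increment_kernel[OF \<sigma> \<omega>M] by simp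
        show "(\<integral>\<^sup>+x. ennreal ((smoothed \<sigma> a b \<omega> (x + \<delta> / 2 ^ Suc k) - smoothed \<sigma> a b \<omega> x) ^ p) \<partial>lborel)
            \<le> ennreal (\<delta> / 2 ^ Suc k * l (Suc k) ^ p)" for k
          using I_le[of "Suc k"] unfolding I_def d_def additive_increment_kernel[OF \<sigma> \<omega>M] \<delta>_def by simp
      qed
      also have "\<dots> = \<Lambda> * real p * \<beta>"
        using sums_unique[OF l_sums] unfolding \<Lambda>_def by simp
      finally show ?thesis .
    qed
    then show "\<exists>E\<in>sets M. prob E \<le> exp (- real p) \<and>
        (\<forall>\<omega>\<in>space M - E. \<forall>x. smoothed \<sigma> a b \<omega> x \<le> \<Lambda> * real p * q powr (- (1 - 1 / \<alpha>)))"
      using prob_le unfolding \<beta>_def by (intro bexI[of _ "\<Union>k. E k"]) auto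
  qed
qed

end

section \<open>Continuous occupation densities\<close>

text \<open>The inequality \<open>exp (- u) \<le> 1 / u\<close> is enough to make the density uniformly small away from its mean as
  \<open>\<sigma>\<close> tends to zero.\<close>
lemma normal_density_away_le:
  assumes \<sigma>: "0 < \<sigma>" and d: "0 < d" "d \<le> \<bar>z\<bar>"
  shows "normal_density 0 \<sigma> z \<le> \<sigma> / d\<^sup>2"
proof -
  have z: "z \<noteq> 0" using d by auto
  define u where "u = z\<^sup>2 / (2 * \<sigma>\<^sup>2)"
  have u: "0 < u" using z \<sigma> unfolding u_def by simp
  have "u * exp (- u) \<le> 1"
  proof -
    have "u \<le> exp u" using exp_ge_add_one_self[of u] by linarith
    then have "u * exp (- u) \<le> exp u * exp (- u)" by (rule mult_right_mono) simp
    then show ?thesis by (simp flip: exp_add)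
  qed
  then have e: "exp (- u) \<le> 1 / u" using u by (simp only: pos_le_divide_eq mult.commute)
  have "2 * \<sigma> \<le> sqrt (2 * pi) * sqrt (\<sigma>\<^sup>2)"
  proof -
    have "2 \<le> sqrt (2 * pi)" using pi_ge_two by (intro real_le_rsqrt) auto
    then show ?thesis using \<sigma> by simp
  qed
  then have s: "2 * \<sigma> \<le> sqrt (2 * pi * \<sigma>\<^sup>2)" by (simp only: real_sqrt_mult)
  have "normal_density 0 \<sigma> z = 1 / sqrt (2 * pi * \<sigma>\<^sup>2) * exp (- u)"
    unfolding normal_density_def u_def by simp
  also have "\<dots> \<le> 1 / (2 * \<sigma>) * (1 / u)"
    using s \<sigma> e by (intro mult_mono divide_left_mono) auto
  also have "\<dots> = \<sigma> / z\<^sup>2"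
  proof -
    have "1 / u = 2 * \<sigma>\<^sup>2 / z\<^sup>2" unfolding u_def by simp
    then show ?thesis using \<sigma> by (simp add: power2_eq_square)
  qed
  also have "\<dots> \<le> \<sigma> / d\<^sup>2"
    using \<sigma> d z power_mono[OF d(2), of 2] by (intro divide_left_mono) auto
  finally show ?thesis .
qed

lemma continuous_local_time_slice:
  fixes l :: "real \<Rightarrow> real \<Rightarrow> real"
  assumes "continuous_on (UNIV \<times> {0..}) (\<lambda>(x, t). l x t)" "0 \<le> t"
  shows "continuous_on UNIV (\<lambda>x. l x t)"
proof -
  have "continuous_on UNIV (\<lambda>x. (\<lambda>(x, t). l x t) (x, t))"
    by (rule continuous_on_compose2[OF assms(1)]) (use assms(2) in \<open>auto intro!: continuous_intros\<close>)
  then show ?thesis by simp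
qed

text \<open>The density \<open>l\<close> is only known to be continuous and integrable. Near \<open>x\<close> continuity is used;
  away from \<open>x\<close> the contribution of \<open>l z\<close> is small because the normal density is uniformly small there
  and \<open>l\<close> has mass \<open>t\<close>, and the contribution of \<open>l x\<close> is small by the second moment.\<close>
lemma occupation_density_limit:
  fixes Y :: "real \<Rightarrow> real" and l :: "real \<Rightarrow> real"
  assumes Y: "Y \<in> borel_measurable (restrict_space lborel {0..t})" and t: "0 \<le> t"
    and l: "continuous_on UNIV l" "\<And>x. 0 \<le> l x"
    and occ: "density lborel (\<lambda>x. ennreal (l x)) = distr (restrict_space lborel {0..t}) borel Y"
  shows "(\<lambda>n. LINT r|lborel. indicator {0..t} r * normal_density 0 (1 / real (Suc n)) (Y r - x)) \<longlonglongrightarrow> l x"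
proof -
  let ?\<phi> = "\<lambda>\<sigma> z. normal_density 0 \<sigma> (z - x)"
  have [measurable]: "l \<in> borel_measurable borel"
    using l(1) by (rule borel_measurable_continuous_onI)
  have "(\<integral>\<^sup>+x. ennreal (l x) \<partial>lborel) = emeasure (density lborel (\<lambda>x. ennreal (l x))) UNIV"
    by (simp add: emeasure_density)
  also have "\<dots> = ennreal t"
    unfolding occ using Y t by (simp add: emeasure_distr emeasure_restrict_space space_restrict_space)
  finally have mass: "(\<integral>\<^sup>+x. ennreal (l x) \<partial>lborel) = ennreal t" .
  then have l_int: "integrable lborel l"
    using l(2) by (intro integrableI_bounded) auto
  have l_mass: "(LINT z|lborel. l z) = t"
    using nn_integral_eq_integral[OF l_int] l(2) t mass
    by (simp add: integral_nonneg_AE)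
  define A where "A \<sigma> = (LINT r|lborel. indicator {0..t} r * normal_density 0 \<sigma> (Y r - x))" for \<sigma>
  have A_eq: "A \<sigma> = (LINT z|lborel. l z * ?\<phi> \<sigma> z)" for \<sigma>
  proof -
    have "A \<sigma> = (LINT r|restrict_space lborel {0..t}. normal_density 0 \<sigma> (Y r - x))"
      unfolding A_def by (subst integral_restrict_space) auto
    also have "\<dots> = (LINT z|distr (restrict_space lborel {0..t}) borel Y. ?\<phi> \<sigma> z)"
      by (subst integral_distr[OF Y]) auto
    also have "\<dots> = (LINT z|lborel. l z * ?\<phi> \<sigma> z)"
      unfolding occ[symmetric] using l(2) by (subst integral_density) auto
    finally show ?thesis .
  qed
  have est: "\<bar>A \<sigma> - l x\<bar> \<le> e + (\<sigma> / d\<^sup>2 * t + l x / d\<^sup>2 * \<sigma>\<^sup>2)"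
    if \<sigma>: "0 < \<sigma>" and d: "0 < d" and e: "0 < e" and near: "\<And>z. \<bar>z - x\<bar> < d \<Longrightarrow> \<bar>l z - l x\<bar> \<le> e" for \<sigma> d e
  proof -
    have \<phi>: "integrable lborel (\<lambda>z. ?\<phi> \<sigma> z)" "(LINT z|lborel. ?\<phi> \<sigma> z) = 1"
    proof -
      have "?\<phi> \<sigma> z = normal_density x \<sigma> z" for z unfolding normal_density_def by simp
      then show "integrable lborel (\<lambda>z. ?\<phi> \<sigma> z)" "(LINT z|lborel. ?\<phi> \<sigma> z) = 1"
        using \<sigma> by simp_all
    qed
    have second: "integrable lborel (\<lambda>z. ?\<phi> \<sigma> z * (z - x)\<^sup>2)"
      "(LINT z|lborel. ?\<phi> \<sigma> z * (z - x)\<^sup>2) = \<sigma>\<^sup>2"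
    proof -
      have "?\<phi> \<sigma> z = normal_density x \<sigma> z" for z unfolding normal_density_def by simp
      then show "integrable lborel (\<lambda>z. ?\<phi> \<sigma> z * (z - x)\<^sup>2)"
        "(LINT z|lborel. ?\<phi> \<sigma> z * (z - x)\<^sup>2) = \<sigma>\<^sup>2"
        using integrable_normal_moment[OF \<sigma>, of x 2] integral_normal_moment_even[OF \<sigma>, of x 1] \<sigma>
        by (simp_all add: fact_2)
    qed
    have l\<phi>: "integrable lborel (\<lambda>z. l z * ?\<phi> \<sigma> z)"
    proof (rule Bochner_Integration.integrable_bound)
      show "integrable lborel (\<lambda>z. normal_density 0 \<sigma> 0 * l z)" using l_int by simp
      show "AE z in lborel. norm (l z * ?\<phi> \<sigma> z) \<le> norm (normal_density 0 \<sigma> 0 * l z)"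
        using normal_density_le[OF \<sigma>] l(2)
        by (intro AE_I2) (simp add: abs_mult mult.commute[of "normal_density 0 \<sigma> 0"] mult_left_mono)
    qed measurable
    have diff: "A \<sigma> - l x = (LINT z|lborel. l z * ?\<phi> \<sigma> z - l x * ?\<phi> \<sigma> z)"
      unfolding A_eq using l\<phi> \<phi> by simp
    have "\<bar>A \<sigma> - l x\<bar> \<le> (LINT z|lborel. \<bar>l z * ?\<phi> \<sigma> z - l x * ?\<phi> \<sigma> z\<bar>)"
      unfolding diff by (rule integral_abs_bound)
    also have "\<dots> \<le> (LINT z|lborel. e * ?\<phi> \<sigma> z + (\<sigma> / d\<^sup>2 * l z + l x / d\<^sup>2 * (?\<phi> \<sigma> z * (z - x)\<^sup>2)))"
    proof (rule integral_mono)
      show "integrable lborel (\<lambda>z. \<bar>l z * ?\<phi> \<sigma> z - l x * ?\<phi> \<sigma> z\<bar>)"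
        by (rule integrable_abs[OF Bochner_Integration.integrable_diff[OF l\<phi> integrable_mult_right[OF \<phi>(1)]]])
      show "integrable lborel (\<lambda>z. e * ?\<phi> \<sigma> z + (\<sigma> / d\<^sup>2 * l z + l x / d\<^sup>2 * (?\<phi> \<sigma> z * (z - x)\<^sup>2)))"
        by (rule Bochner_Integration.integrable_add[OF integrable_mult_right[OF \<phi>(1)]
              Bochner_Integration.integrable_add[OF integrable_mult_right[OF l_int] integrable_mult_right[OF second(1)]]])
      fix z
      have p: "0 \<le> ?\<phi> \<sigma> z" by simp
      have eq: "\<bar>l z * ?\<phi> \<sigma> z - l x * ?\<phi> \<sigma> z\<bar> = \<bar>l z - l x\<bar> * ?\<phi> \<sigma> z"
        by (simp only: left_diff_distrib[symmetric] abs_mult abs_of_nonneg[OF p])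
      show "\<bar>l z * ?\<phi> \<sigma> z - l x * ?\<phi> \<sigma> z\<bar> \<le> e * ?\<phi> \<sigma> z + (\<sigma> / d\<^sup>2 * l z + l x / d\<^sup>2 * (?\<phi> \<sigma> z * (z - x)\<^sup>2))"
      proof (cases "\<bar>z - x\<bar> < d")
        case True
        have "0 \<le> \<sigma> / d\<^sup>2 * l z" "0 \<le> l x / d\<^sup>2 * (?\<phi> \<sigma> z * (z - x)\<^sup>2)" using \<sigma> l(2) by auto
        moreover have "\<bar>l z - l x\<bar> * ?\<phi> \<sigma> z \<le> e * ?\<phi> \<sigma> z" using near[OF True] by (intro mult_right_mono) auto
        ultimately show ?thesis unfolding eq by linarith
      next
        case False
        then have 1: "?\<phi> \<sigma> z \<le> \<sigma> / d\<^sup>2" by (intro normal_density_away_le \<sigma> d) auto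
        have "d\<^sup>2 \<le> (z - x)\<^sup>2" using False d power_mono[of d "\<bar>z - x\<bar>" 2] by simp
        then have 2: "1 \<le> (z - x)\<^sup>2 / d\<^sup>2" using d by simp
        have "\<bar>l z - l x\<bar> \<le> l z + l x" using l(2)[of x] l(2)[of z] by (simp add: abs_le_iff)
        then have 3: "\<bar>l z - l x\<bar> * ?\<phi> \<sigma> z \<le> l z * ?\<phi> \<sigma> z + l x * ?\<phi> \<sigma> z"
          unfolding distrib_right[symmetric] using p by (rule mult_right_mono)
        have 4: "l z * ?\<phi> \<sigma> z \<le> \<sigma> / d\<^sup>2 * l z"
          using mult_left_mono[OF 1 l(2)[of z]] by (simp only: mult.commute)
        have "(l x * ?\<phi> \<sigma> z) * 1 \<le> (l x * ?\<phi> \<sigma> z) * ((z - x)\<^sup>2 / d\<^sup>2)"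
          by (rule mult_left_mono[OF 2]) (rule mult_nonneg_nonneg[OF l(2) p])
        then have 5: "l x * ?\<phi> \<sigma> z \<le> l x / d\<^sup>2 * (?\<phi> \<sigma> z * (z - x)\<^sup>2)"
          by (simp only: mult_1_right times_divide_eq_right times_divide_eq_left mult.assoc)
        have "\<bar>l z - l x\<bar> * ?\<phi> \<sigma> z \<le> \<sigma> / d\<^sup>2 * l z + l x / d\<^sup>2 * (?\<phi> \<sigma> z * (z - x)\<^sup>2)"
          using 3 4 5 by linarith
        moreover have "0 \<le> e * ?\<phi> \<sigma> z" using e p by simp
        ultimately show ?thesis unfolding eq by linarith
      qed
    qed
    also have "\<dots> = e + (\<sigma> / d\<^sup>2 * t + l x / d\<^sup>2 * \<sigma>\<^sup>2)"
      using \<phi> second l_int l_mass by simp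
    finally show ?thesis .
  qed
  show ?thesis
  proof (rule LIMSEQ_I)
    fix e :: real assume e: "0 < e"
    have "\<exists>d>0. \<forall>z. dist z x < d \<longrightarrow> dist (l z) (l x) < e / 2"
      using l(1)[unfolded continuous_on_iff, rule_format, of x "e / 2"] e by simp
    then obtain d where d: "0 < d" "\<And>z. \<bar>z - x\<bar> < d \<Longrightarrow> \<bar>l z - l x\<bar> \<le> e / 2"
      by (auto simp: dist_real_def less_imp_le)
    have inv: "(\<lambda>n. 1 / real (Suc n)) \<longlonglongrightarrow> 0"
      using LIMSEQ_inverse_real_of_nat by (simp add: inverse_eq_divide)
    have "(\<lambda>n. 1 / real (Suc n) / d\<^sup>2 * t + l x / d\<^sup>2 * (1 / real (Suc n))\<^sup>2) \<longlonglongrightarrow> 0 / d\<^sup>2 * t + l x / d\<^sup>2 * 0\<^sup>2"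
      using d by (intro tendsto_intros inv) auto
    then have "eventually (\<lambda>n. 1 / real (Suc n) / d\<^sup>2 * t + l x / d\<^sup>2 * (1 / real (Suc n))\<^sup>2 < e / 2) sequentially"
      using e by (intro order_tendstoD) auto
    then obtain N where N: "\<And>n. n \<ge> N \<Longrightarrow> 1 / real (Suc n) / d\<^sup>2 * t + l x / d\<^sup>2 * (1 / real (Suc n))\<^sup>2 < e / 2"
      unfolding eventually_sequentially by blast
    have "norm (A (1 / real (Suc n)) - l x) < e" if "n \<ge> N" for n
    proof -
      have "\<bar>A (1 / real (Suc n)) - l x\<bar> \<le>
          e / 2 + (1 / real (Suc n) / d\<^sup>2 * t + l x / d\<^sup>2 * (1 / real (Suc n))\<^sup>2)"
        by (rule est) (use d e in auto)
      then show ?thesis using N[OF that] by (simp only: real_norm_def)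
    qed
    then show "\<exists>no. \<forall>n\<ge>no. norm ((LINT r|lborel. indicator {0..t} r * normal_density 0 (1 / real (Suc n)) (Y r - x)) - l x) < e"
      unfolding A_def by blast
  qed
qed

section \<open>From the Levy process to a right-continuous version\<close>

context levy_process
begin

lemma real_distribution_X: "0 \<le> t \<Longrightarrow> real_distribution (distr M borel (X t))"
  by (intro real_distribution_distr rv)

lemma exponent_eq:
  assumes "has_char_exponent M X (\<lambda>\<xi>. complex_of_real (\<psi> \<xi>))" "0 \<le> t"
  shows "char (distr M borel (X t)) \<xi> = complex_of_real (exp (- (t * \<psi> \<xi>)))"
  using assms unfolding has_char_exponent_def by (simp flip: exp_of_real of_real_mult of_real_minus)

lemma exponent_nonneg:
  assumes "has_char_exponent M X (\<lambda>\<xi>. complex_of_real (\<psi> \<xi>))"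
  shows "0 \<le> \<psi> \<xi>"
proof -
  interpret D: real_distribution "distr M borel (X 1)" by (rule real_distribution_X) simp
  have "norm (complex_of_real (exp (- (1 * \<psi> \<xi>)))) \<le> 1"
    using D.cmod_char_le_1[of \<xi>] exponent_eq[OF assms, of 1 \<xi>] by (simp del: norm_of_real)
  then show ?thesis by simp
qed

lemma exponent_measurable:
  assumes "has_char_exponent M X (\<lambda>\<xi>. complex_of_real (\<psi> \<xi>))"
  shows "\<psi> \<in> borel_measurable borel"
proof -
  interpret D: real_distribution "distr M borel (X 1)" by (rule real_distribution_X) simp
  have "\<psi> \<xi> = - ln (Re (char (distr M borel (X 1)) \<xi>))" for \<xi>
    using exponent_eq[OF assms, of 1 \<xi>] by simp
  then have "\<psi> = (\<lambda>\<xi>. - ln (Re (char (distr M borel (X 1)) \<xi>)))" by (rule ext)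
  then show ?thesis using D.char_measurable by simp
qed

lemma exponent_even:
  assumes "has_char_exponent M X (\<lambda>\<xi>. complex_of_real (\<psi> \<xi>))"
  shows "\<psi> (- \<xi>) = \<psi> \<xi>"
proof -
  have "char (distr M borel (X 1)) (- \<xi>) = cnj (char (distr M borel (X 1)) \<xi>)"
    unfolding char_def Bochner_Integration.integral_cnj[symmetric]
    by (intro Bochner_Integration.integral_cong) (auto simp: exp_cnj)
  then show ?thesis
    using exponent_eq[OF assms, of 1 \<xi>] exponent_eq[OF assms, of 1 "- \<xi>"]
    by (simp flip: of_real_exp)
qed

text \<open>On the exceptional null set, and at negative times, the path is replaced by zero; a path that is
  zero before time \<open>0\<close> is right-continuous on the whole line.\<close>
lemma right_continuous_version:
  obtains X' where "\<And>t. X' t \<in> borel_measurable M"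
    "\<And>t \<omega>. ((\<lambda>s. X' s \<omega>) \<longlongrightarrow> X' t \<omega>) (at_right t)"
    "AE \<omega> in M. \<forall>t\<ge>0. X' t \<omega> = X t \<omega>"
proof -
  obtain N where N: "{\<omega>\<in>space M. \<not> cadlag (\<lambda>t. X t \<omega>)} \<subseteq> N" "N \<in> null_sets M"
    using cadlag_paths by (auto elim!: AE_E simp: null_sets_def)
  define X' where "X' t \<omega> = (if \<omega> \<in> space M - N \<and> 0 \<le> t then X t \<omega> else 0)" for t \<omega>
  show ?thesis
  proof (rule that[of X'])
    show "X' t \<in> borel_measurable M" for t
    proof (cases "0 \<le> t")
      case True
      have [measurable]: "X t \<in> borel_measurable M" using rv[OF True] .
      have [measurable]: "N \<in> sets M" using N(2) by auto
      show ?thesis unfolding X'_def using True by measurable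
    next
      case False
      then show ?thesis unfolding X'_def by simp
    qed
    show "((\<lambda>s. X' s \<omega>) \<longlongrightarrow> X' t \<omega>) (at_right t)" for t \<omega>
    proof (cases "\<omega> \<in> space M - N \<and> 0 \<le> t")
      case True
      then have "continuous (at_right t) (\<lambda>t. X t \<omega>)"
        using N(1) unfolding cadlag_def by auto
      then have "((\<lambda>s. X s \<omega>) \<longlongrightarrow> X t \<omega>) (at_right t)" by (simp add: continuous_within)
      moreover have "eventually (\<lambda>s. X s \<omega> = X' s \<omega>) (at_right t)"
        using True by (intro eventually_at_rightI[of t "t + 1"]) (auto simp: X'_def)
      ultimately show ?thesis
        using True by (auto simp: X'_def[of t] elim: Lim_transform_eventually)
    next
      case False
      have "eventually (\<lambda>s. 0 = X' s \<omega>) (at_right t)"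
      proof (cases "0 \<le> t")
        case True
        then show ?thesis using False by (auto simp: X'_def)
      next
        case t: False
        then show ?thesis by (intro eventually_at_rightI[of t 0]) (auto simp: X'_def)
      qed
      then have "((\<lambda>s. X' s \<omega>) \<longlongrightarrow> 0) (at_right t)"
        by (rule Lim_transform_eventually[OF tendsto_const])
      then show ?thesis using False by (auto simp: X'_def[of t])
    qed
    show "AE \<omega> in M. \<forall>t\<ge>0. X' t \<omega> = X t \<omega>"
      using AE_not_in[OF N(2)] AE_space by eventually_elim (auto simp: X'_def)
  qed
qed

text \<open>The values at the times \<open>T\<close> are partial sums of independent increments, almost surely, as the process
  starts at zero; the last increment is independent of them.\<close>
lemma expectation_past_increment:
  fixes G :: "(nat \<Rightarrow> real) \<Rightarrow> complex"
  assumes exponent: "has_char_exponent M X (\<lambda>\<xi>. complex_of_real (\<psi> \<xi>))"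
    and T: "0 < T 0" "\<And>i. i < n \<Longrightarrow> T i < T (Suc i)" "T n < t"
    and G [measurable]: "G \<in> borel_measurable (PiM {..n} (\<lambda>_. borel))"
    and bound: "\<And>z. norm (G z) \<le> K"
  shows "(CLINT \<omega>|M. G (\<lambda>j\<in>{..n}. X (T j) \<omega>) * iexp (\<zeta> * (X t \<omega> - X (T n) \<omega>))) =
    (CLINT \<omega>|M. G (\<lambda>j\<in>{..n}. X (T j) \<omega>)) * of_real (exp (- ((t - T n) * \<psi> \<zeta>)))"
proof -
  define S where "S j = (case j of 0 \<Rightarrow> 0 | Suc i \<Rightarrow> if i \<le> n then T i else t)" for j
  define D where "D i \<omega> = X (S (Suc i)) \<omega> - X (S i) \<omega>" for i \<omega>
  let ?S = "\<lambda>\<omega>. \<lambda>j\<in>{..n}. \<Sum>i\<le>j. restrict (\<lambda>i. D i \<omega>) {..n} i"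
  let ?Z = "\<lambda>\<omega>. \<lambda>j\<in>{..n}. X (T j) \<omega>"
  have T_pos: "0 < T i" if "i \<le> n" for i
    using that by (induction i) (use T in \<open>auto intro: less_trans\<close>)
  have t: "0 < t" using T_pos[of n] T(3) by simp
  have Xm [measurable]: "X t \<in> borel_measurable M" using t by (intro rv) simp
  have XT [measurable]: "X (T j) \<in> borel_measurable M" if "j \<le> n" for j
    using T_pos[OF that] by (intro rv) simp
  have S_less: "S i < S (Suc i)" if "i < n + 2" for i
  proof (cases i)
    case 0
    then show ?thesis using T(1) by (simp add: S_def)
  next
    case (Suc j)
    then have "j < n \<or> j = n" using that by auto
    then show ?thesis using T(2,3) by (auto simp: S_def Suc)
  qed
  have "indep_vars (\<lambda>_. borel) D {..<n + 2}"
    unfolding D_def by (rule indep_increments) (use S_less in \<open>auto simp: S_def\<close>)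
  then have "indep_var (PiM {..n} (\<lambda>_. borel)) (\<lambda>\<omega>. restrict (\<lambda>i. D i \<omega>) {..n})
      (PiM {Suc n} (\<lambda>_. borel)) (\<lambda>\<omega>. restrict (\<lambda>i. D i \<omega>) {Suc n})"
    by (rule indep_var_restrict) auto
  then have "indep_var borel ((\<lambda>z. G (\<lambda>j\<in>{..n}. \<Sum>i\<le>j. z i)) \<circ> (\<lambda>\<omega>. restrict (\<lambda>i. D i \<omega>) {..n}))
      borel ((\<lambda>z. iexp (\<zeta> * z (Suc n))) \<circ> (\<lambda>\<omega>. restrict (\<lambda>i. D i \<omega>) {Suc n}))"
  proof (rule indep_var_compose)
    have [measurable]: "(\<lambda>z. \<lambda>j\<in>{..n}. \<Sum>i\<le>j. z i) \<in>
        measurable (PiM {..n} (\<lambda>_. borel)) (PiM {..n} (\<lambda>_. borel :: real measure))"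
      by (intro measurable_restrict borel_measurable_sum measurable_component_singleton) auto
    show "(\<lambda>z. G (\<lambda>j\<in>{..n}. \<Sum>i\<le>j. z i)) \<in> borel_measurable (PiM {..n} (\<lambda>_. borel))"
      by measurable
    have [measurable]: "(\<lambda>z. z (Suc n)) \<in> borel_measurable (PiM {Suc n} (\<lambda>_. borel :: real measure))"
      by (rule measurable_component_singleton) auto
    show "(\<lambda>z. iexp (\<zeta> * z (Suc n))) \<in> borel_measurable (PiM {Suc n} (\<lambda>_. borel))"
      by measurable
  qed
  then have ind: "indep_var borel (\<lambda>\<omega>. G (?S \<omega>)) borel (\<lambda>\<omega>. iexp (\<zeta> * D (Suc n) \<omega>))"
    by (simp add: comp_def)
  have sum: "AE \<omega> in M. ?S \<omega> = ?Z \<omega>"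
    using start_zero
  proof eventually_elim
    fix \<omega> assume zero: "X 0 \<omega> = 0"
    show "?S \<omega> = ?Z \<omega>"
    proof (rule restrict_ext)
      fix j assume j: "j \<in> {..n}"
      have "(\<Sum>i\<le>j. restrict (\<lambda>i. D i \<omega>) {..n} i) = (\<Sum>i<Suc j. X (S (Suc i)) \<omega> - X (S i) \<omega>)"
        unfolding lessThan_Suc_atMost D_def using j by (intro sum.cong) auto
      also have "\<dots> = X (S (Suc j)) \<omega> - X (S 0) \<omega>" by (rule sum_lessThan_telescope)
      also have "\<dots> = X (T j) \<omega>" using j zero by (simp add: S_def)
      finally show "(\<Sum>i\<le>j. restrict (\<lambda>i. D i \<omega>) {..n} i) = X (T j) \<omega>" .
    qed
  qed
  have last: "D (Suc n) \<omega> = X t \<omega> - X (T n) \<omega>" for \<omega> by (simp add: D_def S_def)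
  have [measurable]: "(\<lambda>\<omega>. \<lambda>j\<in>{..n}. X (T j) \<omega>) \<in> measurable M (PiM {..n} (\<lambda>_. borel))"
    by (intro measurable_restrict XT) auto
  have m1: "(\<lambda>\<omega>. G (?S \<omega>)) \<in> borel_measurable M"
    using indep_var_rv1[OF ind] .
  have m2: "(\<lambda>\<omega>. iexp (\<zeta> * D (Suc n) \<omega>)) \<in> borel_measurable M"
    using indep_var_rv2[OF ind] .
  have i1: "integrable M (\<lambda>\<omega>. G (?S \<omega>))"
    by (rule integrable_const_bound[where B = K]) (use bound m1 in auto)
  have i2: "integrable M (\<lambda>\<omega>. iexp (\<zeta> * D (Suc n) \<omega>))"
    by (rule integrable_const_bound[where B = 1]) (use m2 in auto)
  have e1: "(CLINT \<omega>|M. G (?Z \<omega>)) = (CLINT \<omega>|M. G (?S \<omega>))"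
  proof (rule integral_cong_AE)
    show "AE \<omega> in M. G (?Z \<omega>) = G (?S \<omega>)"
      using sum by eventually_elim simp
  qed (use m1 in auto)
  have e2: "(CLINT \<omega>|M. G (?Z \<omega>) * iexp (\<zeta> * D (Suc n) \<omega>)) =
      (CLINT \<omega>|M. G (?S \<omega>) * iexp (\<zeta> * D (Suc n) \<omega>))"
  proof (rule integral_cong_AE)
    show "AE \<omega> in M. G (?Z \<omega>) * iexp (\<zeta> * D (Suc n) \<omega>) = G (?S \<omega>) * iexp (\<zeta> * D (Suc n) \<omega>)"
      using sum by eventually_elim simp
  qed (use m1 m2 in \<open>auto intro!: borel_measurable_times\<close>)
  have "(CLINT \<omega>|M. iexp (\<zeta> * D (Suc n) \<omega>)) =
      (CLINT x|distr M borel (\<lambda>\<omega>. X (T n + (t - T n)) \<omega> - X (T n) \<omega>). iexp (\<zeta> * x))"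
    unfolding last by (subst integral_distr) auto
  also have "\<dots> = char (distr M borel (X (t - T n))) \<zeta>"
    using T_pos[of n] T(3) unfolding char_def by (subst stationary_increments) auto
  also have "\<dots> = complex_of_real (exp (- ((t - T n) * \<psi> \<zeta>)))"
    using T(3) by (intro exponent_eq[OF exponent]) simp
  finally have e3: "(CLINT \<omega>|M. iexp (\<zeta> * D (Suc n) \<omega>)) = complex_of_real (exp (- ((t - T n) * \<psi> \<zeta>)))" .
  show ?thesis
    unfolding last[symmetric] e2 indep_var_lebesgue_integral[OF ind i1 i2] e3 e1 by (rule refl)
qed

text \<open>If the exponent vanished at all high frequencies, then \<open>\<theta> * X t\<close> would be a multiple of \<open>2 * pi\<close>
  almost surely for all these \<open>\<theta>\<close>, hence, by taking differences, for all small \<open>\<theta>\<close> as well. The process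
  would stay at zero and its occupation measure would have an atom there, which excludes a
  local time.\<close>
lemma exponent_unbounded_support:
  assumes exponent: "has_char_exponent M X (\<lambda>\<xi>. complex_of_real (\<psi> \<xi>))"
    and L: "jointly_continuous_local_time M X L"
  shows "\<exists>\<theta>>K. 0 < \<psi> \<theta>"
proof (rule ccontr)
  assume "\<not> (\<exists>\<theta>>K. 0 < \<psi> \<theta>)"
  then have zero: "\<psi> \<theta> = 0" if "\<theta> > K" for \<theta>
    using that exponent_nonneg[OF exponent, of \<theta>] by force
  have X_zero: "AE \<omega> in M. X t \<omega> = 0" if t: "0 \<le> t" for t
  proof -
    have [measurable]: "X t \<in> borel_measurable M" using t by (rule rv)
    have cos_1: "AE \<omega> in M. cos (\<theta> * X t \<omega>) = 1" if \<theta>: "\<theta> > K" for \<theta>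
    proof -
      have "(CLINT \<omega>|M. iexp (\<theta> * X t \<omega>)) = 1"
        using exponent_eq[OF exponent t, of \<theta>] zero[OF \<theta>]
        unfolding char_def by (subst (asm) integral_distr) auto
      moreover have i: "integrable M (\<lambda>\<omega>. iexp (\<theta> * X t \<omega>))"
        by (rule integrable_const_bound[where B = 1]) auto
      ultimately have "(LINT \<omega>|M. Re (iexp (\<theta> * X t \<omega>))) = 1"
        by (subst integral_Re) auto
      then have "(LINT \<omega>|M. 1 - cos (\<theta> * X t \<omega>)) = 0"
        using integrable_Re[OF i] by (subst Bochner_Integration.integral_diff) (auto simp: prob_space Re_exp)
      moreover have "integrable M (\<lambda>\<omega>. 1 - cos (\<theta> * X t \<omega>))"
        using integrable_Re[OF i] by (intro Bochner_Integration.integrable_diff) (auto simp: Re_exp)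
      ultimately have "AE \<omega> in M. 1 - cos (\<theta> * X t \<omega>) = 0"
        by (subst (asm) integral_nonneg_eq_0_iff_AE) auto
      then show ?thesis by eventually_elim simp
    qed
    have "AE \<omega> in M. cos (1 / real (Suc n) * X t \<omega>) = 1" for n
    proof -
      have "AE \<omega> in M. cos ((\<bar>K\<bar> + 1 + 1 / real (Suc n)) * X t \<omega>) = 1"
      proof (rule cos_1)
        have "0 < 1 / real (Suc n)" by simp
        then show "K < \<bar>K\<bar> + 1 + 1 / real (Suc n)" by linarith
      qed
      moreover have "AE \<omega> in M. cos ((\<bar>K\<bar> + 1) * X t \<omega>) = 1" by (rule cos_1) linarith
      ultimately show ?thesis
      proof eventually_elim
        case (elim \<omega>)
        let ?a = "(\<bar>K\<bar> + 1 + 1 / real (Suc n)) * X t \<omega>" and ?b = "(\<bar>K\<bar> + 1) * X t \<omega>"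
        have "sin ?b = 0" using elim(2) sin_cos_squared_add[of ?b] by simp
        then have "cos (?a - ?b) = 1" using elim by (simp add: cos_diff)
        moreover have "?a - ?b = 1 / real (Suc n) * X t \<omega>" by (simp add: distrib_right)
        ultimately show ?case by simp
      qed
    qed
    then have "AE \<omega> in M. \<forall>n. cos (1 / real (Suc n) * X t \<omega>) = 1"
      by (simp add: AE_all_countable)
    then show ?thesis
    proof eventually_elim
      case (elim \<omega>)
      obtain n where n: "\<bar>X t \<omega>\<bar> < real n" using reals_Archimedean2 by blast
      define y where "y = \<bar>1 / real (Suc n) * X t \<omega>\<bar>"
      have "y < 1" unfolding y_def using n by (simp add: abs_mult)
      then have "y < pi" using pi_gt3 by simp
      have "cos y = 1" using elim unfolding y_def cos_abs_real by blast
      have "y = 0"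
      proof (rule ccontr)
        assume "y \<noteq> 0"
        then have "0 < y" unfolding y_def by simp
        then have "cos y < cos 0" using \<open>y < pi\<close> by (intro cos_monotone_0_pi) auto
        then show False using \<open>cos y = 1\<close> by simp
      qed
      then show ?case unfolding y_def by simp
    qed
  qed
  have "AE \<omega> in M. \<forall>r::rat. 0 \<le> r \<longrightarrow> X (of_rat r) \<omega> = 0"
    unfolding AE_all_countable using X_zero by (auto intro!: AE_impI)
  moreover have "AE \<omega> in M. density lborel (\<lambda>x. ennreal (L x 1 \<omega>)) = occupation_measure X {0..1} \<omega>"
    using L unfolding jointly_continuous_local_time_def by auto
  moreover have "AE \<omega> in M. continuous_on (UNIV \<times> {0..}) (\<lambda>(x, t). L x t \<omega>)"
    using L unfolding jointly_continuous_local_time_def by auto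
  ultimately have "AE \<omega> in M. False"
    using cadlag_paths
  proof eventually_elim
    case (elim \<omega>)
    have zero: "X t \<omega> = 0" if t: "0 \<le> t" for t
    proof -
      have lim: "((\<lambda>s. X s \<omega>) \<longlongrightarrow> X t \<omega>) (at_right t)"
        using elim(4) t unfolding cadlag_def by (simp add: continuous_within)
      show ?thesis
      proof (rule ccontr)
        assume "X t \<omega> \<noteq> 0"
        then have "eventually (\<lambda>s. X s \<omega> \<noteq> 0) (at_right t)"
          using tendsto_imp_eventually_ne[OF lim] by auto
        then obtain b where b: "t < b" "\<And>s. t < s \<Longrightarrow> s < b \<Longrightarrow> X s \<omega> \<noteq> 0"
          unfolding eventually_at_right_field by blast
        obtain r where "t < of_rat r" "of_rat r < b" using of_rat_dense[OF b(1)] by blast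
        moreover from this have "0 \<le> r" using t by (metis less_eq_real_def order_less_le_trans order_less_imp_le zero_le_of_rat_iff)
        ultimately show False using b(2) elim(1) by blast
      qed
    qed
    have "(\<lambda>t. X t \<omega>) \<in> borel_measurable (restrict_space lborel {0..1}) \<longleftrightarrow>
        (\<lambda>t :: real. 0 :: real) \<in> borel_measurable (restrict_space lborel {0..1})"
      by (rule measurable_cong) (auto simp: space_restrict_space zero)
    then have m: "(\<lambda>t. X t \<omega>) \<in> borel_measurable (restrict_space lborel {0..1})" by simp
    have "emeasure (occupation_measure X {0..1} \<omega>) {0} =
        emeasure (restrict_space lborel {0..1}) ((\<lambda>t. X t \<omega>) -` {0} \<inter> space (restrict_space lborel {0..1}))"
      unfolding occupation_measure_def using m by (intro emeasure_distr) auto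
    also have "(\<lambda>t. X t \<omega>) -` {0} \<inter> space (restrict_space lborel {0..1}) = {0..1}"
      by (auto simp: space_restrict_space zero)
    also have "emeasure (restrict_space lborel {0..1::real}) {0..1} = 1"
      by (subst emeasure_restrict_space) auto
    finally have "emeasure (density lborel (\<lambda>x. ennreal (L x 1 \<omega>))) {0} = 1" using elim(2) by simp
    moreover have "emeasure (density lborel (\<lambda>x. ennreal (L x 1 \<omega>))) {0} = 0"
    proof -
      have "continuous_on UNIV (\<lambda>x. L x 1 \<omega>)"
        using elim(3) by (rule continuous_local_time_slice) simp
      then have [measurable]: "(\<lambda>x. L x 1 \<omega>) \<in> borel_measurable borel"
        by (rule borel_measurable_continuous_onI)
      have "emeasure (density lborel (\<lambda>x. ennreal (L x 1 \<omega>))) {0} =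
          (\<integral>\<^sup>+x. ennreal (L x 1 \<omega>) * indicator {0} x \<partial>lborel)"
        by (rule emeasure_density) auto
      also have "\<dots> = (\<integral>\<^sup>+x. 0 \<partial>(lborel :: real measure))"
      proof (rule nn_integral_cong_AE)
        show "AE x in lborel. ennreal (L x 1 \<omega>) * indicator {0} x = 0"
          using AE_lborel_singleton[of 0] by eventually_elim simp
      qed
      finally show ?thesis by simp
    qed
    ultimately show False by simp
  qed
  then show False by simp
qed

end

section \<open>Tails of local times\<close>

locale levy_local_time = levy_process +
  fixes \<psi> :: "real \<Rightarrow> real" and L :: "real \<Rightarrow> real \<Rightarrow> 'a \<Rightarrow> real" and \<alpha> \<theta>\<^sub>1 c :: real
  assumes exponent: "has_char_exponent M X (\<lambda>\<xi>. complex_of_real (\<psi> \<xi>))"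
    and L: "jointly_continuous_local_time M X L"
    and \<alpha>: "1 < \<alpha>" and lower: "\<psi> \<in> WLSC \<alpha> \<theta>\<^sub>1 c"
begin

text \<open>The lower scaling condition, started from one frequency at which the exponent is positive, gives a
  lower bound of order \<open>\<bar>\<xi>\<bar> powr \<alpha>\<close> at all higher frequencies.\<close>
lemma stable_paths_version:
  obtains X' c\<^sub>0 where "stable_paths M X' \<psi> \<alpha> c\<^sub>0" "AE \<omega> in M. \<forall>t\<ge>0. X' t \<omega> = X t \<omega>"
proof -
  obtain X' where X': "\<And>t. X' t \<in> borel_measurable M"
    "\<And>t \<omega>. ((\<lambda>s. X' s \<omega>) \<longlongrightarrow> X' t \<omega>) (at_right t)"
    "AE \<omega> in M. \<forall>t\<ge>0. X' t \<omega> = X t \<omega>"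
    using right_continuous_version by blast
  have c: "0 \<le> \<theta>\<^sub>1" "0 < c" and scale: "\<And>l \<theta>. \<lbrakk>1 \<le> l; \<theta>\<^sub>1 < \<theta>\<rbrakk> \<Longrightarrow> c * l powr \<alpha> * \<psi> \<theta> \<le> \<psi> (l * \<theta>)"
    using lower unfolding WLSC_def by auto
  note nonneg = exponent_nonneg[OF exponent]
  obtain \<theta> where \<theta>: "\<theta>\<^sub>1 < \<theta>" "0 < \<psi> \<theta>"
    using exponent_unbounded_support[OF exponent L] by blast
  then have \<theta>_pos: "0 < \<theta>" using c by simp
  define a where "a = c * \<psi> \<theta> / \<theta> powr \<alpha>"
  have a: "0 < a" using c \<theta> \<theta>_pos unfolding a_def by simp
  have large: "a * x powr \<alpha> \<le> \<psi> x" if x: "\<theta> \<le> x" for x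
    using scale[of "x / \<theta>" \<theta>] x \<theta> \<theta>_pos unfolding a_def by (simp add: powr_divide mult_ac)
  define c\<^sub>0 where "c\<^sub>0 = min (min 1 a) (1 / (1 + \<theta> powr \<alpha>))"
  have c\<^sub>0: "0 < c\<^sub>0" "c\<^sub>0 \<le> 1" "c\<^sub>0 \<le> a" "c\<^sub>0 \<le> 1 / (1 + \<theta> powr \<alpha>)"
    using a unfolding c\<^sub>0_def by (auto intro!: divide_pos_pos add_pos_nonneg)
  have bound_nn: "c\<^sub>0 * (1 + x powr \<alpha>) \<le> 1 + \<psi> x" if "0 \<le> x" for x
  proof (cases "x \<le> \<theta>")
    case True
    have "c\<^sub>0 * (1 + x powr \<alpha>) \<le> 1 / (1 + \<theta> powr \<alpha>) * (1 + \<theta> powr \<alpha>)"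
      using c\<^sub>0 True that \<alpha> by (intro mult_mono add_left_mono powr_mono2) auto
    also have "\<dots> = 1" by (simp add: add_pos_nonneg order_less_imp_not_eq2)
    finally show ?thesis using nonneg[of x] by simp
  next
    case False
    have "c\<^sub>0 * (1 + x powr \<alpha>) = c\<^sub>0 + c\<^sub>0 * x powr \<alpha>" by (simp add: distrib_left)
    also have "\<dots> \<le> 1 + a * x powr \<alpha>" using c\<^sub>0 by (intro add_mono mult_right_mono) auto
    also have "\<dots> \<le> 1 + \<psi> x" using large[of x] False by simp
    finally show ?thesis .
  qed
  have bound: "c\<^sub>0 * (1 + \<bar>\<xi>\<bar> powr \<alpha>) \<le> 1 + \<psi> \<xi>" for \<xi>
    using bound_nn[of "\<bar>\<xi>\<bar>"] exponent_even[OF exponent, of \<xi>] by (cases "0 \<le> \<xi>") auto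
  have "stable_paths M X' \<psi> \<alpha> c\<^sub>0"
  proof unfold_locales
    fix T :: "nat \<Rightarrow> real" and n t and G :: "(nat \<Rightarrow> real) \<Rightarrow> complex" and K \<zeta>
    assume T: "0 < T 0" "\<And>i. i < n \<Longrightarrow> T i < T (Suc i)" "T n < t"
      and G [measurable]: "G \<in> borel_measurable (PiM {..n} (\<lambda>_. borel))"
      and bound: "\<And>z. norm (G z) \<le> K"
    have T_pos: "0 < T i" if "i \<le> n" for i
      using that by (induction i) (use T in \<open>auto intro: less_trans\<close>)
    have t: "0 < t" using T_pos[of n] T(3) by simp
    have [measurable]: "X t \<in> borel_measurable M" using t by (intro rv) simp
    have XT [measurable]: "X (T j) \<in> borel_measurable M" if "j \<le> n" for j
      using T_pos[OF that] by (intro rv) simp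
    have [measurable]: "(\<lambda>\<omega>. \<lambda>j\<in>{..n}. X (T j) \<omega>) \<in> measurable M (PiM {..n} (\<lambda>_. borel))"
      by (intro measurable_restrict XT) auto
    have [measurable]: "(\<lambda>\<omega>. \<lambda>j\<in>{..n}. X' (T j) \<omega>) \<in> measurable M (PiM {..n} (\<lambda>_. borel))"
      by (intro measurable_restrict X')
    note [measurable] = X'(1)
    have eq: "AE \<omega> in M. (\<lambda>j\<in>{..n}. X' (T j) \<omega>) = (\<lambda>j\<in>{..n}. X (T j) \<omega>) \<and>
        X' t \<omega> = X t \<omega> \<and> X' (T n) \<omega> = X (T n) \<omega>"
      using X'(3)
    proof eventually_elim
      case (elim \<omega>)
      have "X' (T j) \<omega> = X (T j) \<omega>" if "j \<le> n" for j
        using elim T_pos[OF that] by (simp add: less_imp_le)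
      then show ?case using elim t by (auto simp: restrict_def)
    qed
    have "(CLINT \<omega>|M. G (\<lambda>j\<in>{..n}. X' (T j) \<omega>) * iexp (\<zeta> * (X' t \<omega> - X' (T n) \<omega>))) =
        (CLINT \<omega>|M. G (\<lambda>j\<in>{..n}. X (T j) \<omega>) * iexp (\<zeta> * (X t \<omega> - X (T n) \<omega>)))"
    proof (rule integral_cong_AE)
      show "AE \<omega> in M. G (\<lambda>j\<in>{..n}. X' (T j) \<omega>) * iexp (\<zeta> * (X' t \<omega> - X' (T n) \<omega>)) =
          G (\<lambda>j\<in>{..n}. X (T j) \<omega>) * iexp (\<zeta> * (X t \<omega> - X (T n) \<omega>))"
        using eq by eventually_elim simp
    qed (use XT[of n] in auto)
    also have "\<dots> = (CLINT \<omega>|M. G (\<lambda>j\<in>{..n}. X (T j) \<omega>)) * of_real (exp (- ((t - T n) * \<psi> \<zeta>)))"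
      by (rule expectation_past_increment[OF exponent T G bound])
    also have "(CLINT \<omega>|M. G (\<lambda>j\<in>{..n}. X (T j) \<omega>)) = (CLINT \<omega>|M. G (\<lambda>j\<in>{..n}. X' (T j) \<omega>))"
    proof (rule integral_cong_AE)
      show "AE \<omega> in M. G (\<lambda>j\<in>{..n}. X (T j) \<omega>) = G (\<lambda>j\<in>{..n}. X' (T j) \<omega>)"
        using eq by eventually_elim simp
    qed auto
    finally show "(CLINT \<omega>|M. G (\<lambda>j\<in>{..n}. X' (T j) \<omega>) * iexp (\<zeta> * (X' t \<omega> - X' (T n) \<omega>))) =
        (CLINT \<omega>|M. G (\<lambda>j\<in>{..n}. X' (T j) \<omega>)) * of_real (exp (- ((t - T n) * \<psi> \<zeta>)))" .
  qed (use X' exponent_measurable[OF exponent] nonneg \<alpha> c\<^sub>0 bound in auto)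
  then show ?thesis using that X'(3) by blast
qed

end

context stable_paths
begin

text \<open>The local time belongs to a given process \<open>Y\<close>, the moment bounds to its right-continuous version
  \<open>X\<close>; both have the same path at the sample point \<open>\<omega>\<close>.\<close>
lemma smoothed_tendsto_local_time:
  assumes \<omega>: "\<omega> \<in> space M" and eq: "\<forall>t\<ge>0. X t \<omega> = Y t \<omega>" and ab: "0 \<le> a" "a < b"
    and L: "continuous_on (UNIV \<times> {0..}) (\<lambda>(x, t). L x t \<omega>)" "\<forall>t\<ge>0. (\<forall>x. 0 \<le> L x t \<omega>) \<and>
           density lborel (\<lambda>x. ennreal (L x t \<omega>)) = occupation_measure Y {0..t} \<omega>"
  shows "(\<lambda>n. smoothed (1 / real (Suc n)) a b \<omega> x) \<longlonglongrightarrow> L x b \<omega> - L x a \<omega>"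
proof -
  let ?\<phi> = "\<lambda>n r. normal_density 0 (1 / real (Suc n)) (X r \<omega> - x)"
  have Xm: "(\<lambda>t. X t \<omega>) \<in> borel_measurable borel"
    using \<omega> by measurable
  have lim: "(\<lambda>n. LINT r|lborel. indicator {0..t} r * ?\<phi> n r) \<longlonglongrightarrow> L x t \<omega>" if t: "0 \<le> t" for t
  proof (rule occupation_density_limit[where l = "\<lambda>x. L x t \<omega>"])
    show "(\<lambda>t. X t \<omega>) \<in> borel_measurable (restrict_space lborel {0..t})"
      using Xm by (intro measurable_restrict_space1) simp
    show "continuous_on UNIV (\<lambda>x. L x t \<omega>)" using L(1) t by (rule continuous_local_time_slice)
    show "0 \<le> L x t \<omega>" for x using L(2) t by simp
    have "occupation_measure Y {0..t} \<omega> = distr (restrict_space lborel {0..t}) borel (\<lambda>t. X t \<omega>)"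
      unfolding occupation_measure_def
      by (intro distr_cong) (auto simp: space_restrict_space eq)
    then show "density lborel (\<lambda>x. ennreal (L x t \<omega>)) = distr (restrict_space lborel {0..t}) borel (\<lambda>t. X t \<omega>)"
      using L(2) t by simp
  qed (rule t)
  have "smoothed (1 / real (Suc n)) a b \<omega> x =
      (LINT r|lborel. indicator {0..b} r * ?\<phi> n r) - (LINT r|lborel. indicator {0..a} r * ?\<phi> n r)" for n
  proof -
    have \<sigma>: "0 < 1 / real (Suc n)" by simp
    have int: "integrable lborel (\<lambda>r. indicator {0..t} r * ?\<phi> n r)" for t
      using normal_density_le[OF \<sigma>]
      by (intro integrable_along_path[OF \<omega>, where f = "\<lambda>z. normal_density 0 (1 / real (Suc n)) (z - x)"
            and B = "normal_density 0 (1 / real (Suc n)) 0"]) auto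
    have "smoothed (1 / real (Suc n)) a b \<omega> x =
        (LINT r|lborel. indicator {0..b} r * ?\<phi> n r - indicator {0..a} r * ?\<phi> n r)"
      unfolding smoothed_def additive_def
    proof (rule integral_cong_AE)
      show "AE r in lborel. indicator {a..b} r * ?\<phi> n r = indicator {0..b} r * ?\<phi> n r - indicator {0..a} r * ?\<phi> n r"
        using AE_lborel_singleton[of a]
        by eventually_elim (use ab in \<open>auto split: split_indicator\<close>)
    qed (use Xm in \<open>measurable\<close>)
    then show ?thesis using int by simp
  qed
  then show ?thesis using lim[of b] lim[of a] ab by (simp add: tendsto_diff)
qed

end

lemma (in finite_measure) measure_liminf_le:
  fixes A :: "nat \<Rightarrow> 'a set"
  assumes A: "\<And>n. A n \<in> sets M" and le: "\<And>n. measure M (A n) \<le> c"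
  shows "measure M (\<Union>m. \<Inter>n\<in>{m..}. A n) \<le> c"
proof (rule LIMSEQ_le_const2)
  let ?B = "\<lambda>m::nat. \<Inter>n\<in>{m..}. A n"
  have B: "?B m \<in> sets M" for m using A by (intro sets.countable_INT) auto
  show "(\<lambda>m. measure M (?B m)) \<longlonglongrightarrow> measure M (\<Union>m. ?B m)"
    by (rule finite_Lim_measure_incseq) (use B in \<open>auto simp: incseq_def\<close>)
  have "measure M (?B m) \<le> c" for m
    using finite_measure_mono[of "?B m" "A m"] A le[of m] by (auto intro: order_trans)
  then show "\<exists>N. \<forall>n\<ge>N. measure M (?B n) \<le> c" by blast
qed

context levy_local_time
begin

text \<open>The local time is the limit of mollified occupation times, which are nonnegative on every time
  interval.\<close>
lemma local_time_mono:
  shows "AE \<omega> in M. \<forall>x a b. 0 \<le> a \<longrightarrow> a \<le> b \<longrightarrow> L x a \<omega> \<le> L x b \<omega>"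
proof -
  obtain X' c\<^sub>0 where sp: "stable_paths M X' \<psi> \<alpha> c\<^sub>0" and eq: "AE \<omega> in M. \<forall>t\<ge>0. X' t \<omega> = X t \<omega>"
    using stable_paths_version by blast
  interpret S: stable_paths M X' \<psi> \<alpha> c\<^sub>0 by (rule sp)
  from L have "AE \<omega> in M. continuous_on (UNIV \<times> {0..}) (\<lambda>(x, t). L x t \<omega>) \<and>
        (\<forall>t\<ge>0. (\<forall>x. 0 \<le> L x t \<omega>) \<and>
           density lborel (\<lambda>x. ennreal (L x t \<omega>)) = occupation_measure X {0..t} \<omega>)"
    unfolding jointly_continuous_local_time_def by blast
  then show ?thesis using eq AE_space
  proof eventually_elim
    case (elim \<omega>)
    have "L x a \<omega> \<le> L x b \<omega>" if ab: "0 \<le> a" "a < b" for x a b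
    proof -
      have lim: "(\<lambda>n. S.smoothed (1 / real (Suc n)) a b \<omega> x) \<longlonglongrightarrow> L x b \<omega> - L x a \<omega>"
        by (rule S.smoothed_tendsto_local_time[where Y = X]) (use elim ab in auto)
      have "0 \<le> L x b \<omega> - L x a \<omega>"
      proof (rule LIMSEQ_le_const[OF lim])
        show "\<exists>N. \<forall>n\<ge>N. 0 \<le> S.smoothed (1 / real (Suc n)) a b \<omega> x"
          unfolding S.smoothed_def S.additive_def
          by (intro exI[of _ 0] allI impI integral_nonneg_AE AE_I2) simp
      qed
      then show ?thesis by simp
    qed
    then show ?case by (metis order_le_less order_refl)
  qed
qed

definition increment_tail :: "real \<Rightarrow> nat \<Rightarrow> real \<Rightarrow> real \<Rightarrow> 'a set \<Rightarrow> bool" where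
  "increment_tail \<Lambda> p a b E \<longleftrightarrow> E \<in> sets M \<and> prob E \<le> exp (- real p) \<and> (AE \<omega> in M. \<omega> \<notin> E \<longrightarrow>
     (\<forall>x. L x b \<omega> - L x a \<omega> \<le> \<Lambda> * (b - a) powr (1 - 1 / \<alpha>) * real p powr (1 / \<alpha>)))"

text \<open>The choice \<open>q = p / (b - a)\<close> balances the loss \<open>exp (q * (b - a))\<close> of the Laplace transform against
  the factor \<open>p ! \<approx> p ^ p\<close> of the moments. The exceptional set is the lower limit, over the mollification
  parameter, of the exceptional sets of \<open>smoothed_tail\<close>: off this set infinitely many mollifications
  satisfy the bound, hence so does their limit.\<close>
lemma local_time_tail:
  obtains \<Lambda> p\<^sub>0 where "0 < \<Lambda>"
    "\<And>p a b. \<lbrakk>even p; 0 < p; p\<^sub>0 \<le> real p; 0 \<le> a; a < b; b - a \<le> 1\<rbrakk> \<Longrightarrow> \<exists>E. increment_tail \<Lambda> p a b E"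
proof -
  obtain X' c\<^sub>0 where sp: "stable_paths M X' \<psi> \<alpha> c\<^sub>0" and eq: "AE \<omega> in M. \<forall>t\<ge>0. X' t \<omega> = X t \<omega>"
    using stable_paths_version by blast
  interpret S: stable_paths M X' \<psi> \<alpha> c\<^sub>0 by (rule sp)
  obtain \<Lambda> where \<Lambda>: "0 < \<Lambda>" and tail: "\<And>\<sigma> p a b q. \<lbrakk>0 < \<sigma>; even p; 0 < p; 4 / S.\<gamma> \<le> real p; 0 \<le> a; a < b; 1 \<le> q; q * (b - a) \<le> real p\<rbrakk> \<Longrightarrow>
      \<exists>E\<in>sets M. prob E \<le> exp (- real p) \<and>
        (\<forall>\<omega>\<in>space M - E. \<forall>x. S.smoothed \<sigma> a b \<omega> x \<le> \<Lambda> * real p * q powr (- (1 - 1 / \<alpha>)))"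
    by (rule S.smoothed_tail) blast
  show ?thesis
  proof (rule that[OF \<Lambda>, of "4 / S.\<gamma>"])
    fix p :: nat and a b :: real
    assume p: "even p" "0 < p" "4 / S.\<gamma> \<le> real p" and ab: "0 \<le> a" "a < b" "b - a \<le> 1"
    define q where "q = real p / (b - a)"
    define K where "K = \<Lambda> * real p * q powr (- (1 - 1 / \<alpha>))"
    have q: "1 \<le> q" "q * (b - a) \<le> real p"
      using p ab unfolding q_def by (auto simp: pos_le_divide_eq)
    have "q powr (- (1 - 1 / \<alpha>)) = (b - a) powr (1 - 1 / \<alpha>) * real p powr (- (1 - 1 / \<alpha>))"
      using p ab unfolding q_def by (simp add: powr_divide powr_minus_divide powr_diff field_simps)
    moreover have "real p * real p powr (- (1 - 1 / \<alpha>)) = real p powr (1 / \<alpha>)"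
      using p by (simp add: powr_mult_base)
    ultimately have K: "K = \<Lambda> * (b - a) powr (1 - 1 / \<alpha>) * real p powr (1 / \<alpha>)"
      unfolding K_def by (metis mult.assoc mult.commute)
    have "\<forall>n. \<exists>E\<in>sets M. prob E \<le> exp (- real p) \<and>
        (\<forall>\<omega>\<in>space M - E. \<forall>x. S.smoothed (1 / real (Suc n)) a b \<omega> x \<le> K)"
      unfolding K_def using tail[OF _ p ab(1,2) q] by simp
    then obtain E where E: "\<And>n. E n \<in> sets M" "\<And>n. prob (E n) \<le> exp (- real p)"
        "\<And>n \<omega> x. \<omega> \<in> space M - E n \<Longrightarrow> S.smoothed (1 / real (Suc n)) a b \<omega> x \<le> K"
      unfolding Bex_def by metis
    let ?E = "\<Union>m. \<Inter>n\<in>{m..}. E n"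
    have "?E \<in> sets M" using E(1) by (intro sets.countable_UN sets.countable_INT image_subsetI) auto
    moreover have "prob ?E \<le> exp (- real p)" by (rule measure_liminf_le[OF E(1,2)])
    moreover have "AE \<omega> in M. \<omega> \<notin> ?E \<longrightarrow> (\<forall>x. L x b \<omega> - L x a \<omega> \<le> K)"
    proof -
      from L have "AE \<omega> in M. continuous_on (UNIV \<times> {0..}) (\<lambda>(x, t). L x t \<omega>) \<and>
            (\<forall>t\<ge>0. (\<forall>x. 0 \<le> L x t \<omega>) \<and>
               density lborel (\<lambda>x. ennreal (L x t \<omega>)) = occupation_measure X {0..t} \<omega>)"
        unfolding jointly_continuous_local_time_def by blast
      then show ?thesis using eq AE_space
      proof eventually_elim
        case (elim \<omega>)
        show ?case
        proof (intro impI allI, rule ccontr)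
          fix x
          assume notin: "\<omega> \<notin> ?E" and "\<not> L x b \<omega> - L x a \<omega> \<le> K"
          then have gt: "K < L x b \<omega> - L x a \<omega>" by simp
          have "(\<lambda>n. S.smoothed (1 / real (Suc n)) a b \<omega> x) \<longlonglongrightarrow> L x b \<omega> - L x a \<omega>"
            by (rule S.smoothed_tendsto_local_time[where Y = X]) (use elim ab in auto)
          from order_tendstoD(1)[OF this gt]
          obtain m where m: "\<And>n. n \<ge> m \<Longrightarrow> K < S.smoothed (1 / real (Suc n)) a b \<omega> x"
            unfolding eventually_sequentially by blast
          obtain n where "n \<ge> m" "\<omega> \<notin> E n" using notin by auto
          then show False using m[of n] E(3)[of \<omega> n x] elim by auto
        qed
      qed
    qed
    ultimately show "\<exists>E. increment_tail \<Lambda> p a b E"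
      unfolding increment_tail_def K by blast
  qed
qed

end

section \<open>Limsup laws\<close>

lemma dyadic_scale:
  fixes r :: real
  assumes "0 < r" "r \<le> 1 / 2 ^ m"
  obtains n where "m \<le> n" "1 / 2 ^ Suc n < r" "r \<le> 1 / 2 ^ n"
proof -
  obtain k where k: "(1 / 2) ^ k < r" using real_arch_pow_inv[OF assms(1), of "1 / 2"] by auto
  define n where "n = (LEAST k. (1 / 2) ^ k < r)"
  have n: "(1 / 2) ^ n < r" unfolding n_def by (rule LeastI[of _ k]) (rule k)
  have "m < n"
  proof (rule ccontr)
    assume "\<not> m < n"
    then have "(1 / 2 :: real) ^ m \<le> (1 / 2) ^ n" by (intro power_decreasing) auto
    then show False using n assms(2) by (simp add: power_one_over)
  qed
  then obtain k' where k': "n = Suc k'" by (cases n) auto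
  have "\<not> (1 / 2) ^ k' < r" using not_less_Least[of k' "\<lambda>k. (1 / 2) ^ k < r"] k' unfolding n_def by auto
  then show ?thesis
    using that[of k'] n \<open>m < n\<close> unfolding k' by (simp add: power_one_over)
qed

lemma interval_length_le:
  fixes I :: "real set"
  assumes I: "is_interval I" "I \<noteq> {}" "I \<subseteq> {0..N}"
  shows "Sup I - Inf I \<le> measure lborel I" "0 \<le> Inf I" "Inf I \<le> Sup I"
proof -
  have bdd: "bdd_below I" "bdd_above I" using I(3) by (auto intro: bdd_below_mono bdd_above_mono)
  show le: "Inf I \<le> Sup I" using I(2) bdd by (intro cInf_le_cSup)
  show "0 \<le> Inf I" using I(2,3) by (intro cInf_greatest) auto
  have sub: "{Inf I<..<Sup I} \<subseteq> I"
  proof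
    fix x assume x: "x \<in> {Inf I<..<Sup I}"
    obtain a where "a \<in> I" "a < x" using x I(2) bdd by (auto simp: cInf_less_iff)
    moreover obtain b where "b \<in> I" "x < b" using x I(2) bdd by (auto simp: less_cSup_iff)
    ultimately show "x \<in> I" using I(1) by (meson less_imp_le mem_is_interval_1_I)
  qed
  have "measure lborel {Inf I<..<Sup I} \<le> measure lborel I"
  proof (rule measure_mono_fmeasurable[OF sub])
    have "I \<in> sets lborel" using real_interval_borel_measurable[OF I(1)] by simp
    moreover have "emeasure lborel I \<le> emeasure lborel {0..N}"
      using I(3) by (intro emeasure_mono) auto
    moreover have "emeasure lborel {0..N} < \<infinity>" by (simp add: emeasure_lborel_Icc_eq)
    ultimately show "I \<in> fmeasurable lborel" by (auto intro: fmeasurableI)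
  qed simp
  then show "Sup I - Inf I \<le> measure lborel I" using le by simp
qed

lemma max_local_time_le:
  assumes "\<And>x. L x (Sup I) \<omega> - L x (Inf I) \<omega> \<le> B" "0 \<le> B"
  shows "max_local_time L I \<omega> \<le> ereal B"
  unfolding max_local_time_def local_time_on_def using assms by (auto intro!: SUP_least)

lemma ereal_quotient_le:
  assumes "m \<le> ereal (K * D)" "0 < D"
  shows "m / ereal D \<le> ereal K"
  using assms by (subst ereal_divide_le_pos) (auto simp: mult.commute)

lemma (in prob_space) borel_cantelli_exp:
  fixes p :: "nat \<Rightarrow> real"
  assumes E: "\<And>n. n \<ge> n\<^sub>0 \<Longrightarrow> E n \<in> sets M" and le: "\<And>n. n \<ge> n\<^sub>0 \<Longrightarrow> prob (E n) \<le> p n" and sum: "summable p"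
  shows "AE \<omega> in M. \<exists>m. \<forall>n\<ge>m. \<omega> \<notin> E n"
proof -
  have "AE \<omega> in M. eventually (\<lambda>n. \<omega> \<in> space M - E (n + n\<^sub>0)) sequentially"
  proof (rule borel_cantelli_AE1)
    show "summable (\<lambda>n. measure M (E (n + n\<^sub>0)))"
      by (rule summable_comparison_test'[OF summable_ignore_initial_segment[OF sum, of n\<^sub>0]]) (use le in auto)
  qed (use E in \<open>auto simp: emeasure_eq_measure\<close>)
  then show ?thesis
  proof eventually_elim
    case (elim \<omega>)
    then obtain m where m: "\<And>n. n \<ge> m \<Longrightarrow> \<omega> \<notin> E (n + n\<^sub>0)" unfolding eventually_sequentially by auto
    have "\<omega> \<notin> E n" if "n \<ge> m + n\<^sub>0" for n using m[of "n - n\<^sub>0"] that by auto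
    then show ?case by blast
  qed
qed

context levy_local_time
begin

text \<open>Along \<open>r = 2 ^ (- n)\<close> the probabilities \<open>exp (- p)\<close> with \<open>p \<ge> 2 * ln n\<close> are summable, and monotonicity
  of the local time in the time interval interpolates between the scales.\<close>
lemma local_time_iterated_log:
  assumes \<tau>: "0 < \<tau>"
  shows "AE \<omega> in M. Limsup (at_right 0) (\<lambda>r. max_local_time L {\<tau> - r..\<tau> + r} \<omega> /
              ereal (r powr (1 - 1 / \<alpha>) * ln (ln (1 / r)) powr (1 / \<alpha>))) < \<infinity>"
proof -
  let ?ratio = "\<lambda>\<omega> r. max_local_time L {\<tau> - r..\<tau> + r} \<omega> / ereal (r powr (1 - 1 / \<alpha>) * ln (ln (1 / r)) powr (1 / \<alpha>))"
  obtain \<Lambda> p\<^sub>0 where \<Lambda>: "0 < \<Lambda>" and tail: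
    "\<And>p a b. \<lbrakk>even p; 0 < p; p\<^sub>0 \<le> real p; 0 \<le> a; a < b; b - a \<le> 1\<rbrakk> \<Longrightarrow> \<exists>E. increment_tail \<Lambda> p a b E"
    using local_time_tail by blast
  define p where "p n = 2 * nat \<lceil>ln (real n)\<rceil>" for n
  have p_ge: "2 * ln (real n) \<le> real (p n)" for n
    unfolding p_def using real_nat_ceiling_ge[of "ln (real n)"] by simp
  have p_le: "real (p n) \<le> 4 * ln (real n)" if "3 \<le> n" for n
  proof -
    have "exp 1 \<le> real n" using exp_le that by linarith
    then have 1: "1 \<le> ln (real n)" using that by (subst ln_ge_iff) auto
    then have "real (nat \<lceil>ln (real n)\<rceil>) \<le> ln (real n) + 1" by linarith
    then have "2 * real (nat \<lceil>ln (real n)\<rceil>) \<le> 4 * ln (real n)" using 1 by linarith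
    then show ?thesis unfolding p_def by (simp only: of_nat_mult of_nat_numeral)
  qed
  define h where "h n = (1 / 2 ^ n :: real)" for n :: nat
  have "eventually (\<lambda>n. h n < min \<tau> (1 / 2)) sequentially"
  proof -
    have "h \<longlonglongrightarrow> 0"
      unfolding h_def using LIMSEQ_inverse_realpow_zero[of 2] by (simp add: divide_inverse)
    then show ?thesis using \<tau> by (intro order_tendstoD(2)) auto
  qed
  moreover have "eventually (\<lambda>n. p\<^sub>0 + 1 < ln (real n)) sequentially"
    using filterlim_compose[OF ln_at_top filterlim_real_sequentially]
    unfolding filterlim_at_top_dense by simp
  ultimately have "eventually (\<lambda>n. h n < min \<tau> (1 / 2) \<and> p\<^sub>0 + 1 < ln (real n) \<and> 4 \<le> n) sequentially"
    using eventually_ge_at_top[of "4::nat"] by eventually_elim simp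
  then obtain n\<^sub>0 where n\<^sub>0: "\<And>n. n \<ge> n\<^sub>0 \<Longrightarrow> h n < min \<tau> (1 / 2) \<and> p\<^sub>0 + 1 < ln (real n) \<and> 4 \<le> n"
    unfolding eventually_sequentially by blast
  have ex: "\<exists>E. increment_tail \<Lambda> (p n) (\<tau> - h n) (\<tau> + h n) E" if n: "n \<ge> n\<^sub>0" for n
  proof (rule tail)
    have pos: "0 < ln (real n)" using n\<^sub>0[OF n] by (intro ln_gt_zero) auto
    have h: "0 < h n" unfolding h_def by simp
    have "0 < real (p n)" "p\<^sub>0 \<le> real (p n)"
      using p_ge[of n] pos n\<^sub>0[OF n] by linarith+
    then show "0 < p n" "p\<^sub>0 \<le> real (p n)" by simp_all
    show "even (p n)" unfolding p_def by simp
    show "0 \<le> \<tau> - h n" "\<tau> - h n < \<tau> + h n" "\<tau> + h n - (\<tau> - h n) \<le> 1"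
      using h n\<^sub>0[OF n] by auto
  qed
  define E where "E n = (SOME E. increment_tail \<Lambda> (p n) (\<tau> - h n) (\<tau> + h n) E)" for n
  have E_tail: "increment_tail \<Lambda> (p n) (\<tau> - h n) (\<tau> + h n) (E n)" if "n \<ge> n\<^sub>0" for n
    unfolding E_def by (rule someI_ex[OF ex[OF that]])
  have length: "\<tau> + h n - (\<tau> - h n) = 2 * h n" for n by simp
  note E = E_tail[unfolded increment_tail_def length, THEN conjunct1]
    E_tail[unfolded increment_tail_def length, THEN conjunct2, THEN conjunct1]
    E_tail[unfolded increment_tail_def length, THEN conjunct2, THEN conjunct2]
  have "AE \<omega> in M. \<exists>m. \<forall>n\<ge>m. \<omega> \<notin> E n"
  proof (rule borel_cantelli_exp)
    show "prob (E n) \<le> inverse (real n ^ 2)" if n: "n \<ge> n\<^sub>0" for n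
    proof -
      have "exp (- real (p n)) \<le> exp (- (2 * ln (real n)))" using p_ge[of n] by simp
      also have "\<dots> = inverse (real n ^ 2)"
        using n\<^sub>0[OF n] by (simp add: exp_minus exp_double)
      finally show ?thesis using E(2)[OF n] by simp
    qed
    show "summable (\<lambda>n. inverse (real n ^ 2))" by (rule inverse_power_summable) simp
  qed (use E(1) in auto)
  moreover have "AE \<omega> in M. \<forall>n. n \<ge> n\<^sub>0 \<longrightarrow> \<omega> \<notin> E n \<longrightarrow>
        (\<forall>x. L x (\<tau> + h n) \<omega> - L x (\<tau> - h n) \<omega> \<le> \<Lambda> * (2 * h n) powr (1 - 1 / \<alpha>) * real (p n) powr (1 / \<alpha>))"
    unfolding AE_all_countable using E(3) by (auto intro!: AE_impI)
  moreover note local_time_mono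
  ultimately show ?thesis
  proof eventually_elim
    case (elim \<omega>)
    obtain m where m: "\<And>n. n \<ge> m \<Longrightarrow> \<omega> \<notin> E n" using elim(1) by blast
    define m' where "m' = max m n\<^sub>0"
    define K where "K = \<Lambda> * 4 powr (1 - 1 / \<alpha>) * 8 powr (1 / \<alpha>)"
    have K: "0 < K" unfolding K_def using \<Lambda> by simp
    have "?ratio \<omega> r \<le> ereal K"
      if r: "0 < r" "r < 1 / 2 ^ m'" for r
    proof -
      obtain n where n: "m' \<le> n" "1 / 2 ^ Suc n < r" "r \<le> 1 / 2 ^ n"
        using dyadic_scale[OF r(1) less_imp_le[OF r(2)]] by blast
      have nn: "n \<ge> m" "n \<ge> n\<^sub>0" using n(1) unfolding m'_def by auto
      have n4: "4 \<le> n" and h\<tau>: "h n < \<tau>" using n\<^sub>0[OF nn(2)] by auto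
      have hr: "2 * h n \<le> 4 * r" "r \<le> h n" using n(2,3) unfolding h_def by (auto simp: field_simps)
      have ln_n: "0 < ln (real n)" using n4 by (intro ln_gt_zero) auto
      have lnln: "ln (real n) / 2 \<le> ln (ln (1 / r))"
      proof -
        have "2 ^ n \<le> 1 / r" using n(3) r(1) by (simp add: field_simps)
        then have "ln (2 ^ n) \<le> ln (1 / r)" using r(1) by (intro ln_mono) auto
        then have 1: "real n * ln 2 \<le> ln (1 / r)" by (simp add: ln_realpow)
        have "sqrt (real n) * 2 \<le> sqrt (real n) * sqrt (real n)"
          using n4 by (intro mult_left_mono real_le_rsqrt) auto
        then have "sqrt (real n) \<le> real n * (1 / 2)" by simp
        also have "\<dots> \<le> real n * ln 2" using ln2_ge_two_thirds by (intro mult_left_mono) auto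
        finally have "sqrt (real n) \<le> ln (1 / r)" using 1 by simp
        then have "ln (sqrt (real n)) \<le> ln (ln (1 / r))" using n4 by (intro ln_mono) auto
        then show ?thesis using n4 by (simp add: ln_sqrt)
      qed
      have ll: "0 < ln (ln (1 / r))" using lnln ln_n by linarith
      define D where "D = r powr (1 - 1 / \<alpha>) * ln (ln (1 / r)) powr (1 / \<alpha>)"
      have D: "0 < D" unfolding D_def using r(1) ll by simp
      have "L x (\<tau> + r) \<omega> - L x (\<tau> - r) \<omega> \<le> K * D" for x
      proof -
        have "L x (\<tau> + r) \<omega> \<le> L x (\<tau> + h n) \<omega>" "L x (\<tau> - h n) \<omega> \<le> L x (\<tau> - r) \<omega>"
          using elim(3) hr(2) h\<tau> r(1) by auto
        then have "L x (\<tau> + r) \<omega> - L x (\<tau> - r) \<omega> \<le> L x (\<tau> + h n) \<omega> - L x (\<tau> - h n) \<omega>" by simp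
        also have "\<dots> \<le> \<Lambda> * (2 * h n) powr (1 - 1 / \<alpha>) * real (p n) powr (1 / \<alpha>)"
          using elim(2) nn m by blast
        also have "\<dots> \<le> \<Lambda> * (4 * r) powr (1 - 1 / \<alpha>) * (8 * ln (ln (1 / r))) powr (1 / \<alpha>)"
        proof -
          have "(2 * h n) powr (1 - 1 / \<alpha>) \<le> (4 * r) powr (1 - 1 / \<alpha>)"
            by (rule powr_mono2[OF _ _ hr(1)]) (use \<alpha> in \<open>simp_all add: h_def\<close>)
          moreover have "real (p n) \<le> 8 * ln (ln (1 / r))" using p_le[of n] n4 lnln by linarith
          then have "real (p n) powr (1 / \<alpha>) \<le> (8 * ln (ln (1 / r))) powr (1 / \<alpha>)"
            by (rule powr_mono2[rotated 2]) (use \<alpha> in simp_all)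
          ultimately show ?thesis
            using \<Lambda> by (intro mult_mono[OF mult_left_mono]) simp_all
        qed
        also have "\<dots> = K * D" unfolding K_def D_def using r(1) ll by (simp add: powr_mult)
        finally show ?thesis .
      qed
      moreover have "Sup {\<tau> - r..\<tau> + r} = \<tau> + r" "Inf {\<tau> - r..\<tau> + r} = \<tau> - r"
        using r(1) by simp_all
      ultimately have "max_local_time L {\<tau> - r..\<tau> + r} \<omega> \<le> ereal (K * D)"
        using K D by (intro max_local_time_le) auto
      then show ?thesis using ereal_quotient_le D unfolding D_def by blast
    qed
    then have "eventually (\<lambda>r. ?ratio \<omega> r \<le> ereal K) (at_right 0)"
      by (intro eventually_at_rightI[of 0 "1 / 2 ^ m'"]) auto
    then have "Limsup (at_right 0) (\<lambda>r. ?ratio \<omega> r) \<le> ereal K"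
      by (rule Limsup_bounded)
    also have "\<dots> < \<infinity>" by simp
    finally show ?case .
  qed
qed

text \<open>Every interval of length less than \<open>r \<le> 2 ^ (- n)\<close> in \<open>[0, N]\<close> lies in one of the at most
  \<open>N * 2 ^ n + 1\<close> intervals \<open>[j / 2 ^ n, (j + 2) / 2 ^ n]\<close>. With \<open>p = 2 * n\<close> the union bound over them is
  summable, since \<open>2 * exp (- 2) < 1\<close>.\<close>
lemma local_time_uniform_modulus:
  assumes N: "0 < N"
  shows "AE \<omega> in M. Limsup (at_right 0) (\<lambda>r.
              SUP I\<in>{I. is_interval I \<and> I \<subseteq> {0..N} \<and> measure lborel I < r}. max_local_time L I \<omega> /
                  ereal (r powr (1 - 1 / \<alpha>) * ln (1 / r) powr (1 / \<alpha>))) < \<infinity>"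
proof -
  let ?ratio = "\<lambda>\<omega> r. SUP I\<in>{I. is_interval I \<and> I \<subseteq> {0..N} \<and> measure lborel I < r}.
      max_local_time L I \<omega> / ereal (r powr (1 - 1 / \<alpha>) * ln (1 / r) powr (1 / \<alpha>))"
  obtain \<Lambda> p\<^sub>0 where \<Lambda>: "0 < \<Lambda>" and tail:
    "\<And>p a b. \<lbrakk>even p; 0 < p; p\<^sub>0 \<le> real p; 0 \<le> a; a < b; b - a \<le> 1\<rbrakk> \<Longrightarrow> \<exists>E. increment_tail \<Lambda> p a b E"
    using local_time_tail by blast
  define h where "h n = (1 / 2 ^ n :: real)" for n :: nat
  have h_pos: "0 < h n" for n unfolding h_def by simp
  define B where "B n = \<Lambda> * (2 * h n) powr (1 - 1 / \<alpha>) * real (2 * n) powr (1 / \<alpha>)" for n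
  obtain n\<^sub>0 where n\<^sub>0: "1 \<le> n\<^sub>0" "p\<^sub>0 \<le> real n\<^sub>0"
  proof -
    obtain k where "p\<^sub>0 < real k" using reals_Archimedean2 by blast
    then show ?thesis using that[of "Suc k"] by simp
  qed
  have ex: "\<exists>E. increment_tail \<Lambda> (2 * n) (real j * h n) (real j * h n + 2 * h n) E" if n: "n \<ge> n\<^sub>0" for n j
  proof (rule tail)
    have "(2::real) ^ 1 \<le> 2 ^ n" using n n\<^sub>0 by (intro power_increasing) auto
    then show "real j * h n + 2 * h n - real j * h n \<le> 1" unfolding h_def by simp
  qed (use n n\<^sub>0 h_pos[of n] in auto)
  define E where "E n j = (SOME E. increment_tail \<Lambda> (2 * n) (real j * h n) (real j * h n + 2 * h n) E)" for n j
  have E_tail: "increment_tail \<Lambda> (2 * n) (real j * h n) (real j * h n + 2 * h n) (E n j)" if "n \<ge> n\<^sub>0" for n j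
    unfolding E_def by (rule someI_ex[OF ex[OF that]])
  have length: "real j * h n + 2 * h n - real j * h n = 2 * h n" for n j by simp
  note E = E_tail[unfolded increment_tail_def length, folded B_def, THEN conjunct1]
    E_tail[unfolded increment_tail_def length, folded B_def, THEN conjunct2, THEN conjunct1]
    E_tail[unfolded increment_tail_def length, folded B_def, THEN conjunct2, THEN conjunct2]
  define J where "J n = nat \<lfloor>N * 2 ^ n\<rfloor>" for n :: nat
  have "AE \<omega> in M. \<exists>m. \<forall>n\<ge>m. \<omega> \<notin> (\<Union>j\<in>{..J n}. E n j)"
  proof (rule borel_cantelli_exp)
    show "(\<Union>j\<in>{..J n}. E n j) \<in> sets M" if "n \<ge> n\<^sub>0" for n
      using E(1)[OF that] by (intro sets.finite_UN) auto
    show "prob (\<Union>j\<in>{..J n}. E n j) \<le> (N + 1) * (2 * exp (- 2)) ^ n" if n: "n \<ge> n\<^sub>0" for n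
    proof -
      have "prob (\<Union>j\<in>{..J n}. E n j) \<le> (\<Sum>j\<in>{..J n}. prob (E n j))"
        using E(1)[OF n] by (intro finite_measure_subadditive_finite) auto
      also have "\<dots> \<le> (\<Sum>j\<in>{..J n}. exp (- real (2 * n)))"
        using E(2)[OF n] by (intro sum_mono)
      also have "\<dots> = (real (J n) + 1) * exp (- real (2 * n))" by simp
      also have "\<dots> \<le> ((N + 1) * 2 ^ n) * exp (- real (2 * n))"
      proof (rule mult_right_mono)
        have "real (J n) \<le> N * 2 ^ n" unfolding J_def using N by (simp add: of_nat_floor)
        moreover have "(1::real) \<le> 2 ^ n" by simp
        ultimately show "real (J n) + 1 \<le> (N + 1) * 2 ^ n" unfolding distrib_right by linarith
      qed simp
      also have "\<dots> = (N + 1) * (2 * exp (- 2)) ^ n"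
        by (simp add: power_mult_distrib exp_of_nat_mult[symmetric] mult.commute)
      finally show ?thesis .
    qed
    have "(2::real) < exp 2" using exp_ge_add_one_self[of "2::real"] by linarith
    then have "2 * exp (- 2) < (1::real)" by (simp add: exp_minus field_simps)
    then show "summable (\<lambda>n. (N + 1) * (2 * exp (- 2)) ^ n)"
      by (intro summable_mult summable_geometric) auto
  qed
  moreover have "AE \<omega> in M. \<forall>n j. n \<ge> n\<^sub>0 \<longrightarrow> \<omega> \<notin> E n j \<longrightarrow>
        (\<forall>x. L x (real j * h n + 2 * h n) \<omega> - L x (real j * h n) \<omega> \<le> B n)"
    unfolding AE_all_countable using E(3) by (auto intro!: AE_impI)
  moreover note local_time_mono
  ultimately show ?thesis
  proof eventually_elim
    case (elim \<omega>)
    obtain m where m: "\<And>n j. n \<ge> m \<Longrightarrow> j \<le> J n \<Longrightarrow> \<omega> \<notin> E n j" using elim(1) by auto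
    define m' where "m' = max m n\<^sub>0"
    define K where "K = \<Lambda> * 4 powr (1 - 1 / \<alpha>) * 4 powr (1 / \<alpha>)"
    have K: "0 < K" unfolding K_def using \<Lambda> by simp
    have "?ratio \<omega> r \<le> ereal K"
      if r: "0 < r" "r < 1 / 2 ^ m'" for r
    proof -
      obtain n where n: "m' \<le> n" "1 / 2 ^ Suc n < r" "r \<le> 1 / 2 ^ n"
        using dyadic_scale[OF r(1) less_imp_le[OF r(2)]] by blast
      have nn: "n \<ge> m" "n \<ge> n\<^sub>0" "n \<ge> 1" using n(1) n\<^sub>0 unfolding m'_def by auto
      have hr: "2 * h n \<le> 4 * r" "r \<le> h n" using n(2,3) unfolding h_def by (auto simp: field_simps)
      have ln_r: "real n / 2 \<le> ln (1 / r)"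
      proof -
        have "2 ^ n \<le> 1 / r" using n(3) r(1) by (simp add: field_simps)
        then have "ln (2 ^ n) \<le> ln (1 / r)" using r(1) by (intro ln_mono) auto
        then have 1: "real n * ln 2 \<le> ln (1 / r)" by (simp add: ln_realpow)
        have "real n * (1 / 2) \<le> real n * ln 2" using ln2_ge_two_thirds by (intro mult_left_mono) auto
        then show ?thesis using 1 by simp
      qed
      have ll: "0 < ln (1 / r)" using ln_r nn(3) by (intro less_le_trans[OF _ ln_r]) simp
      define D where "D = r powr (1 - 1 / \<alpha>) * ln (1 / r) powr (1 / \<alpha>)"
      have D: "0 < D" unfolding D_def using r(1) ll by simp
      have B_le: "B n \<le> K * D"
      proof -
        have "B n \<le> \<Lambda> * (4 * r) powr (1 - 1 / \<alpha>) * (4 * ln (1 / r)) powr (1 / \<alpha>)"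
        proof -
          have "(2 * h n) powr (1 - 1 / \<alpha>) \<le> (4 * r) powr (1 - 1 / \<alpha>)"
            by (rule powr_mono2[OF _ _ hr(1)]) (use \<alpha> in \<open>simp_all add: h_def\<close>)
          moreover have "real (2 * n) \<le> 4 * ln (1 / r)" using ln_r by simp
          then have "real (2 * n) powr (1 / \<alpha>) \<le> (4 * ln (1 / r)) powr (1 / \<alpha>)"
            by (rule powr_mono2[rotated 2]) (use \<alpha> in simp_all)
          ultimately show ?thesis
            unfolding B_def
            using \<Lambda> by (intro mult_mono[OF mult_left_mono]) simp_all
        qed
        also have "\<dots> = K * D" unfolding K_def D_def using r(1) ll by (simp add: powr_mult)
        finally show ?thesis .
      qed
      have "max_local_time L I \<omega> \<le> ereal (K * D)"
        if I: "is_interval I" "I \<subseteq> {0..N}" "measure lborel I < r" for I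
      proof (cases "I = {}")
        case True
        then show ?thesis using K D unfolding max_local_time_def local_time_on_def by simp
      next
        case False
        define s t where "s = Inf I" and "t = Sup I"
        have st: "t - s < r" "0 \<le> s" "s \<le> t"
          using interval_length_le[OF I(1) False I(2)] I(3) unfolding s_def t_def by auto
        have tN: "t \<le> N" unfolding t_def using False I(2) by (intro cSup_least) auto
        define j where "j = nat \<lfloor>s * 2 ^ n\<rfloor>"
        have "j \<le> J n" unfolding j_def J_def using st tN by (intro nat_mono floor_mono mult_right_mono) auto
        then have notin: "\<omega> \<notin> E n j" using m nn by blast
        have "real j \<le> s * 2 ^ n" unfolding j_def using st by (simp add: of_nat_floor)
        then have 1: "real j * h n \<le> s" unfolding h_def by (simp add: pos_divide_le_eq)
        have "s * 2 ^ n \<le> real j + 1" unfolding j_def using st by linarith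
        then have "s \<le> (real j + 1) * h n" unfolding h_def by (simp add: pos_le_divide_eq)
        then have 2: "t \<le> real j * h n + 2 * h n" using st(1) hr(2) by (simp add: distrib_right)
        have "L x t \<omega> - L x s \<omega> \<le> K * D" for x
        proof -
          have "L x (real j * h n) \<omega> \<le> L x s \<omega>" "L x t \<omega> \<le> L x (real j * h n + 2 * h n) \<omega>"
            using elim(3) 1 2 st h_pos[of n] by auto
          moreover have "L x (real j * h n + 2 * h n) \<omega> - L x (real j * h n) \<omega> \<le> B n"
            using elim(2) nn(2) notin by blast
          ultimately show ?thesis using B_le by simp
        qed
        then show ?thesis using K D unfolding s_def t_def by (intro max_local_time_le) auto
      qed
      then show ?thesis unfolding D_def[symmetric] using D by (auto intro!: SUP_least ereal_quotient_le)
    qed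
    then have "eventually (\<lambda>r. ?ratio \<omega> r \<le> ereal K) (at_right 0)"
      by (intro eventually_at_rightI[of 0 "1 / 2 ^ m'"]) auto
    then have "Limsup (at_right 0) (\<lambda>r. ?ratio \<omega> r) \<le> ereal K"
      by (rule Limsup_bounded)
    also have "\<dots> < \<infinity>" by simp
    finally show ?case .
  qed
qed

end

section \<open>Maximal local times of Levy processes with regularly scaling exponent\<close>

theorem theorem4p4:
  fixes M :: "'a measure"
    and X :: "real \<Rightarrow> 'a \<Rightarrow> real"
    and \<psi> :: "real \<Rightarrow> real"
    and L :: "real \<Rightarrow> real \<Rightarrow> 'a \<Rightarrow> real"
    and \<alpha> \<theta>\<^sub>1 \<theta>\<^sub>2 c C \<tau> N :: real
  assumes "levy_process M X"
    and "symmetric_process M X"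
    and "unimodal_process M X"
    and "has_char_exponent M X (\<lambda>\<xi>. complex_of_real (\<psi> \<xi>))"
    and "pure_jump_exponent \<psi>"
    and "\<alpha> > 1"
    and "0 \<le> \<theta>\<^sub>1" and "0 \<le> \<theta>\<^sub>2" and "c \<in> {0<..1}" and "C \<in> {1..}"
    and "\<psi> \<in> WLSC \<alpha> \<theta>\<^sub>1 c \<inter> WUSC \<alpha> \<theta>\<^sub>2 C"
    and "jointly_continuous_local_time M X L"
    and "\<tau> > 0" and "N > 0"
  shows "(AE \<omega> in M.
            Limsup (at_right 0) (\<lambda>r. max_local_time L {\<tau> - r..\<tau> + r} \<omega> /
              ereal (r powr (1 - 1 / \<alpha>) * ln (ln (1 / r)) powr (1 / \<alpha>))) < \<infinity>) \<and>
         (AE \<omega> in M.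
            Limsup (at_right 0) (\<lambda>r.
              SUP I\<in>{I. is_interval I \<and> I \<subseteq> {0..N} \<and> measure lborel I < r}.
                max_local_time L I \<omega> /
                  ereal (r powr (1 - 1 / \<alpha>) * ln (1 / r) powr (1 / \<alpha>))) < \<infinity>)"
proof -
  have lower: "\<psi> \<in> WLSC \<alpha> \<theta>\<^sub>1 c" using assms(11) by simp
  interpret levy_local_time M X \<psi> L \<alpha> \<theta>\<^sub>1 c
    using assms(1,4,12,6) lower by (simp add: levy_local_time_def levy_local_time_axioms_def)
  show ?thesis
    using local_time_iterated_log[OF assms(13)] local_time_uniform_modulus[OF assms(14)] by blast
qed

end
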